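(* Fix an even integer $d\geq 2$. Let $\Omega\subset\mathbb{R}^d$ be an open subset and $P$ a Borel probability measure on $\mathbb{R}^d$. Assume that $P$ admits a bounded density $f_P$ on $\mathbb{R}^d$ with respect to the Lebesgue measure and that $f_P\in\mathcal{C}^{0,\beta}_{\mathrm{loc}}(\Omega)$ for some $\beta\in(0,1)$. Let $P^*$ be the probability measure on $\mathbb{R}^{d+1}$ supported on the hyperplane $x_{d+1}=0$ with density $f_P$ with respect to the $d$-dimensional Hausdorff measure $\mathcal{H}_d$ (i.e. $P^*(A)=\int_{\mathbb{R}^d}\mathbb{I}[(x,0)\in A]f_P(x)\,dx$). Define $u=\gamma_d\,(-\Delta)^{(d-2)/2}(\nabla\cdot F_P^{\mathrm g})$ (a function on $\mathbb{R}^d$) and $$U(x^* )=2\gamma_{d+1}\,(-\Delta)^{(d-2)/2}(\nabla\cdot F_{P^*}^{\mathrm g})(x^* )\quad\text{for all }x^*\in\mathbb{R}^{d+1}_+:=\mathbb{R}^d\times(0,\infty).$$ Then: (i) $U\in\mathcal{C}^\infty(\mathbb{R}^{d+1}_+)$ and $-\Delta U=0$ on $\mathbb{R}^{d+1}_+$; (ii) $U$ extends continuously on $\Omega\times[0,\infty)$ with $U(x,0)=u(x)$ for all $x\in\Omega$; (iii) for all $x\in\Omega$, $$f_P(x)=((-\Delta)^{1/2}u)(x)=\lim_{\varepsilon\downarrow 0}-(\partial_{d+1}U)(x,\varepsilon).$$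
   Context: Geometric cdf: for a Borel probability measure $P$ on $\mathbb{R}^m$ and $Z\sim P$, $F_P^{\mathrm g}:\mathbb{R}^m\to\mathbb{R}^m$ is $F_P^{\mathrm g}(x)=\mathbb{E}\big[\frac{x-Z}{\|x-Z\|}\mathbb{I}[Z\neq x]\big]$. For $m\ge1$, $\gamma_m^{-1}=2^m\pi^{(m-1)/2}\Gamma((m+1)/2)$. $(-\Delta)^{(d-2)/2}$ denotes $-\Delta$ iterated $(d-2)/2$ times (identity if $d=2$); $\nabla\cdot$ is the divergence. Under the boundedness assumption, $F_P^{\mathrm g}\in\mathcal{C}^{d-1}(\mathbb{R}^d)$, so $u$ is a bounded continuous function on $\mathbb{R}^d$; and $F_{P^*}^{\mathrm g}\in\mathcal{C}^\infty(\mathbb{R}^{d+1}_+)$. $f_P\in\mathcal{C}^{0,\beta}_{\mathrm{loc}}(\Omega)$ means that $f_P$ is bounded and $\beta$-Hölder continuous on every compact subset of $\Omega$. For $\psi$ in the Schwartz class $\mathcal{S}(\mathbb{R}^d)$, $(-\Delta)^{1/2}\psi:=2\pi\,\mathcal{F}^{-1}(\|\xi\|(\mathcal{F}\psi)(\xi))$ with $(\mathcal{F}\psi)(\xi)=\int\psi(x)e^{-2i\pi\langle x,\xi\rangle}dx$; one has $\sup_x(1+\|x\|^{d+1})|(-\Delta)^{1/2}\psi(x)|<\infty$. For the bounded function $u$, $(-\Delta)^{1/2}u$ is the tempered distribution $\psi\mapsto\int_{\mathbb{R}^d}u(x)((-\Delta)^{1/2}\psi)(x)\,dx$. The first equality in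 (iii) means that the restriction of this distribution to $\Omega$ is a continuous function equal to $f_P$ at every point of $\Omega$. *)

theory Defs
  imports "HOL-Probability.Probability"
begin

text \<open>The derivative of \<open>f\<close> at \<open>x\<close> in direction \<open>b\<close>; only meaningful where it exists.\<close>

definition partial_deriv ::
    "'a::euclidean_space \<Rightarrow> ('a \<Rightarrow> 'b::real_normed_vector) \<Rightarrow> 'a \<Rightarrow> 'b" where
  "partial_deriv b f x = vector_derivative (\<lambda>t. f (x + t *\<^sub>R b)) (at 0)"

text \<open>A list of basis vectors plays the role of a multi-index.\<close>

definition iter_partial ::
    "'a::euclidean_space list \<Rightarrow> ('a \<Rightarrow> 'b::real_normed_vector) \<Rightarrow> 'a \<Rightarrow> 'b" where
  "iter_partial bs f = foldr partial_deriv bs f"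

text \<open>The class \<open>C\<^sup>\<infinity>(S)\<close> for an open set \<open>S\<close>: all partial derivatives of all orders
  exist and are continuous.\<close>

definition smooth_on ::
    "'a::euclidean_space set \<Rightarrow> ('a \<Rightarrow> 'b::real_normed_vector) \<Rightarrow> bool" where
  "smooth_on S f \<longleftrightarrow>
     (\<forall>bs \<in> lists Basis.
        continuous_on S (iter_partial bs f) \<and>
        (\<forall>x \<in> S. \<forall>b \<in> Basis. (\<lambda>t. iter_partial bs f (x + t *\<^sub>R b)) differentiable (at 0)))"

definition divergence :: "('a::euclidean_space \<Rightarrow> 'a) \<Rightarrow> 'a \<Rightarrow> real" where
  "divergence F x = (\<Sum>b\<in>Basis. partial_deriv b (\<lambda>y. F y \<bullet> b) x)"

definition neg_laplacian :: "('a::euclidean_space \<Rightarrow> real) \<Rightarrow> 'a \<Rightarrow> real" where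
  "neg_laplacian f x = - (\<Sum>b\<in>Basis. partial_deriv b (partial_deriv b f) x)"

definition holder_loc :: "real \<Rightarrow> 'a::euclidean_space set \<Rightarrow> ('a \<Rightarrow> real) \<Rightarrow> bool" where
  "holder_loc \<beta> \<Omega> f \<longleftrightarrow>
     (\<forall>K. compact K \<and> K \<subseteq> \<Omega> \<longrightarrow>
        bounded (f ` K) \<and>
        (\<exists>C. \<forall>x\<in>K. \<forall>y\<in>K. \<bar>f x - f y\<bar> \<le> C * norm (x - y) powr \<beta>))"

definition geometric_cdf :: "'a::euclidean_space measure \<Rightarrow> 'a \<Rightarrow> 'a" where
  "geometric_cdf P x = (LINT z|P. (if z \<noteq> x then (x - z) /\<^sub>R norm (x - z) else 0))"

definition gamma_const :: "nat \<Rightarrow> real" where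
  "gamma_const m = inverse (2 ^ m * pi powr ((real m - 1) / 2) * Gamma ((real m + 1) / 2))"

definition fourier :: "('a::euclidean_space \<Rightarrow> complex) \<Rightarrow> 'a \<Rightarrow> complex" where
  "fourier \<psi> \<xi> = (LINT x|lborel. \<psi> x * exp (- 2 * \<i> * complex_of_real (pi * (x \<bullet> \<xi>))))"

definition inverse_fourier :: "('a::euclidean_space \<Rightarrow> complex) \<Rightarrow> 'a \<Rightarrow> complex" where
  "inverse_fourier g x = (LINT \<xi>|lborel. g \<xi> * exp (2 * \<i> * complex_of_real (pi * (x \<bullet> \<xi>))))"

definition half_laplacian :: "('a::euclidean_space \<Rightarrow> complex) \<Rightarrow> 'a \<Rightarrow> complex" where
  "half_laplacian \<psi> x =
     2 * complex_of_real pi * inverse_fourier (\<lambda>\<xi>. complex_of_real (norm \<xi>) * fourier \<psi> \<xi>) x"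

text \<open>\<open>half_laplacian\<close>, and hence \<open>half_laplacian_distr u\<close>, is only meaningful on
  Schwartz functions; the latter is the tempered distribution \<open>(-\<Delta>)\<^sup>1\<^sup>/\<^sup>2 u\<close> given by
  its action on them. It is only ever evaluated on \<open>test_functions\<close>, which are Schwartz.\<close>

definition half_laplacian_distr ::
    "('a::euclidean_space \<Rightarrow> real) \<Rightarrow> ('a \<Rightarrow> complex) \<Rightarrow> complex" where
  "half_laplacian_distr u \<psi> = (LINT x|lborel. complex_of_real (u x) * half_laplacian \<psi> x)"

definition test_functions :: "'a::euclidean_space set \<Rightarrow> ('a \<Rightarrow> complex) set" where
  "test_functions \<Omega> =
     {\<psi>. smooth_on UNIV \<psi> \<and> compact (closure {x. \<psi> x \<noteq> 0}) \<and> closure {x. \<psi> x \<noteq> 0} \<subseteq> \<Omega>}"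

text \<open>The restriction of the distribution \<open>T\<close> to the open set \<open>\<Omega>\<close> is the continuous
  function \<open>g\<close>.\<close>

definition restricts_to_continuous ::
    "(('a::euclidean_space \<Rightarrow> complex) \<Rightarrow> complex) \<Rightarrow> 'a set \<Rightarrow> ('a \<Rightarrow> real) \<Rightarrow> bool" where
  "restricts_to_continuous T \<Omega> g \<longleftrightarrow>
     continuous_on \<Omega> g \<and>
     (\<forall>\<psi> \<in> test_functions \<Omega>. T \<psi> = (LINT x:\<Omega>|lborel. complex_of_real (g x) * \<psi> x))"

end

theory Submission
  imports Defs
begin

text \<open>
  Differentiating under the integral sign, both \<open>u\<close> and \<open>U\<close> become the same constant times the
  potential of \<open>f\<close> with kernel \<open>1 / \<bar>w\<bar>\<^sup>d\<^sup>-\<^sup>1\<close> on \<open>\<real>\<^sup>d \<times> \<real>\<close>, restricted to the hyperplane for \<open>u\<close>. The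
  kernels met on the way are homogeneous of degree at least \<open>1 - d\<close>, hence locally integrable on
  the hyperplane, and such potentials are continuous on all of \<open>\<real>\<^sup>d \<times> \<real>\<close>; this gives (ii) and
  transports horizontal derivatives from the half spaces to the hyperplane. The kernel is harmonic
  off the origin, and its normal derivative is the Poisson kernel, an approximate identity.

  For the distribution, \<open>u\<close> is a Riesz potential of \<open>f\<close>, so by Fubini it is enough that the Riesz
  potential of \<open>(-\<Delta>)\<^sup>1\<^sup>/\<^sup>2 \<psi>\<close> is \<open>\<psi>\<close>. Powers of \<open>\<bar>x\<bar>\<close> are superpositions of Gaussians, which
  turns this into Fourier inversion. All Gamma integrals are taken in logarithmic scale
  \<open>\<integral> exp (s v - a exp v) dv\<close> over the whole line, so that inverting the Gaussian parameter is a
  mere reflection.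
\<close>

section \<open>Integration tools\<close>

text \<open>The kernel of the geometric cdf is \<open>w / norm w\<close>; its divergence is a
  multiple of \<open>1 / norm w\<close>, and each \<open>neg_laplacian\<close> raises the exponent
  by 2. As \<open>d\<close> is even, \<open>(d - 2) div 2\<close> steps end at order d - 1, the
  largest integer order that is locally integrable on the hyperplane. At order m a step contributes
  m (d - 2 - m) on the hyperplane but m (d - 1 - m) in d + 1 dimensions. The d-dimensional Laplacian
  is not a restriction of the other one, so \<open>u\<close> being the boundary value of
  \<open>U\<close> is no formality: it rests on both products, weighted by their
  \<open>gamma_const\<close>, being the same \<open>riesz_const\<close>. That constant also gives
  the Poisson kernel mass one and makes the kernel invert the half Laplacian. The kernel of order d
  - 1 is not integrable at infinity, so its Fourier transform is no absolutely convergent integral;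
  the Gaussian superposition keeps every interchange absolutely convergent. Local integrability is
  obtained without polar coordinates, from a Poisson kernel whose mass does not depend on the
  height.\<close>

lemma has_vector_derivative_lebesgue_integral:
  fixes g g' :: "real \<Rightarrow> 'a \<Rightarrow> 'b::{banach, second_countable_topology}"
  assumes "0 < r"
    and int: "\<And>t. \<bar>t\<bar> < r \<Longrightarrow> integrable M (g t)"
    and deriv: "\<And>t x. \<bar>t\<bar> < r \<Longrightarrow> x \<in> space M \<Longrightarrow>
      ((\<lambda>s. g s x) has_vector_derivative g' t x) (at t)"
    and bound: "\<And>t x. \<bar>t\<bar> < r \<Longrightarrow> x \<in> space M \<Longrightarrow> norm (g' t x) \<le> h x"
    and h: "integrable M h"
  shows "((\<lambda>t. \<integral>x. g t x \<partial>M) has_vector_derivative (\<integral>x. g' 0 x \<partial>M)) (at 0)"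
proof -
  define q where "q t x = (g t x - g 0 x) /\<^sub>R t" for t x
  have q_lim: "((\<lambda>t. q t x) \<longlongrightarrow> g' 0 x) (at 0)" if "x \<in> space M" for x
  proof -
    have "((\<lambda>s. g s x) has_vector_derivative g' 0 x) (at 0)"
      using deriv[of 0 x] that \<open>0 < r\<close> by simp
    then have "((\<lambda>t. norm (g t x - g 0 x - t *\<^sub>R g' 0 x) / norm t) \<longlongrightarrow> 0) (at 0)"
      by (auto simp: has_vector_derivative_def has_derivative_at)
    moreover have "norm (g t x - g 0 x - t *\<^sub>R g' 0 x) / norm t = norm (q t x - g' 0 x)"
      if "t \<noteq> 0" for t
    proof -
      have "q t x - g' 0 x = (g t x - g 0 x - t *\<^sub>R g' 0 x) /\<^sub>R t"
        using that by (simp add: q_def algebra_simps)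
      then show ?thesis by (simp add: divide_inverse mult.commute)
    qed
    ultimately have "((\<lambda>t. norm (q t x - g' 0 x)) \<longlongrightarrow> 0) (at 0)"
      by (elim Lim_transform_eventually) (auto simp: eventually_at_filter)
    then show ?thesis
      using Lim_null tendsto_norm_zero_iff by blast
  qed
  \<comment> \<open>The mean value inequality turns the bound on \<open>g'\<close> into one on the
    difference quotients, so that \<open>h\<close> dominates the whole family. At t = 0 the quotient
    is 0 by convention.\<close>
  have q_bound: "norm (q t x) \<le> h x" if t: "\<bar>t\<bar> < r" and x: "x \<in> space M" for t x
  proof (cases "t = 0")
    case True
    with bound[of 0 x] that show ?thesis
      by (simp add: q_def) (smt (verit) norm_ge_zero)
  next
    case False
    have "norm (g t x - g 0 x) \<le> h x * norm (t - 0)"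
    proof (rule differentiable_bound[of "{-r<..<r}"])
      show "((\<lambda>s. g s x) has_derivative (\<lambda>s. s *\<^sub>R g' u x)) (at u within {-r<..<r})"
        if "u \<in> {-r<..<r}" for u
        using deriv[of u x] that x
        by (auto simp: has_vector_derivative_def intro: has_derivative_at_withinI)
      show "onorm (\<lambda>s. s *\<^sub>R g' u x) \<le> h x" if "u \<in> {-r<..<r}" for u
        using bound[of u x] that x
        by (intro onorm_le) (auto simp: mult.commute[of "h x"] intro!: mult_left_mono)
    qed (use t \<open>0 < r\<close> in auto)
    moreover have "norm (q t x) = norm (g t x - g 0 x) / \<bar>t\<bar>"
      by (simp add: q_def divide_inverse mult.commute)
    ultimately show ?thesis
      using False by (simp add: divide_le_eq mult.commute)
  qed
  have "((\<lambda>t. norm ((\<integral>x. q t x \<partial>M) - (\<integral>x. g' 0 x \<partial>M))) \<longlongrightarrow> 0) (at 0)"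
  proof (rule tendsto_norm_zero, rule LIM_zero, unfold tendsto_at_iff_sequentially, safe)
    fix X :: "nat \<Rightarrow> real" assume X: "\<forall>i. X i \<in> UNIV - {0}" "X \<longlonglongrightarrow> 0"
    from X(2) have "\<forall>\<^sub>F i in sequentially. dist (X i) 0 < r"
      using \<open>0 < r\<close> by (rule tendstoD)
    then obtain N where N: "\<And>i. i \<ge> N \<Longrightarrow> \<bar>X i\<bar> < r"
      by (auto simp: eventually_sequentially)
    \<comment> \<open>Dropping finitely many terms keeps every parameter inside the radius, so the
      domination holds for all indices; \<open>LIMSEQ_offset\<close> puts the terms back.\<close>
    define Y where "Y i = X (i + N)" for i
    have Y: "\<bar>Y i\<bar> < r" "Y i \<noteq> 0" for i
      using N X(1) by (auto simp: Y_def)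
    have YX: "Y \<longlonglongrightarrow> 0"
      unfolding Y_def using X(2) by (rule LIMSEQ_ignore_initial_segment)
    have lim: "(\<lambda>i. q (Y i) x) \<longlonglongrightarrow> g' 0 x" if "x \<in> space M" for x
      using q_lim[OF that] YX Y(2) unfolding tendsto_at_iff_sequentially
      by (auto simp: o_def)
    have meas: "q (Y i) \<in> borel_measurable M" for i
      unfolding q_def using int[OF Y(1)[of i]] int[of 0] \<open>0 < r\<close> by (auto intro!: borel_measurable_scaleR borel_measurable_diff)
    have "(\<lambda>i. \<integral>x. q (Y i) x \<partial>M) \<longlonglongrightarrow> (\<integral>x. g' 0 x \<partial>M)"
    proof (rule integral_dominated_convergence[where w = h])
      \<comment> \<open>Measurability of \<open>g' 0\<close> is inherited from the difference
        quotients, whose pointwise limit it is.\<close>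
      show "g' 0 \<in> borel_measurable M"
        using meas lim by (rule borel_measurable_LIMSEQ_metric)
    qed (use meas lim q_bound Y h in auto)
    then have "(\<lambda>i. \<integral>x. q (X (i + N)) x \<partial>M) \<longlonglongrightarrow> (\<integral>x. g' 0 x \<partial>M)"
      by (simp add: Y_def)
    then show "((\<lambda>t. \<integral>x. q t x \<partial>M) \<circ> X) \<longlonglongrightarrow> (\<integral>x. g' 0 x \<partial>M)"
      unfolding o_def by (rule LIMSEQ_offset)
  qed
  moreover have "\<forall>\<^sub>F t in at 0. norm ((\<integral>x. q t x \<partial>M) - (\<integral>x. g' 0 x \<partial>M)) =
     norm ((\<integral>x. g t x \<partial>M) - (\<integral>x. g 0 x \<partial>M) - t *\<^sub>R (\<integral>x. g' 0 x \<partial>M)) / norm t"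
  proof -
    have "\<forall>\<^sub>F t::real in at 0. \<bar>t\<bar> < r \<and> t \<noteq> 0"
      using \<open>0 < r\<close> by (auto simp: eventually_at intro!: exI[of _ r])
    then show ?thesis
    proof eventually_elim
      case (elim t)
      have "(\<integral>x. q t x \<partial>M) = ((\<integral>x. g t x \<partial>M) - (\<integral>x. g 0 x \<partial>M)) /\<^sub>R t"
        unfolding q_def using int[of t] int[of 0] elim \<open>0 < r\<close> by simp
      then have "(\<integral>x. q t x \<partial>M) - (\<integral>x. g' 0 x \<partial>M) =
        ((\<integral>x. g t x \<partial>M) - (\<integral>x. g 0 x \<partial>M) - t *\<^sub>R (\<integral>x. g' 0 x \<partial>M)) /\<^sub>R t"
        using elim by (simp add: algebra_simps)
      then show ?case by (simp add: divide_inverse mult.commute)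
    qed
  qed
  ultimately have "((\<lambda>t. norm ((\<integral>x. g t x \<partial>M) - (\<integral>x. g 0 x \<partial>M) - t *\<^sub>R (\<integral>x. g' 0 x \<partial>M)) / norm t) \<longlongrightarrow> 0) (at 0)"
    by (rule Lim_transform_eventually)
  then show ?thesis
    by (auto simp: has_vector_derivative_def has_derivative_at bounded_linear_scaleR_left)
qed

text \<open>The mean value inequality for \<open>G r \<delta> - r * H s 0\<close> gives the error
  \<open>e * \<bar>y - s\<bar>\<close> on a radius that is the same for all small \<delta> other
  than 0, so the estimate survives \<delta> tending to 0. Joint continuity of \<open>H\<close> at
  the limit point supplies this uniformity. It carries derivatives from parallel hyperplanes over to
  the hyperplane itself.\<close>

lemma has_vector_derivative_limit:
  fixes G H :: "real \<Rightarrow> real \<Rightarrow> real"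
  assumes contG: "\<And>s. continuous_on UNIV (G s)"
    and contH: "isCont (\<lambda>p. H (fst p) (snd p)) (s, 0)"
    and deriv: "\<And>r \<delta>. \<delta> \<noteq> 0 \<Longrightarrow> ((\<lambda>r. G r \<delta>) has_vector_derivative H r \<delta>) (at r)"
  shows "((\<lambda>r. G r 0) has_vector_derivative H s 0) (at s)"
  unfolding has_vector_derivative_def has_derivative_within_alt
proof (safe intro!: bounded_linear_scaleR_left)
  fix e :: real assume "0 < e"
  then obtain \<eta> where \<eta>: "0 < \<eta>" "\<And>p. dist p (s, 0) < \<eta> \<Longrightarrow> \<bar>H (fst p) (snd p) - H s 0\<bar> < e"
    using contH unfolding continuous_at_eps_delta by (auto simp: dist_real_def)
  have est: "\<bar>G y \<delta> - G s \<delta> - (y - s) * H s 0\<bar> \<le> e * \<bar>y - s\<bar>"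
    if y: "\<bar>y - s\<bar> < \<eta> / 2" and \<delta>: "\<delta> \<noteq> 0" "\<bar>\<delta>\<bar> < \<eta> / 2" for y \<delta>
  proof -
    have "norm ((G y \<delta> - y * H s 0) - (G s \<delta> - s * H s 0)) \<le> e * norm (y - s)"
    proof (rule differentiable_bound[of "ball s (\<eta>/2)"])
      fix r assume r: "r \<in> ball s (\<eta>/2)"
      have "((\<lambda>r. G r \<delta> - r * H s 0) has_vector_derivative (H r \<delta> - H s 0)) (at r within ball s (\<eta>/2))"
        using has_vector_derivative_at_within[OF deriv[OF \<delta>(1), of r]]
        by (auto intro!: derivative_eq_intros
            simp flip: has_real_derivative_iff_has_vector_derivative)
      then show "((\<lambda>r. G r \<delta> - r * H s 0) has_derivative (\<lambda>h. h *\<^sub>R (H r \<delta> - H s 0))) (at r within ball s (\<eta>/2))"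
        by (simp add: has_vector_derivative_def)
      have "dist (r, \<delta>) (s, 0) \<le> dist r s + dist \<delta> 0"
        unfolding dist_Pair_Pair by (rule sqrt_sum_squares_le_sum) auto
      then have "dist (r, \<delta>) (s, 0) < \<eta>"
        using r \<delta> by (simp add: dist_commute)
      from \<eta>(2)[OF this] show "onorm (\<lambda>h. h *\<^sub>R (H r \<delta> - H s 0)) \<le> e"
        by (intro onorm_le) (auto simp: abs_mult mult.commute[of e] intro!: mult_left_mono)
    qed (use y \<eta>(1) in \<open>auto simp: dist_real_def abs_minus_commute\<close>)
    then show ?thesis by (simp add: algebra_simps)
  qed
  have "\<bar>G y 0 - G s 0 - (y - s) * H s 0\<bar> \<le> e * \<bar>y - s\<bar>" if y: "\<bar>y - s\<bar> < \<eta> / 2" for y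
  proof (rule tendsto_upperbound)
    have "(G y \<longlongrightarrow> G y 0) (at 0)" "(G s \<longlongrightarrow> G s 0) (at 0)"
      using contG by (auto simp: continuous_on_eq_continuous_at isCont_def)
    then show "((\<lambda>\<delta>. \<bar>G y \<delta> - G s \<delta> - (y - s) * H s 0\<bar>) \<longlongrightarrow> \<bar>G y 0 - G s 0 - (y - s) * H s 0\<bar>) (at 0)"
      by (intro tendsto_intros)
    show "\<forall>\<^sub>F \<delta> in at 0. \<bar>G y \<delta> - G s \<delta> - (y - s) * H s 0\<bar> \<le> e * \<bar>y - s\<bar>"
      unfolding eventually_at using est[OF y] \<eta>(1)
      by (intro exI[of _ "\<eta>/2"]) (auto simp: dist_real_def)
  qed auto
  then show "\<exists>d>0. \<forall>y\<in>UNIV. norm (y - s) < d \<longrightarrow>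
      norm (G y 0 - G s 0 - (y - s) *\<^sub>R H s 0) \<le> e * norm (y - s)"
    using \<eta>(1) by (intro exI[of _ "\<eta>/2"]) auto
qed

lemma
  fixes f :: "'a::euclidean_space \<Rightarrow> 'b::{banach, second_countable_topology}"
  assumes "c \<noteq> 0"
  shows lborel_integral_affine:
      "(\<integral>x. f x \<partial>lborel) = \<bar>c\<bar> ^ DIM('a) *\<^sub>R (\<integral>x. f (t + c *\<^sub>R x) \<partial>lborel)"
    and lborel_integrable_affine:
      "integrable lborel f \<Longrightarrow> integrable lborel (\<lambda>x. f (t + c *\<^sub>R x))"
proof -
  let ?D = "density (distr lborel borel (\<lambda>x. t + c *\<^sub>R x)) (\<lambda>_. \<bar>c\<bar> ^ DIM('a))"
  have eq: "(lborel :: 'a measure) = ?D"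
    using lborel_affine[OF assms, of t] by simp
  show int: "integrable lborel (\<lambda>x. f (t + c *\<^sub>R x))" if f: "integrable lborel f"
  proof -
    have [measurable]: "f \<in> borel_measurable borel" using f by auto
    have "integrable ?D f" using f eq by metis
    then have scaled: "integrable lborel (\<lambda>x. \<bar>c\<bar> ^ DIM('a) *\<^sub>R f (t + c *\<^sub>R x))"
      by (simp add: integrable_density integrable_distr_eq)
    show ?thesis
      using assms integrable_scaleR_right[of "1 / \<bar>c\<bar> ^ DIM('a)", OF scaled] by simp
  qed
  show "(\<integral>x. f x \<partial>lborel) = \<bar>c\<bar> ^ DIM('a) *\<^sub>R (\<integral>x. f (t + c *\<^sub>R x) \<partial>lborel)"
  proof (cases "f \<in> borel_measurable borel")
    case True
    note [measurable] = this
    have "(\<integral>x. f x \<partial>lborel) = (\<integral>x. f x \<partial>?D)" using eq by metis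
    then show ?thesis
      by (simp add: integral_density integral_distr)
  next
    case False
    \<comment> \<open>An affine bijection preserves non-measurability, so here both integrals take
      the default value 0 and the formula holds for every \<open>f\<close>.\<close>
    have "(\<lambda>x. f (t + c *\<^sub>R x)) \<notin> borel_measurable borel"
    proof
      assume *: "(\<lambda>x. f (t + c *\<^sub>R x)) \<in> borel_measurable borel"
      have "(\<lambda>x. (\<lambda>x. f (t + c *\<^sub>R x)) ((x - t) /\<^sub>R c)) \<in> borel_measurable borel"
        by (rule measurable_compose[OF _ *]) simp
      with assms False show False by simp
    qed
    with False have "\<not> integrable lborel f" "\<not> integrable lborel (\<lambda>x. f (t + c *\<^sub>R x))"
      by auto
    then show ?thesis by (simp add: not_integrable_integral_eq)
  qed
qed

text \<open>Tonelli's criterion in the shape in which it is met later: the inner integral of the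
  norm is bounded by an integrable function, up to a null set that can hold the singularity of a
  kernel.\<close>

lemma lborel_Fubini:
  fixes f :: "'a::euclidean_space \<Rightarrow> 'b::euclidean_space \<Rightarrow> 'c::{banach, second_countable_topology}"
  assumes meas: "case_prod f \<in> borel_measurable (lborel \<Otimes>\<^sub>M lborel)"
    and int: "AE x in lborel. integrable lborel (\<lambda>y. f x y)"
    and bound: "AE x in lborel. (\<integral>y. norm (f x y) \<partial>lborel) \<le> h x" "integrable lborel h"
  shows "(\<integral>x. \<integral>y. f x y \<partial>lborel \<partial>lborel) = (\<integral>y. \<integral>x. f x y \<partial>lborel \<partial>lborel)"
proof -
  have "integrable (lborel \<Otimes>\<^sub>M lborel) (case_prod f)"
  proof (rule lborel_pair.Fubini_integrable[OF meas])
    show "integrable lborel (\<lambda>x. \<integral>y. norm (case_prod f (x, y)) \<partial>lborel)"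
    proof (rule Bochner_Integration.integrable_bound[OF bound(2)])
      show "(\<lambda>x. \<integral>y. norm (case_prod f (x, y)) \<partial>lborel) \<in> borel_measurable lborel"
        using meas by measurable
      show "AE x in lborel. norm (\<integral>y. norm (case_prod f (x, y)) \<partial>lborel) \<le> norm (h x)"
        using bound(1) by eventually_elim (simp add: order_trans[OF _ abs_ge_self])
    qed
  qed (use int in simp)
  then show ?thesis by (rule lborel_pair.Fubini_integral[symmetric])
qed

text \<open>The scaling sits in the argument of \<open>f\<close> and not in \<open>k\<close>, so
  \<open>norm (k y) * B\<close> dominates at every scale. With \<open>k\<close> of any sign and mass
  and \<open>S\<close> any set, the one-sided Poisson limit and the two-sided Gaussian limit are
  both instances.\<close>

lemma approximate_identity:
  fixes k :: "'a::euclidean_space \<Rightarrow> real" and f :: "'a \<Rightarrow> 'b::{banach, second_countable_topology}"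
  assumes k: "integrable lborel k"
    and f: "f \<in> borel_measurable borel" "\<And>x. norm (f x) \<le> B" "isCont f x"
  shows "((\<lambda>\<epsilon>. \<integral>y. k y *\<^sub>R f (x + \<epsilon> *\<^sub>R y) \<partial>lborel) \<longlongrightarrow> (\<integral>y. k y \<partial>lborel) *\<^sub>R f x) (at 0 within S)"
  unfolding tendsto_at_iff_sequentially o_def
proof safe
  fix X :: "nat \<Rightarrow> real" assume X: "X \<longlonglongrightarrow> 0"
  have "(\<lambda>i. \<integral>y. k y *\<^sub>R f (x + X i *\<^sub>R y) \<partial>lborel) \<longlonglongrightarrow> (\<integral>y. k y *\<^sub>R f x \<partial>lborel)"
  proof (rule integral_dominated_convergence[where w = "\<lambda>y. norm (k y) * B"])
    show "AE y in lborel. (\<lambda>i. k y *\<^sub>R f (x + X i *\<^sub>R y)) \<longlonglongrightarrow> k y *\<^sub>R f x"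
    proof (intro AE_I2 tendsto_scaleR tendsto_const isCont_tendsto_compose[OF f(3)])
      fix y
      show "(\<lambda>i. x + X i *\<^sub>R y) \<longlonglongrightarrow> x"
        by (rule tendsto_eq_intros X refl)+ simp
    qed
  qed (use k f in \<open>auto intro!: mult_left_mono\<close>)
  then show "(\<lambda>i. \<integral>y. k y *\<^sub>R f (x + X i *\<^sub>R y) \<partial>lborel) \<longlonglongrightarrow> (\<integral>y. k y \<partial>lborel) *\<^sub>R f x"
    using k by simp
qed

section \<open>Gaussian and Poisson integrals\<close>

definition fchar :: "real \<Rightarrow> complex" where
  "fchar \<theta> = exp (2 * \<i> * complex_of_real (pi * \<theta>))"

lemma norm_fchar [simp]: "norm (fchar \<theta>) = 1"
  by (simp add: fchar_def norm_exp_eq_Re)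

lemma fchar_0 [simp]: "fchar 0 = 1"
  by (simp add: fchar_def)

lemma fchar_add: "fchar (a + b) = fchar a * fchar b"
  by (simp add: fchar_def exp_add[symmetric] algebra_simps)

lemma continuous_on_fchar [continuous_intros]:
  "continuous_on S g \<Longrightarrow> continuous_on S (\<lambda>x. fchar (g x))"
  unfolding fchar_def by (intro continuous_intros)

lemma borel_measurable_fchar [measurable]: "fchar \<in> borel_measurable borel"
  by (intro borel_measurable_continuous_onI continuous_intros)

lemma fchar_sum: "finite A \<Longrightarrow> fchar (\<Sum>a\<in>A. g a) = (\<Prod>a\<in>A. fchar (g a))"
  by (induction A rule: finite_induct) (auto simp: fchar_add)

text \<open>Euler's integral under t = a exp v: the Jacobian t supplies the power missing from t^(s
  - 1), and the half line becomes the whole line.\<close>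

lemma Gamma_integral_log:
  fixes s a :: real
  assumes "0 < s" "0 < a"
  shows "has_bochner_integral lborel (\<lambda>v. exp (s * v - a * exp v)) (Gamma s / a powr s)"
proof -
  let ?f = "\<lambda>t::real. t powr (s - 1) / exp t"
  \<comment> \<open>Euler's integral is over the closed half line, the range of the substitution is
    the open one; they differ only at 0, where the integrand is 0.\<close>
  have 1: "(?f has_integral Gamma s) {0<..}"
  proof (subst has_integral_spike_set_eq[of "{0<..}" "{0..}"])
    have "{x \<in> {0..} - {0<..}. ?f x \<noteq> 0} = {}" "{x \<in> {0<..} - {0..}. ?f x \<noteq> 0} = {}" by auto
    then show "negligible {x \<in> {0..} - {0<..}. ?f x \<noteq> 0}" "negligible {x \<in> {0<..} - {0..}. ?f x \<noteq> 0}"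
      by (simp_all only: negligible_empty)
  qed (rule Gamma_integral_real[OF assms(1)])
  have abs: "?f absolutely_integrable_on {0<..}"
    by (rule nonnegative_absolutely_integrable_1) (use 1 in \<open>auto simp: has_integral_integrable_integral\<close>)
  have img: "range (\<lambda>v. a * exp v) = {0<..}"
  proof (rule set_eqI)
    fix t :: real
    show "t \<in> range (\<lambda>v. a * exp v) \<longleftrightarrow> t \<in> {0<..}"
      using assms(2) by (auto intro!: image_eqI[of _ _ "ln (t / a)"])
  qed
  let ?h = "\<lambda>v::real. \<bar>a * exp v\<bar> * ?f (a * exp v)"
  have "?h absolutely_integrable_on UNIV \<and> integral UNIV ?h = Gamma s"
  proof (rule has_absolute_integral_change_of_variables_1'[where g = "\<lambda>v. a * exp v" and f = ?f, THEN iffD2])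
    show "inj (\<lambda>v. a * exp v)" using assms by (auto simp: inj_def)
    show "?f absolutely_integrable_on range (\<lambda>v. a * exp v) \<and> integral (range (\<lambda>v. a * exp v)) ?f = Gamma s"
      unfolding img using abs 1 by auto
  qed (auto intro!: derivative_eq_intros)
  moreover have h_eq: "?h v = a powr s * exp (s * v - a * exp v)" for v
  proof -
    have "a powr s = a * a powr (s - 1)"
      using assms by (simp add: powr_diff)
    moreover have "exp (s * v) = exp v * exp ((s - 1) * v)"
      by (simp add: exp_add[symmetric] algebra_simps)
    ultimately show ?thesis
      using assms by (simp add: powr_mult exp_diff powr_def[of "exp v"])
  qed
  ultimately have 2: "(\<lambda>v. a powr s * exp (s * v - a * exp v)) absolutely_integrable_on UNIV"
     "integral UNIV (\<lambda>v. a powr s * exp (s * v - a * exp v)) = Gamma s" by auto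
  then have 3: "integrable lborel (\<lambda>v. a powr s * exp (s * v - a * exp v))"
    by (simp add: set_integrable_def integrable_completion)
  with 2 have "has_bochner_integral lborel (\<lambda>v. a powr s * exp (s * v - a * exp v)) (Gamma s)"
    using integral_lborel[OF 3] by (simp add: has_bochner_integral_iff)
  from has_bochner_integral_mult_right[OF this, of "1 / a powr s"] assms show ?thesis
    by simp
qed

lemma
  fixes f :: "'a::euclidean_space \<Rightarrow> real \<Rightarrow> 'b::{real_normed_field, banach, second_countable_topology}"
  assumes f: "\<And>b. b \<in> Basis \<Longrightarrow> integrable lborel (f b)"
  shows lborel_integrable_prod: "integrable lborel (\<lambda>x::'a. \<Prod>b\<in>Basis. f b (x \<bullet> b))"
    and lborel_integral_prod:
      "(\<integral>x. (\<Prod>b\<in>Basis. f b (x \<bullet> b)) \<partial>(lborel :: 'a measure)) = (\<Prod>b\<in>Basis. (\<integral>x. f b x \<partial>lborel))"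
proof -
  interpret product_sigma_finite "\<lambda>b::'a. lborel :: real measure" by standard
  have [measurable]: "\<And>b. b \<in> Basis \<Longrightarrow> f b \<in> borel_measurable borel"
    using f by auto
  have eq: "(\<Prod>b\<in>Basis. f b ((\<Sum>a\<in>Basis. x a *\<^sub>R a) \<bullet> b)) = (\<Prod>b\<in>Basis. f b (x b))"
    for x :: "'a \<Rightarrow> real"
    by (intro prod.cong refl) (simp add: inner_sum_left inner_Basis if_distrib cong: if_cong)
  show "integrable lborel (\<lambda>x::'a. \<Prod>b\<in>Basis. f b (x \<bullet> b))"
    unfolding lborel_eq[where 'a='a] using f
    by (subst integrable_distr_eq) (auto simp: eq intro!: product_integrable_prod)
  show "(\<integral>x. (\<Prod>b\<in>Basis. f b (x \<bullet> b)) \<partial>(lborel :: 'a measure)) = (\<Prod>b\<in>Basis. (\<integral>x. f b x \<partial>lborel))"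
    unfolding lborel_eq[where 'a='a] using f
    by (subst integral_distr) (auto simp: eq intro!: product_integral_prod)
qed

text \<open>Rescaling by \<open>c\<close>, the root of 2 \<tau>, turns the Gaussian into the
  standard normal density, whose characteristic function is known; \<open>t\<close> is the frequency
  after this rescaling.\<close>

lemma fourier_gaussian_real:
  fixes \<tau> \<eta> :: real
  assumes "0 < \<tau>"
  shows "has_bochner_integral lborel (\<lambda>y. complex_of_real (exp (- \<tau> * y\<^sup>2)) * fchar (y * \<eta>))
    (complex_of_real (sqrt (pi / \<tau>) * exp (- pi\<^sup>2 * \<eta>\<^sup>2 / \<tau>)))"
proof -
  define c where "c = sqrt (2 * \<tau>)"
  have c: "c > 0" "c\<^sup>2 = 2 * \<tau>" using assms by (auto simp: c_def)
  define t where "t = 2 * pi * \<eta> / c"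
  let ?g = "\<lambda>x. std_normal_density x *\<^sub>R iexp (t * x)"
  have int: "integrable lborel ?g"
    by (rule Bochner_Integration.integrable_bound[of lborel std_normal_density])
      (auto simp: integrable_normal_density)
  have "exp (- (t\<^sup>2) / 2) = char std_normal_distribution t"
    by (simp add: char_std_normal_distribution)
  also have "\<dots> = (\<integral>x. ?g x \<partial>lborel)"
    unfolding char_def by (subst integral_density) auto
  finally have hb: "has_bochner_integral lborel ?g (complex_of_real (exp (- (t\<^sup>2) / 2)))"
    using int by (simp add: has_bochner_integral_iff)
  have "has_bochner_integral lborel (\<lambda>x. ?g (0 + c * x)) (complex_of_real (exp (- (t\<^sup>2) / 2)) /\<^sub>R \<bar>c\<bar>)"
    using lborel_has_bochner_integral_real_affine_iff[of c ?g _ 0] hb c by simp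
  from has_bochner_integral_mult_right[OF this, of "complex_of_real (sqrt (2 * pi))"]
  have "has_bochner_integral lborel (\<lambda>x. complex_of_real (sqrt (2 * pi)) * ?g (0 + c * x))
    (complex_of_real (sqrt (2 * pi)) * (complex_of_real (exp (- (t\<^sup>2) / 2)) /\<^sub>R \<bar>c\<bar>))" by simp
  moreover have "complex_of_real (sqrt (2 * pi)) * ?g (0 + c * x) =
      complex_of_real (exp (- \<tau> * x\<^sup>2)) * fchar (x * \<eta>)" for x
  proof -
    have "t * (c * x) = 2 * pi * (x * \<eta>)" using c by (simp add: t_def)
    then have "iexp (t * (c * x)) = fchar (x * \<eta>)"
      unfolding fchar_def by (simp only: of_real_mult of_real_numeral) (simp add: algebra_simps)
    moreover have "(c * x)\<^sup>2 / 2 = \<tau> * x\<^sup>2" using c by (simp add: power_mult_distrib)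
    then have "complex_of_real (sqrt (2 * pi)) * complex_of_real (std_normal_density (c * x)) = complex_of_real (exp (- \<tau> * x\<^sup>2))"
      unfolding of_real_mult[symmetric] std_normal_density_def by simp
    ultimately show ?thesis
      by (simp add: scaleR_conv_of_real mult.assoc[symmetric] del: of_real_mult)
  qed
  moreover have "complex_of_real (sqrt (2 * pi)) * (complex_of_real (exp (- (t\<^sup>2) / 2)) /\<^sub>R \<bar>c\<bar>) =
      complex_of_real (sqrt (pi / \<tau>) * exp (- pi\<^sup>2 * \<eta>\<^sup>2 / \<tau>))"
  proof -
    have "t\<^sup>2 / 2 = pi\<^sup>2 * \<eta>\<^sup>2 / \<tau>"
      using c assms by (simp add: t_def power_divide power_mult_distrib)
    moreover have "sqrt (2 * pi) / c = sqrt (pi / \<tau>)"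
      by (simp add: c_def real_sqrt_divide real_sqrt_mult)
    then have "sqrt (pi / \<tau>) = sqrt (2 * pi) * inverse \<bar>c\<bar>"
      using c by (simp add: divide_inverse)
    ultimately show ?thesis
      by (simp add: scaleR_conv_of_real)
  qed
  ultimately show ?thesis by simp
qed

lemma fourier_gaussian:
  fixes \<xi> :: "'a::euclidean_space"
  assumes "0 < \<tau>"
  shows "has_bochner_integral lborel (\<lambda>x. complex_of_real (exp (- \<tau> * (norm x)\<^sup>2)) * fchar (x \<bullet> \<xi>))
    (complex_of_real ((pi / \<tau>) powr (DIM('a) / 2) * exp (- pi\<^sup>2 * (norm \<xi>)\<^sup>2 / \<tau>)))"
proof -
  let ?f = "\<lambda>b y. complex_of_real (exp (- \<tau> * y\<^sup>2)) * fchar (y * (\<xi> \<bullet> b))"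
  have nrm: "(norm x)\<^sup>2 = (\<Sum>b\<in>Basis. (x \<bullet> b)\<^sup>2)" for x :: 'a
    unfolding power2_norm_eq_inner euclidean_inner[of x x] by (simp add: power2_eq_square)
  have eq: "complex_of_real (exp (- \<tau> * (norm x)\<^sup>2)) * fchar (x \<bullet> \<xi>) = (\<Prod>b\<in>Basis. ?f b (x \<bullet> b))" for x
  proof -
    have "exp (- \<tau> * (norm x)\<^sup>2) = (\<Prod>b\<in>Basis. exp (- \<tau> * (x \<bullet> b)\<^sup>2))"
      unfolding nrm sum_distrib_left by (simp add: exp_sum)
    then show ?thesis
      by (simp add: euclidean_inner[of x \<xi>] fchar_sum prod.distrib)
  qed
  have f: "has_bochner_integral lborel (?f b) (complex_of_real (sqrt (pi / \<tau>) * exp (- pi\<^sup>2 * (\<xi> \<bullet> b)\<^sup>2 / \<tau>)))" for b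
    by (rule fourier_gaussian_real[OF assms])
  then have int: "integrable lborel (?f b)" and val: "(\<integral>x. ?f b x \<partial>lborel) = complex_of_real (sqrt (pi / \<tau>) * exp (- pi\<^sup>2 * (\<xi> \<bullet> b)\<^sup>2 / \<tau>))" for b
    by (auto simp: has_bochner_integral_iff)
  have "(\<Prod>b\<in>Basis. sqrt (pi / \<tau>) * exp (- pi\<^sup>2 * (\<xi> \<bullet> b)\<^sup>2 / \<tau>)) =
      (pi / \<tau>) powr (DIM('a) / 2) * exp (- pi\<^sup>2 * (norm \<xi>)\<^sup>2 / \<tau>)"
  proof -
    have "sqrt (pi / \<tau>) ^ DIM('a) = (pi / \<tau>) powr (DIM('a) / 2)"
      using assms by (simp add: powr_half_sqrt[symmetric] powr_power)
    then show ?thesis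
      unfolding nrm sum_distrib_left sum_divide_distrib by (simp add: prod.distrib exp_sum)
  qed
  then show ?thesis
    unfolding eq has_bochner_integral_iff
    using lborel_integrable_prod[of ?f, OF int] lborel_integral_prod[of ?f, OF int]
    unfolding val of_real_prod[symmetric] by metis
qed

lemma gaussian_integral:
  assumes "0 < \<tau>"
  shows "has_bochner_integral lborel (\<lambda>x::'a::euclidean_space. exp (- \<tau> * (norm x)\<^sup>2))
    ((pi / \<tau>) powr (DIM('a) / 2))"
  using has_bochner_integral_Re[OF fourier_gaussian[OF assms, of "0::'a"]] by simp

text \<open>The power -s of the squared norm, s = (d + 1) / 2 with d the dimension of
  \<open>'a\<close>, is a superposition of Gaussians. Integrating over y first costs d / 2 in the
  exponent and leaves \<open>Gamma_integral_log\<close> at 1 / 2, whence the factor 1 / t.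
  Nonnegative integrals give integrability together with the value.\<close>

lemma poisson_integral:
  fixes t :: real
  assumes "0 < t"
  shows "has_bochner_integral lborel (\<lambda>y::'a::euclidean_space. 1 / norm (y, t) ^ (DIM('a) + 1))
    (pi powr ((DIM('a) + 1) / 2) / Gamma ((DIM('a) + 1) / 2) / t)"
proof (rule has_bochner_integral_nn_integral)
  let ?D = "real DIM('a)"
  define s where "s = (?D + 1) / 2"
  have s: "s > 0" by (simp add: s_def)
  have G: "Gamma s > 0" using s by (rule Gamma_real_pos)
  have base: "1 / norm (y, t) ^ (DIM('a) + 1) = 1 / (((norm y)\<^sup>2 + t\<^sup>2) powr s)" for y :: 'a
  proof -
    have "(norm y)\<^sup>2 + t\<^sup>2 > 0" using assms by (simp add: add_nonneg_pos)
    then have "sqrt ((norm y)\<^sup>2 + t\<^sup>2) ^ (DIM('a) + 1) = ((norm y)\<^sup>2 + t\<^sup>2) powr s"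
      unfolding powr_half_sqrt[symmetric, OF less_imp_le[OF \<open>0 < (norm y)\<^sup>2 + t\<^sup>2\<close>]]
      by (subst powr_realpow[symmetric]) (auto simp: powr_powr s_def algebra_simps)
    then show ?thesis
      by (simp add: norm_Pair)
  qed
  have inner1: "ennreal (1 / norm (y, t) ^ (DIM('a) + 1)) =
     (\<integral>\<^sup>+v. ennreal (1 / Gamma s * exp (s * v - ((norm y)\<^sup>2 + t\<^sup>2) * exp v)) \<partial>lborel)" for y :: 'a
  proof -
    have "(norm y)\<^sup>2 + t\<^sup>2 > 0" using assms by (simp add: add_nonneg_pos)
    from has_bochner_integral_mult_right[OF Gamma_integral_log[OF s this], of "1 / Gamma s"]
    show ?thesis
      unfolding base using G
      by (subst nn_integral_eq_integral) (auto simp: has_bochner_integral_iff simp del: of_nat_Suc)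
  qed
  have inner2: "(\<integral>\<^sup>+y. ennreal (1 / Gamma s * exp (s * v - ((norm y)\<^sup>2 + t\<^sup>2) * exp v)) \<partial>(lborel :: 'a measure)) =
     ennreal (pi powr (?D / 2) / Gamma s * exp (1/2 * v - t\<^sup>2 * exp v))" for v
  proof -
    have eq: "1 / Gamma s * exp (s * v - ((norm y)\<^sup>2 + t\<^sup>2) * exp v) =
       (1 / Gamma s * exp (s * v - t\<^sup>2 * exp v)) * exp (- exp v * (norm y)\<^sup>2)" for y :: 'a
      by (simp add: exp_add[symmetric] algebra_simps)
    have "1 / Gamma s * exp (s * v - t\<^sup>2 * exp v) * (pi / exp v) powr (?D / 2) =
        pi powr (?D / 2) / Gamma s * exp (1/2 * v - t\<^sup>2 * exp v)"
    proof -
      have "(pi / exp v) powr (?D / 2) = pi powr (?D / 2) * exp (- v * ?D / 2)"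
        by (simp add: powr_divide powr_def[of "exp v"] exp_minus field_simps)
      moreover have "exp (s * v - t\<^sup>2 * exp v) * exp (- v * ?D / 2) = exp (1/2 * v - t\<^sup>2 * exp v)"
        by (simp add: exp_add[symmetric] s_def field_simps)
      ultimately show ?thesis by simp
    qed
    with has_bochner_integral_mult_right[OF gaussian_integral[of "exp v", where 'a='a], of "1 / Gamma s * exp (s * v - t\<^sup>2 * exp v)"]
    show ?thesis unfolding eq using G
      by (subst nn_integral_eq_integral) (auto simp: has_bochner_integral_iff)
  qed
  have "(\<integral>\<^sup>+y. ennreal (1 / norm (y, t) ^ (DIM('a) + 1)) \<partial>(lborel :: 'a measure)) =
    (\<integral>\<^sup>+v. ennreal (pi powr (?D / 2) / Gamma s * exp (1/2 * v - t\<^sup>2 * exp v)) \<partial>lborel)"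
    unfolding inner1 inner2[symmetric] by (rule lborel_pair.Fubini') simp
  also have "\<dots> = ennreal (pi powr (?D / 2) / Gamma s * (Gamma (1/2) / t\<^sup>2 powr (1/2)))"
    using has_bochner_integral_mult_right[OF Gamma_integral_log[of "1/2" "t\<^sup>2"], of "pi powr (?D / 2) / Gamma s"] assms G
    by (subst nn_integral_eq_integral) (auto simp: has_bochner_integral_iff)
  also have "pi powr (?D / 2) / Gamma s * (Gamma (1/2) / t\<^sup>2 powr (1/2)) =
      pi powr ((DIM('a) + 1) / 2) / Gamma ((DIM('a) + 1) / 2) / t"
    using assms by (simp add: Gamma_one_half_real powr_half_sqrt s_def add_divide_distrib powr_add add.commute)
  finally show "(\<integral>\<^sup>+y. ennreal (1 / norm (y, t) ^ (DIM('a) + 1)) \<partial>(lborel :: 'a measure)) =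
      ennreal (pi powr ((DIM('a) + 1) / 2) / Gamma ((DIM('a) + 1) / 2) / t)" .
  show "0 \<le> pi powr ((DIM('a) + 1) / 2) / Gamma ((DIM('a) + 1) / 2) / t"
    using assms G by (simp add: s_def add.commute)
qed auto

section \<open>Homogeneous kernels\<close>

text \<open>The Poisson kernel \<open>?P\<close> is integrated over all y and over t from 0 to 1, in
  both orders. Over y the result is the same for every t > 0, by \<open>poisson_integral\<close>, so
  the total is finite. Over t the fundamental theorem of calculus gives, up to the factor n, the
  singular function 1 / norm y ^ n minus a bounded one.\<close>

lemma singular_kernel_integrable:
  assumes "2 \<le> DIM('a::euclidean_space)" "m < DIM('a)"
  shows "integrable lborel (\<lambda>y::'a. indicator (cball 0 1) y / norm y ^ m :: real)"
proof -
  \<comment> \<open>The extreme exponent: on the unit ball every admissible \<open>m\<close> is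
    dominated by it.\<close>
  define n where "n = DIM('a) - 1"
  have n: "n \<ge> 1" "DIM('a) = n + 1" using assms by (auto simp: n_def)
  define A where "A = pi powr ((DIM('a) + 1) / 2) / Gamma ((DIM('a) + 1) / 2)"
  let ?P = "\<lambda>(y::'a) t::real. t / norm (y, t) ^ (DIM('a) + 1)"
  let ?Q = "\<lambda>(y::'a) t::real. - (1 / (real n * norm (y, t) ^ n))"
  have inner: "(\<integral>\<^sup>+t. ennreal (?P y t) * indicator {0..1} t \<partial>lborel) = ennreal (?Q y 1 - ?Q y 0)"
    if "y \<noteq> 0" for y :: 'a
  proof (rule nn_integral_FTC_Icc)
    fix t :: real assume t: "t \<in> {0..1}"
    have nz: "norm (y, t) \<noteq> 0" using that by (simp add: norm_eq_zero zero_prod_def)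
    have d1: "((\<lambda>t. norm (y, t)) has_real_derivative (t / norm (y, t))) (at t)"
    proof -
      have "0 < (norm y)\<^sup>2 + t\<^sup>2" using that by (simp add: add_pos_nonneg)
      then show ?thesis
        unfolding norm_Pair by (auto intro!: derivative_eq_intros simp: field_simps)
    qed
    show "(?Q y has_real_derivative ?P y t) (at t)"
      using n(1) nz
      by (auto intro!: derivative_eq_intros d1 simp: n(2) field_simps)
         (cases n; simp)
    show "0 \<le> ?P y t" using t by simp
  qed (auto simp del: norm_Pair)
  have "(\<integral>\<^sup>+y. ennreal (?Q y 1 - ?Q y 0) \<partial>(lborel :: 'a measure)) =
     (\<integral>\<^sup>+y. (\<integral>\<^sup>+t. ennreal (?P y t) * indicator {0..1} t \<partial>lborel) \<partial>(lborel :: 'a measure))"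
    by (intro nn_integral_cong_AE eventually_mono[OF AE_lborel_singleton[of 0]]) (rule inner[symmetric])
  also have "\<dots> = (\<integral>\<^sup>+t. (\<integral>\<^sup>+y. ennreal (?P y t) * indicator {0..1} t \<partial>(lborel :: 'a measure)) \<partial>lborel)"
    by (rule lborel_pair.Fubini') simp
  also have "\<dots> \<le> (\<integral>\<^sup>+t. ennreal A * indicator {0..1} t \<partial>(lborel :: real measure))"
  proof (intro nn_integral_mono)
    fix t :: real
    show "(\<integral>\<^sup>+y. ennreal (?P y t) * indicator {0..1} t \<partial>(lborel :: 'a measure)) \<le> ennreal A * indicator {0..1} t"
    proof (cases "0 < t")
      case True
      from has_bochner_integral_mult_right[OF poisson_integral[OF this, where 'a='a], of t] True
      have "has_bochner_integral lborel (\<lambda>y::'a. ?P y t) A" by (simp add: A_def)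
      then have "(\<integral>\<^sup>+y. ennreal (?P y t) \<partial>(lborel :: 'a measure)) = ennreal A"
        using True by (subst nn_integral_eq_integral) (auto simp: has_bochner_integral_iff)
      then show ?thesis by (simp add: nn_integral_multc)
    qed (auto simp: indicator_def)
  qed
  also have "\<dots> < \<infinity>" by (simp add: nn_integral_cmult ennreal_mult_less_top)
  finally have fin: "(\<integral>\<^sup>+y. ennreal (?Q y 1 - ?Q y 0) \<partial>(lborel :: 'a measure)) < \<infinity>" .
  have mono: "norm y ^ k \<le> norm (y, 1::real) ^ k" for y :: 'a and k
    by (intro power_mono) (simp_all add: norm_Pair real_le_rsqrt)
  have Q_nonneg: "0 \<le> ?Q y 1 - ?Q y 0" if "y \<noteq> 0" for y
    using mono[of y n] that n(1) by (simp add: norm_Pair1 frac_le)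
  have "integrable lborel (\<lambda>y. ?Q y 1 - ?Q y 0)"
  proof (rule integrableI_bounded)
    have "(\<integral>\<^sup>+y. ennreal (norm (?Q y 1 - ?Q y 0)) \<partial>lborel) = (\<integral>\<^sup>+y. ennreal (?Q y 1 - ?Q y 0) \<partial>lborel)"
      by (intro nn_integral_cong_AE eventually_mono[OF AE_lborel_singleton[of 0]])
         (use Q_nonneg in \<open>auto simp del: norm_Pair\<close>)
    with fin show "(\<integral>\<^sup>+y. ennreal (norm (?Q y 1 - ?Q y 0)) \<partial>lborel) < \<infinity>" by simp
  qed simp
  \<comment> \<open>The indicator makes up for the subtracted 1 / norm (y, 1) ^ n, which is at most
    1.\<close>
  then have "integrable lborel (\<lambda>y. real n * (?Q y 1 - ?Q y 0) + 2 * indicator (cball 0 1) y)"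
    by (intro Bochner_Integration.integrable_add integrable_mult_right)
      (auto intro!: integrable_real_indicator emeasure_bounded_finite)
  then show ?thesis
  proof (rule Bochner_Integration.integrable_bound)
    show "AE y in lborel. norm (indicator (cball 0 1) y / norm y ^ m :: real) \<le>
      norm (real n * (?Q y 1 - ?Q y 0) + 2 * indicator (cball 0 1) y)"
    proof (rule eventually_mono[OF AE_lborel_singleton[of 0]])
      fix y :: 'a assume y: "y \<noteq> 0"
      have e: "real n * (?Q y 1 - ?Q y 0) = 1 / norm y ^ n - 1 / norm (y, 1::real) ^ n"
        using n(1) by (simp add: algebra_simps norm_Pair1)
      have "1 \<le> norm (y, 1::real)" by (simp add: norm_Pair)
      then have "1 \<le> norm (y, 1::real) ^ n" by (rule one_le_power)
      then have "1 / norm (y, 1::real) ^ n \<le> 1" by (subst divide_le_eq_1) auto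
      moreover have "1 / norm y ^ m \<le> 1 / norm y ^ n" if "norm y \<le> 1"
        using that y n assms by (intro divide_left_mono power_decreasing) auto
      moreover have "0 \<le> 1 / norm y ^ n - 1 / norm (y, 1::real) ^ n"
        using Q_nonneg[OF y] unfolding e[symmetric] by simp
      ultimately show "norm (indicator (cball 0 1) y / norm y ^ m :: real) \<le>
          norm (real n * (?Q y 1 - ?Q y 0) + 2 * indicator (cball 0 1) y)"
        unfolding e by (auto simp: indicator_def abs_of_nonneg)
    qed
  qed (auto intro!: borel_measurable_divide borel_measurable_indicator)
qed

text \<open>\<open>hker m\<close> consists of kernels homogeneous of degree \<open>- m\<close>: combinations of monomials divided by
  powers of the norm. Their values at the origin are irrelevant.\<close>

inductive hker :: "nat \<Rightarrow> ('e::euclidean_space \<Rightarrow> real) \<Rightarrow> bool" where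
  base: "hker m (\<lambda>w. 1 / norm w ^ m)"
| mult: "b \<in> Basis \<Longrightarrow> hker (Suc m) k \<Longrightarrow> hker m (\<lambda>w. (w \<bullet> b) * k w)"
| add: "hker m k \<Longrightarrow> hker m l \<Longrightarrow> hker m (\<lambda>w. k w + l w)"
| scale: "hker m k \<Longrightarrow> hker m (\<lambda>w. c * k w)"

text \<open>A relation, so that a derivative can be exhibited as an explicit kernel; the origin is
  left out, as it is for \<open>hker\<close>.\<close>

definition kderiv :: "'e::euclidean_space \<Rightarrow> ('e \<Rightarrow> real) \<Rightarrow> ('e \<Rightarrow> real) \<Rightarrow> bool" where
  "kderiv b k k' \<longleftrightarrow> (\<forall>w. w \<noteq> 0 \<longrightarrow> ((\<lambda>t. k (w + t *\<^sub>R b)) has_vector_derivative k' w) (at 0))"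

lemma hker_bound: "hker m k \<Longrightarrow> \<exists>C\<ge>0. \<forall>w. w \<noteq> 0 \<longrightarrow> \<bar>k w\<bar> \<le> C / norm w ^ m"
proof (induction rule: hker.induct)
  case (base m)
  show ?case by (intro exI[of _ 1]) auto
next
  case (mult b m k)
  then obtain C where C: "C \<ge> 0" "\<And>w. w \<noteq> 0 \<Longrightarrow> \<bar>k w\<bar> \<le> C / norm w ^ Suc m" by blast
  have "\<bar>(w \<bullet> b) * k w\<bar> \<le> C / norm w ^ m" if "w \<noteq> 0" for w
  proof -
    have "\<bar>w \<bullet> b\<bar> * \<bar>k w\<bar> \<le> norm w * (C / norm w ^ Suc m)"
      using C(2)[OF that] Basis_le_norm[OF mult(1)] by (intro mult_mono) auto
    then show ?thesis using that by (simp add: abs_mult)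
  qed
  with C(1) show ?case by blast
next
  case (add m k l)
  then obtain C D where "C \<ge> 0" "\<And>w. w \<noteq> 0 \<Longrightarrow> \<bar>k w\<bar> \<le> C / norm w ^ m"
    "D \<ge> 0" "\<And>w. w \<noteq> 0 \<Longrightarrow> \<bar>l w\<bar> \<le> D / norm w ^ m" by blast
  then show ?case
    by (intro exI[of _ "C + D"]) (auto simp: add_divide_distrib intro!: order_trans[OF abs_triangle_ineq] add_mono)
next
  case (scale m k c)
  then obtain C where "C \<ge> 0" "\<And>w. w \<noteq> 0 \<Longrightarrow> \<bar>k w\<bar> \<le> C / norm w ^ m" by blast
  then show ?case
    by (intro exI[of _ "\<bar>c\<bar> * C"]) (auto simp: abs_mult simp flip: times_divide_eq_right intro!: mult_left_mono)
qed

lemma hker_continuous: "hker m k \<Longrightarrow> continuous_on (- {0}) k"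
  by (induction rule: hker.induct) (auto intro!: continuous_intros)

lemma hker_measurable: "hker m k \<Longrightarrow> k \<in> borel_measurable borel"
  by (induction rule: hker.induct) auto

lemma norm_power_deriv:
  fixes w :: "'e::euclidean_space"
  assumes "w \<noteq> 0"
  shows "((\<lambda>t. 1 / norm (w + t *\<^sub>R b) ^ m) has_vector_derivative - real m * (w \<bullet> b) / norm w ^ (m + 2)) (at 0)"
proof -
  have sq: "norm (w + t *\<^sub>R b) = sqrt (w \<bullet> w + 2 * t * (w \<bullet> b) + t\<^sup>2 * (b \<bullet> b))" for t
    by (simp add: norm_eq_sqrt_inner inner_add_left inner_add_right inner_commute algebra_simps power2_eq_square)
  have "((\<lambda>t. sqrt (w \<bullet> w + 2 * t * (w \<bullet> b) + t\<^sup>2 * (b \<bullet> b))) has_real_derivative (w \<bullet> b) / sqrt (w \<bullet> w)) (at 0)"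
    using assms leD[OF inner_ge_zero[of w]] by (auto intro!: derivative_eq_intros simp: field_simps)
  then have "((\<lambda>t. norm (w + t *\<^sub>R b)) has_real_derivative (w \<bullet> b) / norm w) (at 0)"
    unfolding sq by (simp add: norm_eq_sqrt_inner)
  note d = this
  have "((\<lambda>t. 1 / norm (w + t *\<^sub>R b) ^ m) has_real_derivative - real m * (w \<bullet> b) / norm w ^ (m + 2)) (at 0)"
    by (rule derivative_eq_intros d refl)+
      (use assms in \<open>cases m; simp add: field_simps power2_eq_square\<close>)+
  then show ?thesis by (simp add: has_real_derivative_iff_has_vector_derivative)
qed

lemma kderiv_base: "kderiv b (\<lambda>w. 1 / norm w ^ m) (\<lambda>w. - real m * ((w \<bullet> b) * (1 / norm w ^ (m + 2))))"
  using norm_power_deriv[of _ b m] by (simp add: kderiv_def)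

lemma kderiv_mult:
  assumes "kderiv b k k'"
  shows "kderiv b (\<lambda>w. (w \<bullet> a) * k w) (\<lambda>w. (b \<bullet> a) * k w + (w \<bullet> a) * k' w)"
  unfolding kderiv_def
proof safe
  fix w :: 'a assume "w \<noteq> 0"
  with assms have d: "((\<lambda>t. k (w + t *\<^sub>R b)) has_real_derivative k' w) (at 0)"
    by (simp add: kderiv_def has_real_derivative_iff_has_vector_derivative)
  have "((\<lambda>t. ((w + t *\<^sub>R b) \<bullet> a) * k (w + t *\<^sub>R b)) has_real_derivative (b \<bullet> a) * k w + (w \<bullet> a) * k' w) (at 0)"
    by (auto intro!: derivative_eq_intros d simp: inner_add_left)
  then show "((\<lambda>t. ((w + t *\<^sub>R b) \<bullet> a) * k (w + t *\<^sub>R b)) has_vector_derivative (b \<bullet> a) * k w + (w \<bullet> a) * k' w) (at 0)"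
    by (simp add: has_real_derivative_iff_has_vector_derivative)
qed

lemma kderiv_add: "kderiv b k k' \<Longrightarrow> kderiv b l l' \<Longrightarrow> kderiv b (\<lambda>w. k w + l w) (\<lambda>w. k' w + l' w)"
  by (auto simp: kderiv_def intro!: has_vector_derivative_add)

lemma kderiv_scale: "kderiv b k k' \<Longrightarrow> kderiv b (\<lambda>w. c * k w) (\<lambda>w. c * k' w)"
  by (auto simp: kderiv_def intro!: has_vector_derivative_mult_right)

text \<open>Closure under differentiation, at the price of one order, is what the inductive class is
  designed for: it makes smoothness of \<open>U\<close> a single induction over the
  multi-index.\<close>

lemma hker_kderiv:
  "hker m k \<Longrightarrow> b \<in> Basis \<Longrightarrow> \<exists>k'. hker (Suc m) k' \<and> kderiv b k k'"
proof (induction rule: hker.induct)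
  case (base m)
  have "hker (Suc m) (\<lambda>w. - real m * ((w \<bullet> b) * (1 / norm w ^ (m + 2))))"
    using hker.scale[OF hker.mult[OF base, of "Suc m", OF hker.base[of "Suc (Suc m)"]], of "- real m"]
    by (simp only: add_2_eq_Suc')
  then show ?case using kderiv_base by blast
next
  case (mult a m k)
  then obtain k' where "hker (Suc (Suc m)) k'" "kderiv b k k'" by auto
  then have "hker (Suc m) (\<lambda>w. (b \<bullet> a) * k w + (w \<bullet> a) * k' w)"
    using mult by (intro hker.add hker.scale hker.mult) auto
  with kderiv_mult[OF \<open>kderiv b k k'\<close>, of a] show ?case by blast
next
  case (add m k l)
  then obtain k' l' where "hker (Suc m) k'" "kderiv b k k'" "hker (Suc m) l'" "kderiv b l l'" by auto
  then have "hker (Suc m) (\<lambda>w. k' w + l' w)" "kderiv b (\<lambda>w. k w + l w) (\<lambda>w. k' w + l' w)"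
    by (auto intro: hker.add kderiv_add)
  then show ?case by blast
next
  case (scale m k c)
  then obtain k' where "hker (Suc m) k'" "kderiv b k k'" by auto
  then have "hker (Suc m) (\<lambda>w. c * k' w)" "kderiv b (\<lambda>w. c * k w) (\<lambda>w. c * k' w)"
    by (auto intro: hker.scale kderiv_scale)
  then show ?case by blast
qed

lemma kderiv_at:
  assumes "kderiv b k k'" "w + t *\<^sub>R b \<noteq> 0"
  shows "((\<lambda>s. k (w + s *\<^sub>R b)) has_vector_derivative k' (w + t *\<^sub>R b)) (at t)"
proof -
  have "((\<lambda>s. k ((w + t *\<^sub>R b) + s *\<^sub>R b)) has_vector_derivative k' (w + t *\<^sub>R b)) (at (t - t))"
    using assms by (simp add: kderiv_def)
  then have "((\<lambda>s. k ((w + t *\<^sub>R b) + (s - t) *\<^sub>R b)) has_vector_derivative k' (w + t *\<^sub>R b)) (at t)"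
    using vector_diff_chain_at[of "\<lambda>s. s - t" 1 t "\<lambda>s. k ((w + t *\<^sub>R b) + s *\<^sub>R b)" "k' (w + t *\<^sub>R b)"]
      has_vector_derivative_diff[OF has_vector_derivative_id has_vector_derivative_const]
    by (simp add: o_def)
  then show ?thesis by (simp add: algebra_simps)
qed

section \<open>Potentials\<close>

definition potential :: "('a::euclidean_space \<Rightarrow> real) \<Rightarrow> ('a \<times> real \<Rightarrow> real) \<Rightarrow> 'a \<times> real \<Rightarrow> real" where
  "potential f k w = (\<integral>z. f z * k (w - (z, 0)) \<partial>lborel)"

lemma abs_snd_le_norm: "\<bar>snd w\<bar> \<le> norm w" for w :: "'a::real_normed_vector \<times> real"
  using norm_snd_le[of "snd w" "fst w"] by simp

lemma norm_fst_le_norm: "norm (fst w) \<le> norm w" for w :: "'a::real_normed_vector \<times> real"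
  using norm_fst_le[of "fst w" "snd w"] by simp

lemma hker_isCont: "hker m k \<Longrightarrow> w \<noteq> 0 \<Longrightarrow> isCont k w"
  using hker_continuous[of m k] continuous_on_eq_continuous_at[of "- {0}" k] by auto

context
  fixes f :: "'a::euclidean_space \<Rightarrow> real" and B :: real
  assumes f_int: "integrable lborel f" and f_le: "\<And>x. \<bar>f x\<bar> \<le> B"
begin

lemma f_borel [measurable]: "f \<in> borel_measurable borel"
  using f_int by auto

lemma B_nonneg: "0 \<le> B"
  using f_le[of 0] by linarith

lemma kernel_measurable:
  fixes k :: "'a \<times> real \<Rightarrow> real"
  assumes "hker m k"
  shows "(\<lambda>z. f z * k (w - (z, 0))) \<in> borel_measurable borel"
proof -
  have "(\<lambda>z::'a. w - (z, 0::real)) \<in> borel_measurable borel"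
    by (intro borel_measurable_continuous_onI continuous_intros)
  from measurable_compose[OF this hker_measurable[OF assms]] show ?thesis by simp
qed

text \<open>A point at height \<open>s\<close> or more is at distance at least \<open>s\<close> from
  every \<open>(z, 0)\<close>. As \<open>C\<close> is fixed before \<open>w\<close>, the bound
  dominates on a whole neighbourhood at once.\<close>

lemma kernel_bound_off:
  fixes k :: "'a \<times> real \<Rightarrow> real"
  assumes "hker m k"
  obtains C where "0 \<le> C"
    "\<And>w z s. 0 < s \<Longrightarrow> s \<le> \<bar>snd w\<bar> \<Longrightarrow> \<bar>f z * k (w - (z, 0))\<bar> \<le> \<bar>f z\<bar> * (C / s ^ m)"
proof -
  obtain C where C: "C \<ge> 0" "\<And>w. w \<noteq> 0 \<Longrightarrow> \<bar>k w\<bar> \<le> C / norm w ^ m"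
    using hker_bound[OF assms] by blast
  have "\<bar>f z * k (w - (z, 0))\<bar> \<le> \<bar>f z\<bar> * (C / s ^ m)" if s: "0 < s" "s \<le> \<bar>snd w\<bar>" for w z s
  proof -
    let ?w = "w - (z, 0)"
    have ns: "s \<le> norm ?w" using abs_snd_le_norm[of ?w] s by simp
    then have "?w \<noteq> 0" using s by auto
    from C(2)[OF this] have "\<bar>k ?w\<bar> \<le> C / norm ?w ^ m" .
    also have "\<dots> \<le> C / s ^ m"
      using C(1) s ns by (intro divide_left_mono power_mono mult_pos_pos zero_less_power) auto
    finally show ?thesis unfolding abs_mult by (rule mult_left_mono) simp
  qed
  with that C(1) show ?thesis by blast
qed

lemma potential_integrable_off:
  fixes k :: "'a \<times> real \<Rightarrow> real"
  assumes "hker m k" "snd w \<noteq> 0"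
  shows "integrable lborel (\<lambda>z. f z * k (w - (z, 0)))"
proof -
  obtain C where "0 \<le> C" and C: "\<And>w z s. 0 < s \<Longrightarrow> s \<le> \<bar>snd w\<bar> \<Longrightarrow> \<bar>f z * k (w - (z, 0))\<bar> \<le> \<bar>f z\<bar> * (C / s ^ m)"
    using kernel_bound_off[OF assms(1)] by blast
  show ?thesis
  proof (rule Bochner_Integration.integrable_bound)
    show "integrable lborel (\<lambda>z. \<bar>f z\<bar> * (C / \<bar>snd w\<bar> ^ m))" using f_int by simp
    show "AE z in lborel. norm (f z * k (w - (z, 0))) \<le> norm (\<bar>f z\<bar> * (C / \<bar>snd w\<bar> ^ m))"
      using C[of "\<bar>snd w\<bar>" w] assms(2) by (intro AE_I2, unfold real_norm_def, intro order_trans[OF _ abs_ge_self]) auto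
  qed (use kernel_measurable[OF assms(1)] in simp)
qed

text \<open>Away from the hyperplane the kernels are bounded, so a multiple of \<bar>f\<bar> is a
  dominating function whatever the order of the kernel.\<close>

lemma potential_deriv_off:
  fixes k k' :: "'a \<times> real \<Rightarrow> real"
  assumes "hker m k" "hker n k'" "kderiv b k k'" "norm b \<le> 1" "snd w \<noteq> 0"
  shows "((\<lambda>t. potential f k (w + t *\<^sub>R b)) has_vector_derivative potential f k' w) (at 0)"
proof -
  obtain C where "0 \<le> C" and C: "\<And>w z s. 0 < s \<Longrightarrow> s \<le> \<bar>snd w\<bar> \<Longrightarrow> \<bar>f z * k' (w - (z, 0))\<bar> \<le> \<bar>f z\<bar> * (C / s ^ n)"
    using kernel_bound_off[OF assms(2)] by blast
  \<comment> \<open>Half the height: moving by less than \<open>r\<close> along a vector of norm at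
    most 1 stays at height at least \<open>r\<close>.\<close>
  define r where "r = \<bar>snd w\<bar> / 2"
  have r: "0 < r" using assms by (simp add: r_def)
  have far: "r \<le> \<bar>snd (w + t *\<^sub>R b)\<bar>" if "\<bar>t\<bar> < r" for t
  proof -
    have "\<bar>t * snd b\<bar> \<le> r"
      using that abs_snd_le_norm[of b] assms(4) mult_mono[of "\<bar>t\<bar>" r "\<bar>snd b\<bar>" 1] by (simp add: abs_mult)
    then show ?thesis unfolding r_def by (simp add: abs_if split: if_splits)
  qed
  have nz: "w - (z, 0) + t *\<^sub>R b \<noteq> 0" if "\<bar>t\<bar> < r" for t z
    using far[OF that] r by (auto simp: prod_eq_iff)
  have "((\<lambda>t. \<integral>z. f z * k (w + t *\<^sub>R b - (z, 0)) \<partial>lborel) has_vector_derivative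
      (\<integral>z. f z * k' (w + 0 *\<^sub>R b - (z, 0)) \<partial>lborel)) (at 0)"
  proof (rule has_vector_derivative_lebesgue_integral[OF r, where g' = "\<lambda>t z. f z * k' (w + t *\<^sub>R b - (z, 0))"
        and h = "\<lambda>z. \<bar>f z\<bar> * (C / r ^ n)"])
    fix t assume t: "\<bar>t\<bar> < r"
    show "integrable lborel (\<lambda>z. f z * k (w + t *\<^sub>R b - (z, 0)))"
      using far[OF t] r by (intro potential_integrable_off[OF assms(1)]) auto
    fix z
    have "((\<lambda>s. k ((w - (z, 0)) + s *\<^sub>R b)) has_vector_derivative k' ((w - (z, 0)) + t *\<^sub>R b)) (at t)"
      using assms(3) nz[OF t] by (rule kderiv_at)
    from has_vector_derivative_mult_right[OF this, of "f z"]
    show "((\<lambda>s. f z * k (w + s *\<^sub>R b - (z, 0))) has_vector_derivative f z * k' (w + t *\<^sub>R b - (z, 0))) (at t)"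
      by (simp add: algebra_simps)
    show "norm (f z * k' (w + t *\<^sub>R b - (z, 0))) \<le> \<bar>f z\<bar> * (C / r ^ n)"
      using C[OF r far[OF t]] by simp
  qed (use f_int in simp)
  then show ?thesis by (simp add: potential_def)
qed

lemma potential_continuous_off:
  fixes k :: "'a \<times> real \<Rightarrow> real"
  assumes "hker m k"
  shows "continuous_on {w. snd w \<noteq> 0} (potential f k)"
proof (rule continuous_at_imp_continuous_on, clarify)
  fix w :: "'a \<times> real" assume w: "snd w \<noteq> 0"
  obtain C where "0 \<le> C" and C: "\<And>w z s. 0 < s \<Longrightarrow> s \<le> \<bar>snd w\<bar> \<Longrightarrow> \<bar>f z * k (w - (z, 0))\<bar> \<le> \<bar>f z\<bar> * (C / s ^ m)"
    using kernel_bound_off[OF assms(1)] by blast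
  define r where "r = \<bar>snd w\<bar> / 2"
  have r: "0 < r" using w by (simp add: r_def)
  show "isCont (potential f k) w"
    unfolding continuous_at_sequentially
  proof safe
    fix X :: "nat \<Rightarrow> 'a \<times> real" assume X: "X \<longlonglongrightarrow> w"
    have "(\<lambda>i. \<bar>snd (X i)\<bar>) \<longlonglongrightarrow> \<bar>snd w\<bar>" by (intro tendsto_intros X)
    moreover have "r < \<bar>snd w\<bar>" using r by (simp add: r_def)
    ultimately have "\<forall>\<^sub>F i in sequentially. r < \<bar>snd (X i)\<bar>" by (rule order_tendstoD)
    then obtain N where N: "\<And>i. i \<ge> N \<Longrightarrow> r < \<bar>snd (X i)\<bar>" by (auto simp: eventually_sequentially)
    define Y where "Y i = X (i + N)" for i
    have Y: "r \<le> \<bar>snd (Y i)\<bar>" for i using N[of "i + N"] by (simp add: Y_def)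
    have YX: "Y \<longlonglongrightarrow> w" unfolding Y_def using X by (rule LIMSEQ_ignore_initial_segment)
    have "(\<lambda>i. \<integral>z. f z * k (Y i - (z, 0)) \<partial>lborel) \<longlonglongrightarrow> (\<integral>z. f z * k (w - (z, 0)) \<partial>lborel)"
    proof (rule integral_dominated_convergence[where w = "\<lambda>z. \<bar>f z\<bar> * (C / r ^ m)"])
      show "AE z in lborel. (\<lambda>i. f z * k (Y i - (z, 0))) \<longlonglongrightarrow> f z * k (w - (z, 0))"
      proof (intro AE_I2 tendsto_mult tendsto_const)
        fix z
        have "w - (z, 0) \<noteq> 0" using w by (auto simp: prod_eq_iff)
        then have "isCont k (w - (z, 0))"
          by (rule hker_isCont[OF assms])
        then show "(\<lambda>i. k (Y i - (z, 0))) \<longlonglongrightarrow> k (w - (z, 0))"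
          by (rule isCont_tendsto_compose) (intro tendsto_intros YX)
      qed
    qed (use C[OF r Y] f_int kernel_measurable[OF assms] in auto)
    then have "(\<lambda>i. potential f k (X (i + N))) \<longlonglongrightarrow> potential f k w"
      by (simp add: potential_def Y_def)
    then show "(potential f k \<circ> X) \<longlonglongrightarrow> potential f k w"
      unfolding o_def by (rule LIMSEQ_offset)
  qed
qed

text \<open>Split at horizontal distance 1: inside, \<open>f\<close> is at most \<open>B\<close> and
  the kernel is locally integrable; outside, the kernel is at most \<open>C\<close> and
  \<open>f\<close> is integrable. Estimating by the horizontal distance covers all heights,
  including 0.\<close>

lemma potential_integrable:
  fixes k :: "'a \<times> real \<Rightarrow> real"
  assumes "hker m k" "m < DIM('a)" "2 \<le> DIM('a)"
  shows "integrable lborel (\<lambda>z. f z * k (w - (z, 0)))"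
proof -
  obtain C where C: "C \<ge> 0" "\<And>w. w \<noteq> 0 \<Longrightarrow> \<bar>k w\<bar> \<le> C / norm w ^ m"
    using hker_bound[OF assms(1)] by blast
  let ?s = "\<lambda>y::'a. indicator (cball 0 1) y / norm y ^ m :: real"
  have s: "integrable lborel (\<lambda>z. ?s (fst w + (-1) *\<^sub>R z))"
    using singular_kernel_integrable[OF assms(3,2)] by (intro lborel_integrable_affine) auto
  show ?thesis
  proof (rule Bochner_Integration.integrable_bound)
    show "integrable lborel (\<lambda>z. \<bar>f z\<bar> * C + B * (C * ?s (fst w + (-1) *\<^sub>R z)))"
      using f_int s by (intro Bochner_Integration.integrable_add integrable_mult_left integrable_mult_right) auto
    show "AE z in lborel. norm (f z * k (w - (z, 0))) \<le> norm (\<bar>f z\<bar> * C + B * (C * ?s (fst w + (-1) *\<^sub>R z)))"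
    proof (rule eventually_mono[OF AE_lborel_singleton[of "fst w"]])
      fix z assume z: "z \<noteq> fst w"
      let ?y = "fst w - z"
      have y: "norm ?y > 0" "norm ?y \<le> norm (w - (z, 0))"
        using z norm_fst_le_norm[of "w - (z, 0)"] by auto
      have "w - (z, 0) \<noteq> 0" using z by (auto simp: prod_eq_iff)
      from C(2)[OF this] have "\<bar>k (w - (z, 0))\<bar> \<le> C / norm (w - (z, 0)) ^ m" .
      also have "\<dots> \<le> C / norm ?y ^ m"
        using y C(1) by (intro divide_left_mono power_mono mult_pos_pos zero_less_power) auto
      finally have k: "\<bar>k (w - (z, 0))\<bar> \<le> C / norm ?y ^ m" .
      have "\<bar>f z * k (w - (z, 0))\<bar> \<le> \<bar>f z\<bar> * C + B * (C * ?s ?y)"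
      proof (cases "norm ?y \<le> 1")
        case True
        have "\<bar>f z\<bar> * \<bar>k (w - (z, 0))\<bar> \<le> B * (C / norm ?y ^ m)"
          using k f_le[of z] B_nonneg by (intro mult_mono) auto
        then show ?thesis using True C(1) by (simp add: abs_mult add_increasing)
      next
        case False
        then have "C / norm ?y ^ m \<le> C / 1"
          using C(1) by (intro divide_left_mono one_le_power mult_pos_pos zero_less_power) auto
        then have "\<bar>f z\<bar> * \<bar>k (w - (z, 0))\<bar> \<le> \<bar>f z\<bar> * C"
          using k by (intro mult_left_mono) auto
        then show ?thesis using False by (simp add: abs_mult)
      qed
      then show "norm (f z * k (w - (z, 0))) \<le> norm (\<bar>f z\<bar> * C + B * (C * ?s (fst w + (-1) *\<^sub>R z)))"
        by simp
    qed
  qed (use kernel_measurable[OF assms(1)] in simp)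
qed

text \<open>Near the hyperplane no dominating function is available, as \<open>f\<close> is merely bounded;
  the potential is instead a uniform limit of potentials of bounded kernels.\<close>

lemma potential_continuous:
  fixes k :: "'a \<times> real \<Rightarrow> real"
  assumes "hker m k" "m < DIM('a)" "2 \<le> DIM('a)"
  shows "continuous_on UNIV (potential f k)"
proof -
  obtain C where C: "C \<ge> 0" "\<And>w. w \<noteq> 0 \<Longrightarrow> \<bar>k w\<bar> \<le> C / norm w ^ m"
    using hker_bound[OF assms(1)] by blast
  \<comment> \<open>The factor \<open>real n * norm y ^ m\<close> cancels the singularity, so the
    truncated kernel \<open>kn n\<close> is bounded by \<open>C * real n\<close>.\<close>
  define cut where "cut n y = min 1 (real n * norm y ^ m)" for n and y :: 'a
  define kn where "kn n w = k w * cut n (fst w)" for n and w :: "'a \<times> real"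
  \<comment> \<open>A majorant of the truncation error that does not involve the height. For
    \<open>n \<ge> 1\<close> it lives in the unit ball, since \<open>cut n\<close> is 1
    outside.\<close>
  define D where "D n y = C / norm y ^ m * (1 - cut n y)" for n and y :: 'a
  have cut: "0 \<le> cut n y" "cut n y \<le> 1" for n y by (auto simp: cut_def)
  have [measurable]: "cut n \<in> borel_measurable borel" for n unfolding cut_def[abs_def] by measurable
  have kb: "\<bar>k w\<bar> \<le> C / norm (fst w) ^ m" if "fst w \<noteq> 0" for w :: "'a \<times> real"
  proof -
    have "w \<noteq> 0" using that by auto
    from C(2)[OF this] have "\<bar>k w\<bar> \<le> C / norm w ^ m" .
    also have "\<dots> \<le> C / norm (fst w) ^ m"
      using that C(1) norm_fst_le_norm[of w] by (intro divide_left_mono power_mono mult_pos_pos zero_less_power) (auto intro: \<open>w \<noteq> 0\<close>)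
    finally show ?thesis .
  qed
  have kn_bound: "\<bar>kn n w\<bar> \<le> C * real n" if "fst w \<noteq> 0" for n w
  proof -
    have "\<bar>kn n w\<bar> \<le> C / norm (fst w) ^ m * (real n * norm (fst w) ^ m)"
      unfolding kn_def abs_mult using kb[OF that] C(1) cut by (intro mult_mono) (auto simp: cut_def)
    then show ?thesis using that by simp
  qed
  have kn_diff: "\<bar>k w - kn n w\<bar> \<le> D n (fst w)" if "fst w \<noteq> 0" for n w
  proof -
    have "\<bar>k w - kn n w\<bar> = \<bar>k w\<bar> * (1 - cut n (fst w))"
    proof -
      have "k w - kn n w = k w * (1 - cut n (fst w))" by (simp add: kn_def algebra_simps)
      then show ?thesis using cut[of n "fst w"] by (simp add: abs_mult)
    qed
    also have "\<dots> \<le> D n (fst w)"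
      unfolding D_def using kb[OF that] cut by (intro mult_right_mono) auto
    finally show ?thesis .
  qed
  have kn_meas: "(\<lambda>z. f z * kn n (w - (z, 0))) \<in> borel_measurable borel" for n w
  proof -
    have "(\<lambda>z. (f z * k (w - (z, 0))) * cut n (fst w - z)) \<in> borel_measurable borel"
      using kernel_measurable[OF assms(1)] by measurable
    then show ?thesis by (simp add: kn_def mult.assoc)
  qed
  have \<Phi>_cont: "continuous_on UNIV (potential f (kn n))" for n
  proof (rule continuous_at_imp_continuous_on, clarify)
    fix w
    show "isCont (potential f (kn n)) w"
      unfolding continuous_at_sequentially
    proof safe
      fix X :: "nat \<Rightarrow> 'a \<times> real" assume X: "X \<longlonglongrightarrow> w"
      have "(\<lambda>i. \<integral>z. f z * kn n (X i - (z, 0)) \<partial>lborel) \<longlonglongrightarrow> (\<integral>z. f z * kn n (w - (z, 0)) \<partial>lborel)"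
      proof (rule integral_dominated_convergence[where w = "\<lambda>z. \<bar>f z\<bar> * (C * real n)"])
        show "AE z in lborel. (\<lambda>i. f z * kn n (X i - (z, 0))) \<longlonglongrightarrow> f z * kn n (w - (z, 0))"
        proof (rule eventually_mono[OF AE_lborel_singleton[of "fst w"]])
          fix z assume "z \<noteq> fst w"
          then have "w - (z, 0) \<noteq> 0" by (auto simp: prod_eq_iff)
          then have "isCont k (w - (z, 0))"
            by (rule hker_isCont[OF assms(1)])
          then have "isCont (kn n) (w - (z, 0))"
            unfolding kn_def cut_def by (intro continuous_intros)
          then have "(\<lambda>i. kn n (X i - (z, 0))) \<longlonglongrightarrow> kn n (w - (z, 0))"
            by (rule isCont_tendsto_compose) (intro tendsto_intros X)
          then show "(\<lambda>i. f z * kn n (X i - (z, 0))) \<longlonglongrightarrow> f z * kn n (w - (z, 0))"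
            by (rule tendsto_mult_left)
        qed
        show "AE z in lborel. norm (f z * kn n (X i - (z, 0))) \<le> \<bar>f z\<bar> * (C * real n)" for i
          by (rule eventually_mono[OF AE_lborel_singleton[of "fst (X i)"]])
             (auto simp: abs_mult intro!: mult_left_mono kn_bound)
      qed (use f_int kn_meas in auto)
      then show "(potential f (kn n) \<circ> X) \<longlonglongrightarrow> potential f (kn n) w"
        by (simp add: potential_def o_def)
    qed
  qed
  have D_int: "integrable lborel (D n)" if "n \<ge> 1" for n
  proof (rule Bochner_Integration.integrable_bound)
    show "integrable lborel (\<lambda>y::'a. C * (indicator (cball 0 1) y / norm y ^ m))"
      using singular_kernel_integrable[OF assms(3,2)] by (rule integrable_mult_right)
    show "AE y in lborel. norm (D n y) \<le> norm (C * (indicator (cball 0 1) y / norm y ^ m))"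
    proof (intro AE_I2)
      fix y :: 'a
      have "D n y = 0" if "\<not> norm y \<le> 1"
      proof -
        have "1 * 1 \<le> real n * norm y ^ m"
          using that \<open>n \<ge> 1\<close> by (intro mult_mono one_le_power) auto
        then show ?thesis by (simp add: D_def cut_def)
      qed
      then show "norm (D n y) \<le> norm (C * (indicator (cball 0 1) y / norm y ^ m))"
        using C(1) cut[of n y] by (auto simp: indicator_def D_def abs_mult divide_right_mono mult_left_le)
    qed
  qed (simp add: D_def[abs_def])
  \<comment> \<open>Indexed by \<open>Suc n\<close>, because \<open>cut 0\<close> is 0 and
    \<open>D 0\<close> need not be integrable.\<close>
  have D_lim: "(\<lambda>n. \<integral>y. D (Suc n) y \<partial>lborel) \<longlonglongrightarrow> (\<integral>y. 0 \<partial>(lborel :: 'a measure))"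
  proof (rule integral_dominated_convergence[where w = "D 1"])
    show "AE y in lborel. (\<lambda>n. D (Suc n) y) \<longlonglongrightarrow> 0"
    proof (rule eventually_mono[OF AE_lborel_singleton[of 0]])
      fix y :: 'a assume "y \<noteq> 0"
      then obtain N where N: "1 < real N * norm y ^ m"
        using reals_Archimedean3[of "norm y ^ m"] by auto
      have "\<forall>\<^sub>F n in sequentially. D (Suc n) y = 0"
        using eventually_ge_at_top[of N]
      proof eventually_elim
        case (elim n)
        have "real N * norm y ^ m \<le> real (Suc n) * norm y ^ m"
          using elim by (intro mult_right_mono) auto
        with N show ?case by (simp add: D_def cut_def)
      qed
      then show "(\<lambda>n. D (Suc n) y) \<longlonglongrightarrow> 0" by (rule tendsto_eventually)
    qed
    show "AE y in lborel. norm (D (Suc n) y) \<le> D 1 y" for n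
    proof (intro AE_I2)
      fix y
      have "cut 1 y \<le> cut (Suc n) y"
        unfolding cut_def by (intro min.mono mult_right_mono) auto
      then show "norm (D (Suc n) y) \<le> D 1 y"
        using C(1) cut[of "Suc n" y] unfolding D_def by (auto simp: abs_mult intro!: mult_left_mono divide_right_mono)
    qed
  qed (use D_int[of 1] in \<open>auto simp: D_def\<close>)
  \<comment> \<open>Translation invariance removes \<open>w\<close> from the bound; this is what
    makes the convergence uniform.\<close>
  have diff: "\<bar>potential f k w - potential f (kn n) w\<bar> \<le> B * (\<integral>y. D n y \<partial>lborel)" if "n \<ge> 1" for n w
  proof -
    have i1: "integrable lborel (\<lambda>z. f z * k (w - (z, 0)))"
      by (rule potential_integrable[OF assms])
    have i2: "integrable lborel (\<lambda>z. f z * kn n (w - (z, 0)))"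
    proof (rule Bochner_Integration.integrable_bound[OF i1])
      show "AE z in lborel. norm (f z * kn n (w - (z, 0))) \<le> norm (f z * k (w - (z, 0)))"
        using cut by (intro AE_I2) (auto simp: kn_def abs_mult intro!: mult_left_mono mult_left_le)
    qed (use kn_meas in simp)
    have i3: "integrable lborel (\<lambda>z. B * D n (fst w + (-1) *\<^sub>R z))"
      using D_int[OF that] by (intro integrable_mult_right lborel_integrable_affine) auto
    have "potential f k w - potential f (kn n) w = (\<integral>z. f z * k (w - (z, 0)) - f z * kn n (w - (z, 0)) \<partial>lborel)"
      unfolding potential_def using i1 i2 by simp
    also have "norm (\<dots>) \<le> (\<integral>z. norm (f z * k (w - (z, 0)) - f z * kn n (w - (z, 0))) \<partial>lborel)"
      by (rule integral_norm_bound)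
    also have "\<dots> \<le> (\<integral>z. B * D n (fst w + (-1) *\<^sub>R z) \<partial>lborel)"
    proof (rule integral_mono_AE)
      show "AE z in lborel. norm (f z * k (w - (z, 0)) - f z * kn n (w - (z, 0))) \<le> B * D n (fst w + (-1) *\<^sub>R z)"
      proof (rule eventually_mono[OF AE_lborel_singleton[of "fst w"]])
        fix z assume "z \<noteq> fst w"
        then have "\<bar>k (w - (z, 0)) - kn n (w - (z, 0))\<bar> \<le> D n (fst w - z)"
          using kn_diff[of "w - (z, 0)" n] by simp
        then have "\<bar>f z\<bar> * \<bar>k (w - (z, 0)) - kn n (w - (z, 0))\<bar> \<le> B * D n (fst w - z)"
          using f_le[of z] B_nonneg by (intro mult_mono) auto
        then show "norm (f z * k (w - (z, 0)) - f z * kn n (w - (z, 0))) \<le> B * D n (fst w + (-1) *\<^sub>R z)"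
          by (simp add: abs_mult flip: right_diff_distrib)
      qed
    qed (use i1 i2 i3 in simp_all)
    also have "\<dots> = B * (\<integral>y. D n y \<partial>lborel)"
      using lborel_integral_affine[of "-1" "D n" "fst w"] by simp
    finally show ?thesis by simp
  qed
  have "uniform_limit UNIV (\<lambda>n. potential f (kn (Suc n))) (potential f k) sequentially"
  proof (rule uniform_limitI)
    fix e :: real assume "0 < e"
    have "(\<lambda>n. B * (\<integral>y. D (Suc n) y \<partial>lborel)) \<longlonglongrightarrow> B * 0"
      using D_lim by (intro tendsto_intros) simp
    then have "\<forall>\<^sub>F n in sequentially. B * (\<integral>y. D (Suc n) y \<partial>lborel) < e"
      using \<open>0 < e\<close> by (intro order_tendstoD) auto
    then show "\<forall>\<^sub>F n in sequentially. \<forall>w\<in>UNIV. dist (potential f (kn (Suc n)) w) (potential f k w) < e"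
    proof eventually_elim
      case (elim n)
      then show ?case
        using diff[of "Suc n"] by (auto simp: dist_real_def abs_minus_commute intro: le_less_trans)
    qed
  qed
  then show ?thesis
    by (rule uniform_limit_theorem[rotated]) (auto intro: always_eventually \<Phi>_cont)
qed

text \<open>On the hyperplane the differentiated integrand need not have a dominating function, so
  the derivative is taken at height \<delta> and \<delta> then tends to 0 by
  \<open>has_vector_derivative_limit\<close>. The condition on \<open>m\<close> makes
  \<open>k'\<close> locally integrable too, so that both potentials are continuous up to the
  hyperplane.\<close>

lemma potential_deriv_horizontal:
  fixes k k' :: "'a \<times> real \<Rightarrow> real"
  assumes "hker m k" "hker (Suc m) k'" "kderiv (b, 0) k k'" "norm b \<le> 1"
    and m: "Suc m < DIM('a)"
  shows "((\<lambda>t. potential f k (x + t *\<^sub>R b, 0)) has_vector_derivative potential f k' (x, 0)) (at 0)"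
proof -
  have c: "continuous_on UNIV (potential f k)" "continuous_on UNIV (potential f k')"
    using m by (auto intro!: potential_continuous[OF assms(1)] potential_continuous[OF assms(2)])
  have "((\<lambda>r. potential f k (x + r *\<^sub>R b, 0)) has_vector_derivative potential f k' (x + 0 *\<^sub>R b, 0)) (at 0)"
  proof (rule has_vector_derivative_limit[where G = "\<lambda>r \<delta>. potential f k (x + r *\<^sub>R b, \<delta>)" and H = "\<lambda>r \<delta>. potential f k' (x + r *\<^sub>R b, \<delta>)"])
    show "continuous_on UNIV (\<lambda>\<delta>. potential f k (x + s *\<^sub>R b, \<delta>))" for s
      by (rule continuous_on_compose2[OF c(1)]) (auto intro!: continuous_intros)
    have "continuous_on UNIV (\<lambda>p. potential f k' (x + fst p *\<^sub>R b, snd p))"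
      by (rule continuous_on_compose2[OF c(2)]) (auto intro!: continuous_intros)
    then show "isCont (\<lambda>p. potential f k' (x + fst p *\<^sub>R b, snd p)) (0, 0)"
      by (simp add: continuous_on_eq_continuous_at)
    fix r \<delta> :: real assume "\<delta> \<noteq> 0"
    then have "((\<lambda>t. potential f k ((x + r *\<^sub>R b, \<delta>) + t *\<^sub>R (b, 0))) has_vector_derivative
      potential f k' (x + r *\<^sub>R b, \<delta>)) (at (r - r))"
      using potential_deriv_off[OF assms(1-3), of "(x + r *\<^sub>R b, \<delta>)"] assms(4) by simp
    then have "((\<lambda>t. potential f k ((x + r *\<^sub>R b, \<delta>) + (t - r) *\<^sub>R (b, 0))) has_vector_derivative
      potential f k' (x + r *\<^sub>R b, \<delta>)) (at r)"
      using vector_diff_chain_at[of "\<lambda>s. s - r" 1 r "\<lambda>t. potential f k ((x + r *\<^sub>R b, \<delta>) + t *\<^sub>R (b, 0))"]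
        has_vector_derivative_diff[OF has_vector_derivative_id has_vector_derivative_const]
      by (simp add: o_def)
    then show "((\<lambda>t. potential f k (x + t *\<^sub>R b, \<delta>)) has_vector_derivative
      potential f k' (x + r *\<^sub>R b, \<delta>)) (at r)"
      by (simp add: algebra_simps)
  qed
  then show ?thesis by simp
qed

end

section \<open>The geometric cdf and its iterated Laplacians\<close>

abbreviation riesz :: "nat \<Rightarrow> 'e::euclidean_space \<Rightarrow> real" where
  "riesz m \<equiv> \<lambda>w. 1 / norm w ^ m"

text \<open>For m = 1 this is the component along \<open>b\<close> of the unit vector
  \<open>w / norm w\<close>, the kernel of the geometric cdf; for larger m it is, up to a factor,
  the derivative of the Riesz kernel of order m - 2.\<close>

abbreviation riesz1 :: "nat \<Rightarrow> 'e::euclidean_space \<Rightarrow> 'e \<Rightarrow> real" where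
  "riesz1 m b \<equiv> \<lambda>w. (w \<bullet> b) * (1 / norm w ^ m)"

text \<open>The derivative of \<open>riesz1 m b\<close> along \<open>b\<close>, left exactly as the
  product rule \<open>kderiv_mult\<close> returns it.\<close>

abbreviation riesz2 :: "nat \<Rightarrow> 'e::euclidean_space \<Rightarrow> 'e \<Rightarrow> real" where
  "riesz2 m b \<equiv> \<lambda>w. (b \<bullet> b) * (1 / norm w ^ m) + (w \<bullet> b) * (- real m * ((w \<bullet> b) * (1 / norm w ^ (m + 2))))"

lemma hker_riesz1: "b \<in> Basis \<Longrightarrow> hker m (riesz1 (Suc m) b)"
  by (rule hker.mult[OF _ hker.base])

lemma hker_riesz2: "b \<in> Basis \<Longrightarrow> hker m (riesz2 m b)"
  by (intro hker.add hker.scale hker.base hker.mult) (simp_all only: add_2_eq_Suc' hker.base)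

lemma kderiv_riesz1: "kderiv b (riesz1 m b) (riesz2 m b)"
  by (rule kderiv_mult[OF kderiv_base])

text \<open>The assumption on squares is Parseval's identity for \<open>v\<close>. A general
  \<open>S\<close> covers both the basis of the product space and the horizontal directions alone;
  \<open>card S - m\<close> is where the two dimensions make a difference.\<close>

lemma sum_riesz2:
  fixes v :: "'e::euclidean_space"
  assumes "v \<noteq> 0" "(\<Sum>b\<in>S. (v \<bullet> b)\<^sup>2) = (norm v)\<^sup>2" "\<And>b. b \<in> S \<Longrightarrow> b \<bullet> b = 1"
  shows "(\<Sum>b\<in>S. riesz2 m b v) = (real (card S) - real m) * riesz m v"
proof -
  have "(\<Sum>b\<in>S. riesz2 m b v) = (\<Sum>b\<in>S. riesz m v - real m / norm v ^ (m + 2) * (v \<bullet> b)\<^sup>2)"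
    using assms(3) by (intro sum.cong) (auto simp: power2_eq_square)
  also have "\<dots> = real (card S) * riesz m v - real m / norm v ^ (m + 2) * (norm v)\<^sup>2"
    unfolding sum_subtractf sum_distrib_left[symmetric] assms(2) by simp
  also have "\<dots> = (real (card S) - real m) * riesz m v"
    using assms(1) by (simp add: power_add power2_eq_square field_simps)
  finally show ?thesis .
qed

lemma sum_Basis_inner_square: "(\<Sum>b\<in>Basis. (v \<bullet> b)\<^sup>2) = (norm v)\<^sup>2"
  unfolding power2_norm_eq_inner euclidean_inner[of v v] by (simp add: power2_eq_square)

text \<open>Directional derivatives only see an open neighbourhood. This matters for
  \<open>U\<close>, which is prescribed on the half space alone.\<close>

lemma partial_deriv_cong:
  assumes "open S" "w \<in> S" "\<And>v. v \<in> S \<Longrightarrow> g v = h v"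
    and "((\<lambda>t. h (w + t *\<^sub>R b)) has_vector_derivative D) (at 0)"
  shows "((\<lambda>t. g (w + t *\<^sub>R b)) has_vector_derivative D) (at 0)" "partial_deriv b g w = D"
proof -
  have "open ((\<lambda>t. w + t *\<^sub>R b) -` S)"
    using assms(1) by (intro open_vimage continuous_intros)
  then show 1: "((\<lambda>t. g (w + t *\<^sub>R b)) has_vector_derivative D) (at 0)"
    by (rule has_vector_derivative_transform_within_open[OF assms(4)]) (use assms in auto)
  then show "partial_deriv b g w = D"
    unfolding partial_deriv_def by (rule vector_derivative_at)
qed

lemma potential_scale: "potential f (\<lambda>w. c * k w) w = c * potential f k w"
  by (simp add: potential_def mult.left_commute[of _ c])

lemma Basis_pair: "b \<in> Basis \<Longrightarrow> (b, 0) \<in> Basis" "(0, 1::real) \<in> Basis"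
  by (auto simp: Basis_prod_def)

section \<open>Laplacians of Riesz potentials and the divergence of the geometric cdf, on and off
  the hyperplane\<close>

context
  fixes f :: "'a::euclidean_space \<Rightarrow> real" and B :: real
  assumes f_int: "integrable lborel f" and f_le: "\<And>x. \<bar>f x\<bar> \<le> B"
begin

lemma partial_deriv_potential_off:
  assumes "open S" "S \<subseteq> {w. snd w \<noteq> 0}" "\<And>v. v \<in> S \<Longrightarrow> g v = c * potential f k v" "w \<in> S"
    and "hker m k" "hker n k'" "kderiv b k k'" "b \<in> Basis"
  shows "((\<lambda>t. g (w + t *\<^sub>R b)) has_vector_derivative c * potential f k' w) (at 0)"
    and "partial_deriv b g w = c * potential f k' w"
proof -
  have "((\<lambda>t. potential f k (w + t *\<^sub>R b)) has_vector_derivative potential f k' w) (at 0)"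
    using assms by (intro potential_deriv_off[OF f_int f_le assms(5-7)]) auto
  then have d: "((\<lambda>t. c * potential f k (w + t *\<^sub>R b)) has_vector_derivative c * potential f k' w) (at 0)"
    by (rule has_vector_derivative_mult_right)
  show "((\<lambda>t. g (w + t *\<^sub>R b)) has_vector_derivative c * potential f k' w) (at 0)"
    "partial_deriv b g w = c * potential f k' w"
    using partial_deriv_cong[OF assms(1,4,3) d] by auto
qed

lemma partial_deriv_potential_horizontal:
  assumes "\<And>x. g x = c * potential f k (x, 0)"
    and "hker m k" "hker (Suc m) k'" "kderiv (b, 0) k k'" "b \<in> Basis" "Suc m < DIM('a)"
  shows "partial_deriv b g x = c * potential f k' (x, 0)"
proof -
  have "((\<lambda>t. potential f k (x + t *\<^sub>R b, 0)) has_vector_derivative potential f k' (x, 0)) (at 0)"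
    using assms by (intro potential_deriv_horizontal[OF f_int f_le assms(2-4)]) auto
  then have d: "((\<lambda>t. c * potential f k (x + t *\<^sub>R b, 0)) has_vector_derivative c * potential f k' (x, 0)) (at 0)"
    by (rule has_vector_derivative_mult_right)
  show ?thesis
    using partial_deriv_cong(2)[OF open_UNIV UNIV_I, of g "\<lambda>x. c * potential f k (x, 0)", OF assms(1) d] by simp
qed

lemma sum_potential_off:
  assumes "snd w \<noteq> 0"
  shows "(\<Sum>b\<in>Basis. potential f (riesz2 m b) w) = (real DIM('a) + 1 - real m) * potential f (riesz m) w"
proof -
  have nz: "w - (z, 0) \<noteq> 0" for z using assms by (auto simp: prod_eq_iff)
  have "(\<Sum>b\<in>Basis. potential f (riesz2 m b) w) = (\<integral>z. (\<Sum>b\<in>Basis. f z * riesz2 m b (w - (z, 0))) \<partial>lborel)"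
    unfolding potential_def
    by (intro Bochner_Integration.integral_sum[symmetric] potential_integrable_off[OF f_int f_le hker_riesz2] assms)
  also have "\<dots> = (\<integral>z. (real DIM('a) + 1 - real m) * (f z * riesz m (w - (z, 0))) \<partial>lborel)"
  proof (rule Bochner_Integration.integral_cong[OF refl])
    fix z
    show "(\<Sum>b\<in>Basis. f z * riesz2 m b (w - (z, 0))) = (real DIM('a) + 1 - real m) * (f z * riesz m (w - (z, 0)))"
      unfolding sum_distrib_left[symmetric]
      by (subst sum_riesz2[OF nz sum_Basis_inner_square]) (auto simp: inner_Basis)
  qed
  finally show ?thesis by (simp only: potential_def integral_mult_right_zero)
qed

lemma sum_potential_horizontal:
  assumes "m < DIM('a)" "2 \<le> DIM('a)"
  shows "(\<Sum>b\<in>Basis. potential f (riesz2 m (b, 0)) (x, 0)) = (real DIM('a) - real m) * potential f (riesz m) (x, 0)"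
proof -
  let ?S = "(\<lambda>b::'a. (b, 0::real)) ` Basis"
  have inj: "inj_on (\<lambda>b::'a. (b, 0::real)) Basis" by (auto simp: inj_on_def)
  have "(\<Sum>b\<in>Basis. potential f (riesz2 m (b, 0)) (x, 0)) = (\<Sum>b\<in>?S. potential f (riesz2 m b) (x, 0))"
    by (simp only: sum.reindex[OF inj] o_def)
  also have "\<dots> = (\<integral>z. (\<Sum>b\<in>?S. f z * riesz2 m b ((x, 0) - (z, 0))) \<partial>lborel)"
    unfolding potential_def
    by (intro Bochner_Integration.integral_sum[symmetric] potential_integrable[OF f_int f_le hker_riesz2] assms)
       (auto simp: Basis_pair)
  also have "\<dots> = (\<integral>z. (real DIM('a) - real m) * (f z * riesz m ((x, 0::real) - (z, 0))) \<partial>lborel)"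
  proof (rule integral_cong_AE)
    show "AE z in lborel. (\<Sum>b\<in>?S. f z * riesz2 m b ((x, 0) - (z, 0))) =
        (real DIM('a) - real m) * (f z * riesz m ((x, 0::real) - (z, 0)))"
    proof (rule eventually_mono[OF AE_lborel_singleton[of x]])
      fix z :: 'a assume "z \<noteq> x"
      then have nz: "(x, 0::real) - (z, 0) \<noteq> 0" by (auto simp: prod_eq_iff)
      have sq: "(\<Sum>b\<in>?S. (((x, 0::real) - (z, 0)) \<bullet> b)\<^sup>2) = (norm ((x, 0::real) - (z, 0)))\<^sup>2"
        unfolding sum.reindex[OF inj] by (simp add: o_def sum_Basis_inner_square norm_Pair1)
      show "(\<Sum>b\<in>?S. f z * riesz2 m b ((x, 0) - (z, 0))) =
        (real DIM('a) - real m) * (f z * riesz m ((x, 0::real) - (z, 0)))"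
        unfolding sum_distrib_left[symmetric]
        by (subst sum_riesz2[OF nz sq]) (auto simp: inner_Basis card_image[OF inj])
    qed
    show "(\<lambda>z. \<Sum>b\<in>?S. f z * riesz2 m b ((x, 0) - (z, 0))) \<in> borel_measurable lborel"
    proof (rule borel_measurable_sum)
      fix b assume "b \<in> ?S"
      then have "b \<in> Basis" by (auto simp: Basis_pair)
      then show "(\<lambda>z. f z * riesz2 m b ((x, 0) - (z, 0))) \<in> borel_measurable lborel"
        by (subst measurable_lborel2) (rule kernel_measurable[OF f_int f_le hker_riesz2])
    qed
    show "(\<lambda>z. (real DIM('a) - real m) * (f z * riesz m ((x, 0::real) - (z, 0)))) \<in> borel_measurable lborel"
      by (subst measurable_lborel2)
         (intro borel_measurable_times borel_measurable_const kernel_measurable[OF f_int f_le hker.base])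
  qed
  finally show ?thesis by (simp only: potential_def integral_mult_right_zero)
qed

text \<open>The classical Laplacian of a power of the norm in d + 1 dimensions. The factor vanishes
  at m = d - 1, the fundamental solution; this is the source of harmonicity.\<close>

lemma neg_laplacian_off:
  assumes S: "open S" "S \<subseteq> {w. snd w \<noteq> 0}" "\<And>v. v \<in> S \<Longrightarrow> g v = c * potential f (riesz m) v" "w \<in> S"
  shows "neg_laplacian g w = c * (real m * (real DIM('a) - 1 - real m)) * potential f (riesz (m + 2)) w"
proof -
  have d1: "partial_deriv b g v = (- c * real m) * potential f (riesz1 (m + 2) b) v" if "v \<in> S" "b \<in> Basis" for v b
    using partial_deriv_potential_off(2)[OF S(1-3) that(1) hker.base[of m] hker.scale[OF hker_riesz1[OF that(2), of "Suc m"]] kderiv_base[of b m, unfolded add_2_eq_Suc'] that(2)]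
    by (simp only: potential_scale add_2_eq_Suc')
  have d2: "partial_deriv b (partial_deriv b g) w = (- c * real m) * potential f (riesz2 (m + 2) b) w" if "b \<in> Basis" for b
    by (rule partial_deriv_potential_off(2)[OF S(1,2) d1[OF _ that] S(4)
          hker_riesz1[OF that, of "Suc m", folded add_2_eq_Suc'] hker_riesz2[OF that] kderiv_riesz1 that])
  have "neg_laplacian g w = c * real m * (\<Sum>b\<in>Basis. potential f (riesz2 (m + 2) b) w)"
    unfolding neg_laplacian_def sum_distrib_left by (simp add: d2 sum_negf)
  also have "\<dots> = c * real m * ((real DIM('a) + 1 - real (m + 2)) * potential f (riesz (m + 2)) w)"
    using S by (subst sum_potential_off) auto
  finally show ?thesis by simp
qed

text \<open>One dimension fewer turns d - 1 - m into d - 2 - m. The resulting order m + 2 has to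
  stay below d for the second differentiation to be possible on the hyperplane.\<close>

lemma neg_laplacian_horizontal:
  assumes g: "\<And>x. g x = c * potential f (riesz m) (x, 0)" and m: "m + 2 < DIM('a)"
  shows "neg_laplacian g x = c * (real m * (real DIM('a) - 2 - real m)) * potential f (riesz (m + 2)) (x, 0)"
proof -
  have d1: "partial_deriv b g x = (- c * real m) * potential f (riesz1 (m + 2) (b, 0)) (x, 0)" if "b \<in> Basis" for x b
    using partial_deriv_potential_horizontal[OF g hker.base hker.scale[OF hker_riesz1[OF Basis_pair(1)[OF that], of "Suc m"]] kderiv_base[of "(b, 0)" m, unfolded add_2_eq_Suc'] that] m
    by (simp only: potential_scale add_2_eq_Suc')
  have d2: "partial_deriv b (partial_deriv b g) x = (- c * real m) * potential f (riesz2 (m + 2) (b, 0)) (x, 0)" if "b \<in> Basis" for b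
    using partial_deriv_potential_horizontal[OF d1[OF that, unfolded add_2_eq_Suc'] hker_riesz1[OF Basis_pair(1)[OF that], of "Suc m"]
        hker_riesz2[OF Basis_pair(1)[OF that], of "Suc (Suc m)"] kderiv_riesz1 that] m
    by (simp only: add_2_eq_Suc')
  have "neg_laplacian g x = c * real m * (\<Sum>b\<in>Basis. potential f (riesz2 (m + 2) (b, 0)) (x, 0))"
    unfolding neg_laplacian_def sum_distrib_left by (simp add: d2 sum_negf)
  also have "\<dots> = c * real m * ((real DIM('a) - real (m + 2)) * potential f (riesz (m + 2)) (x, 0))"
    using m by (subst sum_potential_horizontal) auto
  finally show ?thesis by simp
qed

lemma neg_laplacian_iter_off:
  assumes S: "open S" "S \<subseteq> {w. snd w \<noteq> 0}" "\<And>v. v \<in> S \<Longrightarrow> g v = c * potential f (riesz 1) v" "w \<in> S"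
  shows "(neg_laplacian ^^ n) g w =
    c * (\<Prod>i<n. real (2 * i + 1) * (real DIM('a) - 1 - real (2 * i + 1))) * potential f (riesz (2 * n + 1)) w"
  using S(4)
proof (induction n arbitrary: w)
  case 0
  then show ?case using S(3) by simp
next
  case (Suc n)
  have "(neg_laplacian ^^ Suc n) g w = neg_laplacian ((neg_laplacian ^^ n) g) w" by simp
  also have "\<dots> = (c * (\<Prod>i<n. real (2 * i + 1) * (real DIM('a) - 1 - real (2 * i + 1)))) *
      (real (2 * n + 1) * (real DIM('a) - 1 - real (2 * n + 1))) * potential f (riesz ((2 * n + 1) + 2)) w"
    by (rule neg_laplacian_off[OF S(1,2) Suc.IH Suc.prems])
  also have "(2 * n + 1) + 2 = 2 * Suc n + 1" by simp
  finally show ?case by (simp only: prod.lessThan_Suc mult.assoc)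
qed

lemma neg_laplacian_iter_horizontal:
  assumes g: "\<And>x. g x = c * potential f (riesz 1) (x, 0)" and n: "2 * n + 1 < DIM('a)"
  shows "(neg_laplacian ^^ n) g x =
    c * (\<Prod>i<n. real (2 * i + 1) * (real DIM('a) - 2 - real (2 * i + 1))) * potential f (riesz (2 * n + 1)) (x, 0)"
  using n
proof (induction n arbitrary: x)
  case 0
  then show ?case using g by simp
next
  case (Suc n)
  have "(neg_laplacian ^^ Suc n) g x = neg_laplacian ((neg_laplacian ^^ n) g) x" by simp
  also have "\<dots> = (c * (\<Prod>i<n. real (2 * i + 1) * (real DIM('a) - 2 - real (2 * i + 1)))) *
      (real (2 * n + 1) * (real DIM('a) - 2 - real (2 * n + 1))) * potential f (riesz ((2 * n + 1) + 2)) (x, 0)"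
    using Suc.prems by (intro neg_laplacian_horizontal Suc.IH) auto
  also have "(2 * n + 1) + 2 = 2 * Suc n + 1" by simp
  finally show ?case by (simp only: prod.lessThan_Suc mult.assoc)
qed

text \<open>Here \<open>h\<close> is the identity for \<open>P\<close> and the embedding into the
  hyperplane for \<open>Pstar\<close>; writing both measures as images of the same density lets one
  computation serve both.\<close>

lemma geometric_cdf_inner:
  fixes h :: "'a \<Rightarrow> 'e::euclidean_space"
  assumes Q: "Q = distr (density lborel (\<lambda>x. ennreal (f x))) borel h"
    and h [measurable]: "h \<in> borel_measurable borel" and f_nonneg: "\<And>x. 0 \<le> f x"
  shows "geometric_cdf Q w \<bullet> b = (\<integral>z. f z * riesz1 1 b (w - h z) \<partial>lborel)"
proof -
  let ?d = "\<lambda>v::'e. if v \<noteq> w then (w - v) /\<^sub>R norm (w - v) else 0"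
  have [measurable]: "f \<in> borel_measurable borel" using f_int by auto
  have int: "integrable lborel (\<lambda>z. f z *\<^sub>R ?d (h z))"
    by (rule Bochner_Integration.integrable_bound[OF f_int]) auto
  have "geometric_cdf Q w = (\<integral>z. f z *\<^sub>R ?d (h z) \<partial>lborel)"
    unfolding geometric_cdf_def Q using f_nonneg
    by (subst integral_distr) (auto intro!: integral_density)
  then have "geometric_cdf Q w \<bullet> b = (\<integral>z. f z *\<^sub>R ?d (h z) \<bullet> b \<partial>lborel)"
    by (subst integral_inner_left) (use int in auto)
  \<comment> \<open>Where \<open>h z = w\<close> both sides are 0, because the inner product in
    \<open>riesz1\<close> vanishes; the indicator is thereby absorbed into the kernel.\<close>
  also have "\<dots> = (\<integral>z. f z * riesz1 1 b (w - h z) \<partial>lborel)"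
    by (intro Bochner_Integration.integral_cong) (auto simp: divide_inverse)
  finally show ?thesis .
qed

text \<open>The divergence of \<open>w / norm w\<close> is (dimension - 1) / \<open>norm w\<close>,
  here in d + 1 dimensions.\<close>

lemma divergence_geometric_cdf_off:
  assumes "Q = distr (density lborel (\<lambda>x. ennreal (f x))) borel (\<lambda>z. (z, 0::real))" "\<And>x. 0 \<le> f x"
    and w: "snd w \<noteq> 0"
  shows "divergence (geometric_cdf Q) w = real DIM('a) * potential f (riesz 1) w"
proof -
  \<comment> \<open>The factor 1 matches the shape \<open>c * potential f k v\<close> of the
    derivative rules.\<close>
  have F: "geometric_cdf Q v \<bullet> b = 1 * potential f (riesz1 1 b) v" for v b
    unfolding potential_def using geometric_cdf_inner[OF assms(1) _ assms(2)] by simp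
  have op: "open {w :: 'a \<times> real. snd w \<noteq> 0}"
    by (intro open_Collect_neq continuous_intros)
  have "partial_deriv b (\<lambda>y. geometric_cdf Q y \<bullet> b) w = 1 * potential f (riesz2 1 b) w" if "b \<in> Basis" for b
    using partial_deriv_potential_off(2)[OF op subset_refl F _ hker_riesz1[OF that, of 0, folded One_nat_def] hker_riesz2[OF that] kderiv_riesz1 that] w
    by simp
  then show ?thesis
    unfolding divergence_def using sum_potential_off[OF w, of 1] by simp
qed

lemma divergence_geometric_cdf:
  assumes "Q = density lborel (\<lambda>x. ennreal (f x))" "\<And>x. 0 \<le> f x" "2 \<le> DIM('a)"
  shows "divergence (geometric_cdf Q) x = (real DIM('a) - 1) * potential f (riesz 1) (x, 0)"
proof -
  have Q: "Q = distr (density lborel (\<lambda>x. ennreal (f x))) borel (\<lambda>z. z)"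
    unfolding assms(1) by (rule distr_id2[symmetric]) simp
  have F: "geometric_cdf Q x \<bullet> b = 1 * potential f (riesz1 1 (b, 0)) (x, 0)" for x b
    unfolding potential_def using geometric_cdf_inner[OF Q _ assms(2)] by (simp add: norm_Pair1)
  have "partial_deriv b (\<lambda>y. geometric_cdf Q y \<bullet> b) x = 1 * potential f (riesz2 1 (b, 0)) (x, 0)" if "b \<in> Basis" for b
  proof -
    have "hker (Suc 0) (riesz2 1 (b, 0 :: real))"
      using hker_riesz2[OF Basis_pair(1)[OF that], of 1] by (simp only: One_nat_def)
    then show ?thesis
      using partial_deriv_potential_horizontal[OF F hker_riesz1[OF Basis_pair(1)[OF that], of 0, folded One_nat_def] _ kderiv_riesz1 that] assms(3)
      by simp
  qed
  then show ?thesis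
    unfolding divergence_def using sum_potential_horizontal[of 1 x] assms(3) by simp
qed

text \<open>Every iterated partial derivative is again \<open>c\<close> times the potential of a
  kernel in some \<open>hker\<close>, so all orders reduce to continuity and differentiability of
  potentials off the hyperplane.\<close>

lemma smooth_on_potential:
  assumes "hker m k" "\<And>w. w \<in> UNIV \<times> {0<..} \<Longrightarrow> g w = c * potential f k w"
  shows "smooth_on (UNIV \<times> {0<..}) g"
proof -
  let ?S = "UNIV \<times> {0<..} :: ('a \<times> real) set"
  have op: "open ?S" by (intro open_Times) auto
  have sub: "?S \<subseteq> {w. snd w \<noteq> 0}" by auto
  have *: "\<exists>m k. hker m k \<and> (\<forall>w\<in>?S. iter_partial bs g w = c * potential f k w)" if "bs \<in> lists Basis" for bs
    using that
  proof (induction bs rule: list.induct)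
    case Nil
    then show ?case using assms by (auto simp: iter_partial_def)
  next
    case (Cons b bs)
    then obtain m k where k: "hker m k" "\<And>w. w \<in> ?S \<Longrightarrow> iter_partial bs g w = c * potential f k w" by auto
    obtain k' where k': "hker (Suc m) k'" "kderiv b k k'" using hker_kderiv[OF k(1), of b] Cons.prems by auto
    have "iter_partial (b # bs) g w = c * potential f k' w" if "w \<in> ?S" for w
      using partial_deriv_potential_off(2)[OF op sub k(2) that k(1) k'] Cons.prems by (simp add: iter_partial_def)
    with k'(1) show ?case by blast
  qed
  show ?thesis
    unfolding smooth_on_def
  proof (intro ballI conjI)
    fix bs :: "('a \<times> real) list" assume bs: "bs \<in> lists Basis"
    then obtain m k where k: "hker m k" "\<And>w. w \<in> ?S \<Longrightarrow> iter_partial bs g w = c * potential f k w"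
      using * by blast
    have "continuous_on ?S (\<lambda>w. c * potential f k w)"
      by (intro continuous_intros continuous_on_subset[OF potential_continuous_off[OF f_int f_le k(1)] sub])
    then show "continuous_on ?S (iter_partial bs g)"
      using k(2) by (simp cong: continuous_on_cong)
    fix w b :: "'a \<times> real" assume w: "w \<in> ?S" and b: "b \<in> Basis"
    obtain k' where k': "hker (Suc m) k'" "kderiv b k k'" using hker_kderiv[OF k(1) b] by auto
    show "(\<lambda>t. iter_partial bs g (w + t *\<^sub>R b)) differentiable at 0"
      using partial_deriv_potential_off(1)[OF op sub k(2) w k(1) k' b] by (rule differentiableI_vector)
  qed
qed

end

text \<open>The constant of the Riesz potential of order 1 in d dimensions, that is, of the inverse
  of (-\<Delta>)^(1/2).\<close>

definition riesz_const :: "nat \<Rightarrow> real" where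
  "riesz_const d = Gamma ((real d - 1) / 2) / (2 * pi powr ((real d + 1) / 2))"

section \<open>Evaluation of the products of exponents by Gamma values\<close>

lemma prod_odd_Gamma: "(\<Prod>i<n. real (2 * i + 1)) = 2 ^ n * Gamma (real n + 1 / 2) / sqrt pi"
proof (induction n)
  case 0
  then show ?case by (simp add: Gamma_one_half_real)
next
  case (Suc n)
  have "Gamma (real n + 1 / 2 + 1) = (real n + 1 / 2) * Gamma (real n + 1 / 2)"
    by (rule Gamma_plus1) (auto elim!: nonpos_Ints_cases)
  then have e: "Gamma (real (Suc n) + 1 / 2) = (real n + 1 / 2) * Gamma (real n + 1 / 2)"
    by (simp add: add_ac)
  show ?case unfolding prod.lessThan_Suc Suc.IH e by (simp add: field_simps)
qed

context
  fixes N d :: nat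
  assumes d: "d = 2 * N + 2"
begin

text \<open>Read backwards, the factors d - 2 - (2 i + 1) are the odd numbers below 2 N once more,
  so the product is the square of a double factorial.\<close>

lemma gamma_const_horizontal:
  "gamma_const d * ((real d - 1) * (\<Prod>i<N. real (2 * i + 1) * (real d - 2 - real (2 * i + 1)))) = riesz_const d"
proof -
  define g where "g = Gamma (real N + 1 / 2)"
  have g: "g > 0" unfolding g_def by (rule Gamma_real_pos) simp
  have G: "Gamma ((real d + 1) / 2) = (real N + 1 / 2) * g"
  proof -
    have "Gamma (real N + 1 / 2 + 1) = (real N + 1 / 2) * g"
      unfolding g_def by (rule Gamma_plus1) (auto elim!: nonpos_Ints_cases)
    then show ?thesis by (simp add: d algebra_simps add_divide_distrib)
  qed
  have "(\<Prod>i<N. real d - 2 - real (2 * i + 1)) = (\<Prod>i<N. real (2 * (N - Suc i) + 1))"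
    by (intro prod.cong) (auto simp: d of_nat_diff algebra_simps)
  also have "\<dots> = (\<Prod>i<N. real (2 * i + 1))"
    using prod.nat_diff_reindex[of "\<lambda>i. real (2 * i + 1)" N] by simp
  finally have P: "(\<Prod>i<N. real (2 * i + 1) * (real d - 2 - real (2 * i + 1))) = (2 ^ N * g / sqrt pi)\<^sup>2"
    unfolding prod.distrib prod_odd_Gamma g_def by (simp add: power2_eq_square)
  have P': "(2 ^ N * g / sqrt pi)\<^sup>2 = 2 ^ (2 * N) * g\<^sup>2 / pi"
    by (simp add: power_divide power_mult_distrib power_mult[symmetric] mult.commute)
  have pi: "pi powr ((real d - 1) / 2) = pi ^ N * sqrt pi" "pi powr ((real d + 1) / 2) = pi ^ (N + 1) * sqrt pi"
  proof -
    have "(real d - 1) / 2 = real N + 1 / 2" "(real d + 1) / 2 = real (N + 1) + 1 / 2" by (auto simp: d field_simps)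
    then show "pi powr ((real d - 1) / 2) = pi ^ N * sqrt pi" "pi powr ((real d + 1) / 2) = pi ^ (N + 1) * sqrt pi"
      by (simp_all only: powr_add powr_realpow[OF pi_gt_zero] powr_half_sqrt[OF pi_ge_zero])
  qed
  have c: "(real d - 1) / 2 = real N + 1 / 2" by (auto simp: d field_simps)
  show ?thesis
    unfolding gamma_const_def riesz_const_def P P' G pi unfolding c g_def[symmetric]
    using g by (simp add: d field_simps power_add power2_eq_square power_mult)
      (subst nonzero_divide_eq_eq,
        (intro less_imp_neq[THEN not_sym] add_pos_nonneg mult_pos_pos mult_nonneg_nonneg; simp), simp add: algebra_simps)
qed

text \<open>Here the factors d - 1 - (2 i + 1) are even and produce 2^N N!, which cancels against
  the factorial in the Gamma value of \<open>gamma_const (d + 1)\<close>. The leading 2 from the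
  definition of \<open>U\<close> brings the outcome to the horizontal constant, so that
  \<open>U\<close> and \<open>u\<close> match on the boundary.\<close>

lemma gamma_const_off:
  "2 * gamma_const (d + 1) * (real d * (\<Prod>i<N. real (2 * i + 1) * (real d - 1 - real (2 * i + 1)))) = riesz_const d"
proof -
  define g where "g = Gamma (real N + 1 / 2)"
  have g: "g > 0" unfolding g_def by (rule Gamma_real_pos) simp
  have G: "Gamma ((real (d + 1) + 1) / 2) = (real N + 1) * fact N"
  proof -
    have "(real (d + 1) + 1) / 2 = 1 + real (Suc N)" by (simp add: d)
    then show ?thesis by (simp only: Gamma_fact) (simp add: algebra_simps)
  qed
  have "(\<Prod>i<N. real d - 1 - real (2 * i + 1)) = (\<Prod>i<N. 2 * real (Suc (N - Suc i)))"
    by (intro prod.cong) (auto simp: d of_nat_diff algebra_simps)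
  also have "\<dots> = (\<Prod>i<N. 2 * real (Suc i))"
    using prod.nat_diff_reindex[of "\<lambda>i. 2 * real (Suc i)" N] by simp
  also have "\<dots> = 2 ^ N * fact N"
  proof -
    have "(\<Prod>i<N. real (Suc i)) = fact N" by (simp add: fact_prod_Suc lessThan_atLeast0)
    then show ?thesis by (simp only: prod.distrib prod_constant card_lessThan)
  qed
  finally have P: "(\<Prod>i<N. real (2 * i + 1) * (real d - 1 - real (2 * i + 1))) = (2 ^ N * g / sqrt pi) * (2 ^ N * fact N)"
    unfolding prod.distrib prod_odd_Gamma g_def by simp
  have pi: "pi powr ((real (d + 1) - 1) / 2) = pi ^ (N + 1)" "pi powr ((real d + 1) / 2) = pi ^ (N + 1) * sqrt pi"
  proof -
    have "(real (d + 1) - 1) / 2 = real (N + 1)" "(real d + 1) / 2 = real (N + 1) + 1 / 2" by (auto simp: d field_simps)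
    then show "pi powr ((real (d + 1) - 1) / 2) = pi ^ (N + 1)" "pi powr ((real d + 1) / 2) = pi ^ (N + 1) * sqrt pi"
      by (simp_all only: powr_add powr_realpow[OF pi_gt_zero] powr_half_sqrt[OF pi_ge_zero])
  qed
  have c: "(real d - 1) / 2 = real N + 1 / 2" by (auto simp: d field_simps)
  show ?thesis
    unfolding gamma_const_def riesz_const_def P G pi unfolding c g_def[symmetric]
    using g by (simp add: d field_simps power_add power2_eq_square power_mult)
      (subst nonzero_divide_eq_eq,
        (intro less_imp_neq[THEN not_sym] add_pos_nonneg mult_pos_pos mult_nonneg_nonneg; simp), simp add: algebra_simps)
qed

end

section \<open>Boundary behaviour\<close>

text \<open>A non-integrable \<open>f\<close> has integral 0 by convention and the right-hand side
  is nonnegative, so pointwise domination settles every case.\<close>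

lemma norm_integral_le:
  fixes f :: "'a \<Rightarrow> 'b::{banach, second_countable_topology}"
  assumes "integrable M g" "\<And>x. norm (f x) \<le> g x"
  shows "norm (\<integral>x. f x \<partial>M) \<le> (\<integral>x. g x \<partial>M)"
proof (cases "integrable M f")
  case True
  have "norm (\<integral>x. f x \<partial>M) \<le> (\<integral>x. norm (f x) \<partial>M)" by (rule integral_norm_bound)
  also have "\<dots> \<le> (\<integral>x. g x \<partial>M)" using True assms by (intro integral_mono) auto
  finally show ?thesis .
next
  case False
  have "0 \<le> g x" for x using assms(2)[of x] norm_ge_zero order_trans by blast
  then show ?thesis using False by (simp add: not_integrable_integral_eq)
qed

text \<open>The factor d - 1 comes from the vertical derivative of the kernel of order d - 1, and
  the last factor is the mass from \<open>poisson_integral\<close> at height 1. With s = (d - 1) / 2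
  all reduces to Gamma (s + 1) = s Gamma s.\<close>

lemma poisson_const:
  assumes "2 \<le> d"
  shows "riesz_const d * (real d - 1) * (pi powr ((real d + 1) / 2) / Gamma ((real d + 1) / 2)) = 1"
proof -
  define s where "s = (real d - 1) / 2"
  have d: "real d - 1 = 2 * s" "(real d + 1) / 2 = s + 1" by (simp_all add: s_def field_simps)
  have s: "0 < s" using assms by (simp add: s_def)
  then have "Gamma (s + 1) = s * Gamma s"
    by (intro Gamma_plus1) (auto elim!: nonpos_Ints_cases)
  moreover have "Gamma s \<noteq> 0" using Gamma_real_pos[OF s] by simp
  ultimately show ?thesis
    using s unfolding riesz_const_def d by simp
qed

lemma isCont_holder_loc:
  fixes f :: "'a::euclidean_space \<Rightarrow> real"
  assumes "holder_loc \<beta> \<Omega> f" "0 < \<beta>" "open \<Omega>" "x \<in> \<Omega>"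
  shows "isCont f x"
proof -
  obtain r where r: "0 < r" "cball x r \<subseteq> \<Omega>"
    using assms(3,4) open_contains_cball by blast
  obtain C where C: "\<And>y z. y \<in> cball x r \<Longrightarrow> z \<in> cball x r \<Longrightarrow> \<bar>f y - f z\<bar> \<le> C * norm (y - z) powr \<beta>"
    using assms(1) r(2) unfolding holder_loc_def by (metis compact_cball)
  have "((\<lambda>y. f y - f x) \<longlongrightarrow> 0) (at x)"
  proof (rule tendsto_0_le)
    have "((\<lambda>y. norm (y - x)) \<longlongrightarrow> 0) (at x)"
      by (rule tendsto_norm_zero, rule LIM_zero, rule tendsto_ident_at)
    then have "((\<lambda>y. norm (y - x) powr \<beta>) \<longlongrightarrow> 0) (at x)"
      by (rule tendsto_zero_powrI[OF _ tendsto_const _ assms(2)]) simp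
    then show "((\<lambda>y. C * norm (y - x) powr \<beta>) \<longlongrightarrow> 0) (at x)"
      by (rule tendsto_mult_right_zero)
    show "\<forall>\<^sub>F y in at x. norm (f y - f x) \<le> norm (C * norm (y - x) powr \<beta>) * 1"
      unfolding eventually_at
    proof (intro exI[of _ r] conjI ballI impI)
      fix y assume "y \<noteq> x \<and> dist y x < r"
      then have "\<bar>f y - f x\<bar> \<le> C * norm (y - x) powr \<beta>"
        using r(1) by (intro C) (auto simp: dist_commute)
      then show "norm (f y - f x) \<le> norm (C * norm (y - x) powr \<beta>) * 1" by simp
    qed (rule r(1))
  qed
  then show ?thesis
    unfolding isCont_def by (rule LIM_zero_cancel)
qed

context
  fixes f :: "'a::euclidean_space \<Rightarrow> real" and B :: real
  assumes f_int: "integrable lborel f" and f_le: "\<And>x. \<bar>f x\<bar> \<le> B"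
begin

text \<open>Substituting z = x + \<epsilon> y brings \<epsilon>^d from the measure and
  \<epsilon>^-(d + 1) from the kernel. With the prefactor all powers cancel, leaving a fixed kernel
  of height 1 for \<open>approximate_identity\<close>.\<close>

lemma poisson_limit:
  assumes "isCont f x"
  shows "((\<lambda>\<epsilon>. \<epsilon> * potential f (riesz (DIM('a) + 1)) (x, \<epsilon>)) \<longlongrightarrow>
    pi powr ((DIM('a) + 1) / 2) / Gamma ((DIM('a) + 1) / 2) * f x) (at_right 0)"
proof -
  let ?k = "\<lambda>y::'a. 1 / norm (y, 1::real) ^ (DIM('a) + 1)"
  have f [measurable]: "f \<in> borel_measurable borel" using f_int by auto
  have k: "integrable lborel ?k" "(\<integral>y. ?k y \<partial>lborel) = pi powr ((DIM('a) + 1) / 2) / Gamma ((DIM('a) + 1) / 2)"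
    using poisson_integral[of 1, where 'a='a] by (auto simp only: has_bochner_integral_iff div_by_1 zero_less_one)
  have eq: "\<epsilon> * potential f (riesz (DIM('a) + 1)) (x, \<epsilon>) = (\<integral>y. ?k y *\<^sub>R f (x + \<epsilon> *\<^sub>R y) \<partial>lborel)" if "0 < \<epsilon>" for \<epsilon>
  proof -
    have "potential f (riesz (DIM('a) + 1)) (x, \<epsilon>) =
        \<bar>\<epsilon>\<bar> ^ DIM('a) *\<^sub>R (\<integral>y. f (x + \<epsilon> *\<^sub>R y) * riesz (DIM('a) + 1) ((x, \<epsilon>) - (x + \<epsilon> *\<^sub>R y, 0)) \<partial>lborel)"
      unfolding potential_def using that by (intro lborel_integral_affine) auto
    also have "\<dots> = \<epsilon> ^ DIM('a) * (\<integral>y. (1 / \<epsilon> ^ (DIM('a) + 1)) * (?k y *\<^sub>R f (x + \<epsilon> *\<^sub>R y)) \<partial>lborel)"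
    proof -
      have "norm ((x, \<epsilon>) - (x + \<epsilon> *\<^sub>R y, 0)) = \<epsilon> * norm (y, 1::real)" for y
      proof -
        have "norm ((x, \<epsilon>) - (x + \<epsilon> *\<^sub>R y, 0)) = norm (\<epsilon> *\<^sub>R (y, 1::real))"
          by (simp add: norm_Pair)
        then show ?thesis using that by (simp only: norm_scaleR)
      qed
      then show ?thesis using that by (simp add: power_mult_distrib mult_ac del: scaleR_Pair)
    qed
    finally show ?thesis using that by (simp only: integral_mult_right_zero) simp
  qed
  have "((\<lambda>\<epsilon>. \<integral>y. ?k y *\<^sub>R f (x + \<epsilon> *\<^sub>R y) \<partial>lborel) \<longlongrightarrow> (\<integral>y. ?k y \<partial>lborel) *\<^sub>R f x) (at_right 0)"
    using k f_le assms by (intro approximate_identity[where B = B]) auto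
  moreover have "\<forall>\<^sub>F \<epsilon> in at_right 0. (\<integral>y. ?k y *\<^sub>R f (x + \<epsilon> *\<^sub>R y) \<partial>lborel) = \<epsilon> * potential f (riesz (DIM('a) + 1)) (x, \<epsilon>)"
    using eq by (intro eventually_at_rightI[of 0 1]) auto
  ultimately show ?thesis
    unfolding k(2) by (simp only: real_scaleR_def tendsto_cong)
qed

text \<open>All sources lie at height 0, so the vertical coordinate of
  \<open>(x, \<epsilon>) - (z, 0)\<close> is \<epsilon> for every z and leaves the integral: the
  vertical derivative is a Poisson integral.\<close>

lemma normal_derivative_limit:
  assumes U: "\<And>w. w \<in> UNIV \<times> {0<..} \<Longrightarrow> U w = riesz_const DIM('a) * potential f (riesz (DIM('a) - 1)) w"
    and "2 \<le> DIM('a)" "isCont f x"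
  shows "((\<lambda>\<epsilon>. - partial_deriv (0, 1) U (x, \<epsilon>)) \<longlongrightarrow> f x) (at_right 0)"
proof -
  define m where "m = DIM('a) - 1"
  have m: "DIM('a) = Suc m" "real m = real DIM('a) - 1" using assms(2) by (auto simp: m_def)
  let ?S = "UNIV \<times> {0<..} :: ('a \<times> real) set"
  have eq: "- partial_deriv (0, 1) U (x, \<epsilon>) =
      riesz_const DIM('a) * real m * (\<epsilon> * potential f (riesz (DIM('a) + 1)) (x, \<epsilon>))" if "0 < \<epsilon>" for \<epsilon>
  proof -
    have "partial_deriv (0, 1) U (x, \<epsilon>) = riesz_const DIM('a) *
        potential f (\<lambda>w. - real m * riesz1 (m + 2) (0, 1) w) (x, \<epsilon>)"
    proof (rule partial_deriv_potential_off(2)[OF f_int f_le, where S = ?S])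
      show "open ?S" by (intro open_Times) auto
      show "hker m (riesz m :: 'a \<times> real \<Rightarrow> real)" by (rule hker.base)
      show "hker (Suc m) (\<lambda>w::'a \<times> real. - real m * riesz1 (m + 2) (0, 1) w)"
        unfolding add_2_eq_Suc' by (intro hker.scale hker_riesz1 Basis_pair)
      show "kderiv (0, 1) (riesz m) (\<lambda>w::'a \<times> real. - real m * riesz1 (m + 2) (0, 1) w)" by (rule kderiv_base)
    qed (use that U in \<open>auto simp: m_def Basis_pair\<close>)
    also have "potential f (\<lambda>w. - real m * riesz1 (m + 2) (0, 1) w) (x, \<epsilon>) =
        - real m * (\<epsilon> * potential f (riesz (m + 2)) (x, \<epsilon>))"
    proof -
      have "f z * riesz1 (m + 2) (0, 1) ((x, \<epsilon>) - (z, 0)) = \<epsilon> * (f z * riesz (m + 2) ((x, \<epsilon>) - (z, 0)))" for z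
        by simp
      then show ?thesis
        unfolding potential_scale by (simp only: potential_def integral_mult_right_zero)
    qed
    finally show ?thesis by (simp add: m(1))
  qed
  have "((\<lambda>\<epsilon>. riesz_const DIM('a) * real m * (\<epsilon> * potential f (riesz (DIM('a) + 1)) (x, \<epsilon>))) \<longlongrightarrow>
      riesz_const DIM('a) * real m * (pi powr ((DIM('a) + 1) / 2) / Gamma ((DIM('a) + 1) / 2) * f x)) (at_right 0)"
    by (intro tendsto_mult_left poisson_limit assms)
  also have "riesz_const DIM('a) * real m * (pi powr ((DIM('a) + 1) / 2) / Gamma ((DIM('a) + 1) / 2) * f x) =
      riesz_const DIM('a) * (real DIM('a) - 1) * (pi powr ((DIM('a) + 1) / 2) / Gamma ((DIM('a) + 1) / 2)) * f x"
    unfolding m(2) by (simp only: mult.assoc)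
  also have "\<dots> = f x"
    using poisson_const[OF assms(2)] by (simp only: of_nat_add of_nat_1 mult_1)
  finally show ?thesis
    by (rule Lim_transform_eventually) (auto intro!: eventually_at_rightI[of 0 1] simp: eq)
qed

text \<open>This keeps the inner integral bounded when \<open>u\<close> is paired with an integrable
  \<open>half_laplacian\<close>; a bound from above is enough, as density and kernel are
  nonnegative. The split at distance 1 is that of \<open>potential_integrable\<close>.\<close>

lemma riesz_potential_bounded:
  assumes "m < DIM('a)" "2 \<le> DIM('a)" "\<And>x. 0 \<le> f x"
  shows "\<exists>M\<ge>0. \<forall>x. potential f (riesz m) (x, 0) \<le> M"
proof -
  let ?s = "\<lambda>y::'a. indicator (cball 0 1) y / norm y ^ m :: real"
  have s: "integrable lborel ?s" by (rule singular_kernel_integrable[OF assms(2,1)])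
  have B: "0 \<le> B" using f_le[of 0] by linarith
  have "potential f (riesz m) (x, 0) \<le> (\<integral>z. f z \<partial>lborel) + B * (\<integral>y. ?s y \<partial>lborel)" for x
  proof -
    have i: "integrable lborel (\<lambda>z. B * ?s (x + (-1) *\<^sub>R z))"
      using s by (intro integrable_mult_right lborel_integrable_affine) auto
    have "potential f (riesz m) (x, 0) \<le> (\<integral>z. f z + B * ?s (x + (-1) *\<^sub>R z) \<partial>lborel)"
      unfolding potential_def
    proof (rule integral_mono)
      show "integrable lborel (\<lambda>z. f z * riesz m ((x, 0::real) - (z, 0)))"
        by (rule potential_integrable[OF f_int f_le hker.base assms(1,2)])
      show "integrable lborel (\<lambda>z. f z + B * ?s (x + (-1) *\<^sub>R z))"
        by (intro Bochner_Integration.integrable_add f_int i)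
      fix z
      have n: "norm ((x, 0::real) - (z, 0)) = norm (x - z)" by (simp add: norm_Pair1)
      show "f z * riesz m ((x, 0::real) - (z, 0)) \<le> f z + B * ?s (x + (-1) *\<^sub>R z)"
      proof (cases "norm (x - z) \<le> 1")
        case True
        have "f z * riesz m (x - z) \<le> B * riesz m (x - z)"
          using f_le[of z] by (intro mult_right_mono) auto
        then show ?thesis unfolding n using True assms(3)[of z] by simp
      next
        case False
        then have "1 \<le> norm (x - z) ^ m" by (intro one_le_power) simp
        then have "riesz m (x - z) \<le> 1" by (subst divide_le_eq_1) auto
        then have "f z * riesz m (x - z) \<le> f z * 1" using assms(3)[of z] by (intro mult_left_mono)
        then show ?thesis unfolding n using False by simp
      qed
    qed
    also have "\<dots> = (\<integral>z. f z \<partial>lborel) + B * (\<integral>z. ?s (x + (-1) *\<^sub>R z) \<partial>lborel)"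
      using f_int i by (subst Bochner_Integration.integral_add) (simp_all only: integral_mult_right_zero)
    also have "(\<integral>z. ?s (x + (-1) *\<^sub>R z) \<partial>lborel) = (\<integral>y. ?s y \<partial>lborel)"
      using lborel_integral_affine[of "-1" ?s x] by simp
    finally show ?thesis .
  qed
  moreover have "0 \<le> (\<integral>z. f z \<partial>lborel) + B * (\<integral>y. ?s y \<partial>lborel)"
    using assms(3) B by (intro add_nonneg_nonneg mult_nonneg_nonneg Bochner_Integration.integral_nonneg) auto
  ultimately show ?thesis by blast
qed

end

section \<open>Fourier inversion\<close>

lemma fourier_fchar: "fourier \<psi> \<xi> = (\<integral>x. \<psi> x * fchar (- (x \<bullet> \<xi>)) \<partial>lborel)"
  by (simp add: fourier_def fchar_def)

lemma inverse_fourier_fchar: "inverse_fourier g x = (\<integral>\<xi>. g \<xi> * fchar (x \<bullet> \<xi>) \<partial>lborel)"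
  by (simp add: inverse_fourier_def fchar_def)

lemma integrable_fchar_mult:
  fixes A :: "'a::euclidean_space \<Rightarrow> complex"
  assumes "integrable lborel A" "(\<lambda>\<xi>. h \<xi>) \<in> borel_measurable borel"
  shows "integrable lborel (\<lambda>\<xi>. A \<xi> * fchar (h \<xi>))"
proof (rule Bochner_Integration.integrable_bound[OF assms(1)])
  have [measurable]: "A \<in> borel_measurable borel" "h \<in> borel_measurable borel" using assms by auto
  show "(\<lambda>\<xi>. A \<xi> * fchar (h \<xi>)) \<in> borel_measurable lborel" by measurable
qed (simp add: norm_mult)

lemma inverse_fourier_measurable:
  fixes A :: "'a::euclidean_space \<Rightarrow> complex"
  assumes [measurable]: "A \<in> borel_measurable borel"
  shows "inverse_fourier A \<in> borel_measurable borel"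
proof -
  have "(\<lambda>x. \<integral>\<xi>. A \<xi> * fchar (x \<bullet> \<xi>) \<partial>lborel) \<in> borel_measurable borel" by measurable
  then show ?thesis by (simp add: inverse_fourier_fchar[abs_def])
qed

lemma inverse_fourier_bounded:
  assumes "integrable lborel A"
  shows "norm (inverse_fourier A x) \<le> (\<integral>\<xi>. norm (A \<xi>) \<partial>lborel)"
  unfolding inverse_fourier_fchar using assms by (intro norm_integral_le) (auto simp: norm_mult)

text \<open>The multiplication formula against a Gaussian centred at \<open>z\<close>. Both
  \<open>A\<close> and the Gaussian are integrable, so the double integral converges absolutely and
  the inner integral is \<open>fourier_gaussian\<close>.\<close>

lemma gaussian_inverse_fourier:
  fixes z :: "'a::euclidean_space"
  assumes A: "integrable lborel A" and "0 < \<tau>"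
  shows "(\<integral>x. complex_of_real (exp (- \<tau> * (norm (x - z))\<^sup>2)) * inverse_fourier A x \<partial>lborel) =
    complex_of_real ((pi / \<tau>) powr (DIM('a) / 2)) *
      (\<integral>\<xi>. A \<xi> * complex_of_real (exp (- pi\<^sup>2 * (norm \<xi>)\<^sup>2 / \<tau>)) * fchar (z \<bullet> \<xi>) \<partial>lborel)"
proof -
  let ?G = "\<lambda>y::'a. complex_of_real (exp (- \<tau> * (norm y)\<^sup>2))"
  let ?F = "\<lambda>x \<xi>. ?G (x - z) * (A \<xi> * fchar (x \<bullet> \<xi>))"
  have [measurable]: "A \<in> borel_measurable borel" using A by auto
  have Gint: "integrable lborel (\<lambda>x::'a. exp (- \<tau> * (norm x)\<^sup>2))"
    using gaussian_integral[OF assms(2), where 'a='a] by (simp only: has_bochner_integral_iff)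
  then have Gz: "integrable lborel (\<lambda>x. exp (- \<tau> * (norm (x - z))\<^sup>2))"
    using lborel_integrable_affine[of 1 "\<lambda>x::'a. exp (- \<tau> * (norm x)\<^sup>2)" "- z"] by simp
  have "(\<integral>x. ?G (x - z) * inverse_fourier A x \<partial>lborel) = (\<integral>x. \<integral>\<xi>. ?F x \<xi> \<partial>lborel \<partial>lborel)"
    by (simp only: inverse_fourier_fchar integral_mult_right_zero)
  also have "\<dots> = (\<integral>\<xi>. \<integral>x. ?F x \<xi> \<partial>lborel \<partial>lborel)"
  proof (rule lborel_Fubini)
    show "AE x in lborel. integrable lborel (?F x)"
      by (intro AE_I2 integrable_mult_right integrable_fchar_mult A) simp
    show "AE x in lborel. (\<integral>\<xi>. norm (?F x \<xi>) \<partial>lborel) \<le> exp (- \<tau> * (norm (x - z))\<^sup>2) * (\<integral>\<xi>. norm (A \<xi>) \<partial>lborel)"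
      by (intro AE_I2) (simp add: norm_mult)
    show "integrable lborel (\<lambda>x. exp (- \<tau> * (norm (x - z))\<^sup>2) * (\<integral>\<xi>. norm (A \<xi>) \<partial>lborel))"
      using Gz by (rule integrable_mult_left)
  qed measurable
  also have "\<dots> = (\<integral>\<xi>. complex_of_real ((pi / \<tau>) powr (DIM('a) / 2)) *
      (A \<xi> * complex_of_real (exp (- pi\<^sup>2 * (norm \<xi>)\<^sup>2 / \<tau>)) * fchar (z \<bullet> \<xi>)) \<partial>lborel)"
  proof (rule Bochner_Integration.integral_cong[OF refl])
    fix \<xi>
    have "(\<integral>x. ?F x \<xi> \<partial>lborel) = (\<integral>x. (A \<xi> * fchar (z \<bullet> \<xi>)) * (?G x * fchar (x \<bullet> \<xi>)) \<partial>lborel)"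
      using lborel_integral_affine[of 1 "\<lambda>x. ?F x \<xi>" z]
      by (simp add: inner_add_left fchar_add mult_ac)
    also have "\<dots> = (A \<xi> * fchar (z \<bullet> \<xi>)) * complex_of_real ((pi / \<tau>) powr (DIM('a) / 2) * exp (- pi\<^sup>2 * (norm \<xi>)\<^sup>2 / \<tau>))"
      unfolding integral_mult_right_zero
      using fourier_gaussian[OF assms(2), of \<xi>] by (simp only: has_bochner_integral_iff)
    finally show "(\<integral>x. ?F x \<xi> \<partial>lborel) = complex_of_real ((pi / \<tau>) powr (DIM('a) / 2)) *
      (A \<xi> * complex_of_real (exp (- pi\<^sup>2 * (norm \<xi>)\<^sup>2 / \<tau>)) * fchar (z \<bullet> \<xi>))"
      by (simp add: mult_ac)
  qed
  finally show ?thesis by (simp only: integral_mult_right_zero)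
qed

text \<open>The factor \<open>fourier \<psi> \<xi> * fchar (z \<bullet> \<xi>)\<close> is itself the
  inverse transform of the reflected translate of \<open>\<psi>\<close>. The previous formula
  therefore applies with the dual Gaussian parameter pi^2 / \<tau>.\<close>

lemma heat_fourier:
  fixes z :: "'a::euclidean_space"
  assumes \<psi>: "integrable lborel \<psi>" and "0 < \<tau>"
  shows "(\<integral>\<xi>. fourier \<psi> \<xi> * complex_of_real (exp (- pi\<^sup>2 * (norm \<xi>)\<^sup>2 / \<tau>)) * fchar (z \<bullet> \<xi>) \<partial>lborel) =
    complex_of_real ((\<tau> / pi) powr (DIM('a) / 2)) * (\<integral>y. \<psi> (z + (-1) *\<^sub>R y) * complex_of_real (exp (- \<tau> * (norm y)\<^sup>2)) \<partial>lborel)"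
proof -
  have i: "integrable lborel (\<lambda>y. \<psi> (z + (-1) *\<^sub>R y))"
    using \<psi> by (intro lborel_integrable_affine) auto
  have \<tau>: "0 < pi\<^sup>2 / \<tau>" "pi / (pi\<^sup>2 / \<tau>) = \<tau> / pi"
    using assms(2) by (auto simp: power2_eq_square)
  have "inverse_fourier (\<lambda>y. \<psi> (z + (-1) *\<^sub>R y)) x = fourier \<psi> x * fchar (z \<bullet> x)" for x
  proof -
    have "inverse_fourier (\<lambda>y. \<psi> (z + (-1) *\<^sub>R y)) x = (\<integral>y. \<psi> (z + (-1) *\<^sub>R y) * fchar ((z - (z + (-1) *\<^sub>R y)) \<bullet> x) \<partial>lborel)"
      by (simp add: inverse_fourier_fchar inner_commute)
    also have "\<dots> = (\<integral>y. \<psi> y * fchar ((z - y) \<bullet> x) \<partial>lborel)"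
      using lborel_integral_affine[of "-1" "\<lambda>y. \<psi> y * fchar ((z - y) \<bullet> x)" z] by simp
    also have "\<dots> = (\<integral>y. \<psi> y * fchar (- (y \<bullet> x)) * fchar (z \<bullet> x) \<partial>lborel)"
      by (intro Bochner_Integration.integral_cong) (auto simp: inner_diff_left fchar_add[symmetric] mult.assoc)
    finally show ?thesis by (simp add: fourier_fchar)
  qed
  then show ?thesis
    using gaussian_inverse_fourier[OF i \<tau>(1), of 0] assms(2) unfolding \<tau>(2)
    by (simp add: mult_ac)
qed

lemma fourier_measurable:
  fixes \<psi> :: "'a::euclidean_space \<Rightarrow> complex"
  assumes [measurable]: "\<psi> \<in> borel_measurable borel"
  shows "fourier \<psi> \<in> borel_measurable borel"
proof -
  have "(\<lambda>\<xi>. \<integral>x. \<psi> x * fchar (- (x \<bullet> \<xi>)) \<partial>lborel) \<in> borel_measurable borel" by measurable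
  then show ?thesis by (simp add: fourier_fchar[abs_def])
qed

text \<open>The inverse transform damped by a Gaussian is computed in two ways: by
  \<open>heat_fourier\<close> it is an average of \<open>\<psi>\<close> that tends to
  \<open>\<psi> z\<close>, and by dominated convergence it tends to the undamped integral.\<close>

lemma fourier_inversion:
  fixes \<psi> :: "'a::euclidean_space \<Rightarrow> complex"
  assumes \<psi>: "integrable lborel \<psi>" "continuous_on UNIV \<psi>" "\<And>x. norm (\<psi> x) \<le> M"
    and A: "integrable lborel (fourier \<psi>)"
  shows "inverse_fourier (fourier \<psi>) z = \<psi> z"
proof -
  let ?L = "\<lambda>\<epsilon>. \<integral>\<xi>. fourier \<psi> \<xi> * complex_of_real (exp (- pi\<^sup>2 * (norm \<xi>)\<^sup>2 * \<epsilon>\<^sup>2)) * fchar (z \<bullet> \<xi>) \<partial>lborel"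
  let ?k = "\<lambda>y::'a. pi powr (- (DIM('a) / 2)) * exp (- 1 * (norm y)\<^sup>2)"
  have [measurable]: "\<psi> \<in> borel_measurable borel" using \<psi> by auto
  have [measurable]: "fourier \<psi> \<in> borel_measurable borel" using A by auto
  have k: "has_bochner_integral lborel ?k 1"
    using has_bochner_integral_mult_right[OF gaussian_integral[of 1, where 'a='a], of "pi powr (- (DIM('a) / 2))"]
    by (simp add: powr_add[symmetric])
  have eq: "?L \<epsilon> = (\<integral>y. ?k y *\<^sub>R \<psi> (z + (- \<epsilon>) *\<^sub>R y) \<partial>lborel)" if "0 < \<epsilon>" for \<epsilon> :: real
  proof -
    \<comment> \<open>Chosen so that rescaling y by \<epsilon> turns the Gaussian of parameter
      \<tau> into a fixed one.\<close>
    define \<tau> where "\<tau> = 1 / \<epsilon>\<^sup>2"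
    have \<tau>: "0 < \<tau>" using that by (simp add: \<tau>_def)
    have "(\<integral>y. \<psi> (z + (-1) *\<^sub>R y) * complex_of_real (exp (- \<tau> * (norm y)\<^sup>2)) \<partial>lborel) =
        \<epsilon> ^ DIM('a) *\<^sub>R (\<integral>y. \<psi> (z + (-1) *\<^sub>R (0 + \<epsilon> *\<^sub>R y)) * complex_of_real (exp (- \<tau> * (norm (0 + \<epsilon> *\<^sub>R y))\<^sup>2)) \<partial>lborel)"
      using lborel_integral_affine[of \<epsilon> "\<lambda>y. \<psi> (z + (-1) *\<^sub>R y) * complex_of_real (exp (- \<tau> * (norm y)\<^sup>2))" 0] that
      by simp
    also have "\<dots> = \<epsilon> ^ DIM('a) *\<^sub>R (\<integral>y. \<psi> (z + (- \<epsilon>) *\<^sub>R y) * complex_of_real (exp (- 1 * (norm y)\<^sup>2)) \<partial>lborel)"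
      using that by (simp add: \<tau>_def power_mult_distrib)
    finally have 1: "?L \<epsilon> = complex_of_real ((\<tau> / pi) powr (DIM('a) / 2)) *
        (\<epsilon> ^ DIM('a) *\<^sub>R (\<integral>y. \<psi> (z + (- \<epsilon>) *\<^sub>R y) * complex_of_real (exp (- 1 * (norm y)\<^sup>2)) \<partial>lborel))"
      using heat_fourier[OF \<psi>(1) \<tau>, of z] by (simp add: \<tau>_def)
    have "(\<tau> / pi) powr (DIM('a) / 2) * \<epsilon> ^ DIM('a) = pi powr (- (DIM('a) / 2))"
    proof -
      have "\<tau> powr (DIM('a) / 2) = 1 / \<epsilon> ^ DIM('a)"
      proof -
        have "(\<epsilon>\<^sup>2) powr (DIM('a) / 2) = \<epsilon> ^ DIM('a)"
        proof -
          have "\<epsilon>\<^sup>2 powr (DIM('a) / 2) = (\<epsilon> powr 2) powr (DIM('a) / 2)" using that by simp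
          also have "\<dots> = \<epsilon> powr real DIM('a)" unfolding powr_powr by simp
          also have "\<dots> = \<epsilon> ^ DIM('a)" by (rule powr_realpow[OF that])
          finally show ?thesis .
        qed
        then show ?thesis using that by (simp add: \<tau>_def powr_divide)
      qed
      moreover have "(\<tau> / pi) powr (DIM('a) / 2) = \<tau> powr (DIM('a) / 2) / pi powr (DIM('a) / 2)"
        by (rule powr_divide)
      ultimately show ?thesis using that by (simp add: powr_minus_divide)
    qed
    then have 2: "complex_of_real ((\<tau> / pi) powr (DIM('a) / 2)) * (\<epsilon> ^ DIM('a) *\<^sub>R w) = pi powr (- (DIM('a) / 2)) *\<^sub>R w" for w
      unfolding scaleR_conv_of_real mult.assoc[symmetric] of_real_mult[symmetric] by simp
    show ?thesis
      unfolding 1 2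
      unfolding integral_scaleR_right[symmetric]
      by (intro Bochner_Integration.integral_cong) (auto simp: scaleR_conv_of_real mult_ac)
  qed
  have "((\<lambda>\<epsilon>. \<integral>y. ?k y *\<^sub>R \<psi> (z + \<epsilon> *\<^sub>R y) \<partial>lborel) \<longlongrightarrow> (\<integral>y. ?k y \<partial>lborel) *\<^sub>R \<psi> z) (at 0)"
    using k \<psi> by (intro approximate_identity[where B = M])
      (auto simp: has_bochner_integral_iff continuous_on_eq_continuous_at)
  then have lim1: "((\<lambda>\<epsilon>. \<integral>y. ?k y *\<^sub>R \<psi> (z + \<epsilon> *\<^sub>R y) \<partial>lborel) \<longlongrightarrow> \<psi> z) (at 0)"
    using k by (simp only: has_bochner_integral_iff) simp
  define X where "X n = 1 / real (Suc n)" for n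
  have X: "X \<longlonglongrightarrow> 0" "\<And>n. 0 < X n" unfolding X_def by (rule LIMSEQ_Suc[OF lim_1_over_n]) simp
  \<comment> \<open>\<open>heat_fourier\<close> averages over z - y; the two-sided limit allows the
    negative scales that this requires.\<close>
  have "(\<lambda>n. - X n) \<longlonglongrightarrow> - 0" by (intro tendsto_minus X)
  then have "(\<lambda>n. \<integral>y. ?k y *\<^sub>R \<psi> (z + (- X n) *\<^sub>R y) \<partial>lborel) \<longlonglongrightarrow> \<psi> z"
    using lim1[unfolded tendsto_at_iff_sequentially o_def, rule_format, of "\<lambda>n. - X n"] X(2)
    by (simp add: less_imp_neq[symmetric] order_less_imp_not_eq2)
  then have 1: "(\<lambda>n. ?L (X n)) \<longlonglongrightarrow> \<psi> z" using eq X(2) by simp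
  have "(\<lambda>n. ?L (X n)) \<longlonglongrightarrow> (\<integral>\<xi>. fourier \<psi> \<xi> * fchar (z \<bullet> \<xi>) \<partial>lborel)"
  proof (rule integral_dominated_convergence[where w = "\<lambda>\<xi>. norm (fourier \<psi> \<xi>)"])
    show "AE \<xi> in lborel. (\<lambda>n. fourier \<psi> \<xi> * complex_of_real (exp (- pi\<^sup>2 * (norm \<xi>)\<^sup>2 * (X n)\<^sup>2)) * fchar (z \<bullet> \<xi>))
        \<longlonglongrightarrow> fourier \<psi> \<xi> * fchar (z \<bullet> \<xi>)"
    proof (intro AE_I2)
      fix \<xi>
      have "(\<lambda>n. fourier \<psi> \<xi> * complex_of_real (exp (- pi\<^sup>2 * (norm \<xi>)\<^sup>2 * (X n)\<^sup>2)) * fchar (z \<bullet> \<xi>))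
        \<longlonglongrightarrow> fourier \<psi> \<xi> * complex_of_real (exp (- pi\<^sup>2 * (norm \<xi>)\<^sup>2 * 0\<^sup>2)) * fchar (z \<bullet> \<xi>)"
        by (intro tendsto_intros X)
      then show "(\<lambda>n. fourier \<psi> \<xi> * complex_of_real (exp (- pi\<^sup>2 * (norm \<xi>)\<^sup>2 * (X n)\<^sup>2)) * fchar (z \<bullet> \<xi>))
        \<longlonglongrightarrow> fourier \<psi> \<xi> * fchar (z \<bullet> \<xi>)" by simp
    qed
  qed (use A in \<open>auto simp: norm_mult mult_left_le\<close>)
  with 1 show ?thesis
    unfolding inverse_fourier_fchar using LIMSEQ_unique by blast
qed

section \<open>Decay of the Fourier transform\<close>

text \<open>The factor 1 - exp (- q^2 exp v) is an integral over s from 0 to q. After exchanging,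
  the integral over v equals 2 sqrt pi for every s > 0, by \<open>Gamma_integral_log\<close> at 1 /
  2, and integrating this constant gives the linear growth in q.\<close>

lemma absolute_value_integral:
  fixes q :: real
  assumes "0 \<le> q"
  shows "has_bochner_integral lborel (\<lambda>v. (1 - exp (- q\<^sup>2 * exp v)) * exp (- (1/2) * v)) (2 * sqrt pi * q)"
proof (rule has_bochner_integral_nn_integral)
  have inner: "ennreal ((1 - exp (- q\<^sup>2 * exp v)) * exp (- (1/2) * v)) =
      (\<integral>\<^sup>+s. ennreal (2 * s * exp (1/2 * v - s\<^sup>2 * exp v)) * indicator {0..q} s \<partial>lborel)" for v
  proof -
    have "(\<integral>\<^sup>+s. ennreal (2 * s * exp (1/2 * v - s\<^sup>2 * exp v)) * indicator {0..q} s \<partial>lborel) =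
      ennreal (- exp (- (1/2) * v) * exp (- q\<^sup>2 * exp v) - (- exp (- (1/2) * v) * exp (- 0\<^sup>2 * exp v)))"
    proof (rule nn_integral_FTC_Icc)
      fix s :: real
      have "exp (1/2 * v - s\<^sup>2 * exp v) = exp v * (exp (- (1/2) * v) * exp (- s\<^sup>2 * exp v))"
        by (simp add: exp_add[symmetric] field_simps)
      then show "((\<lambda>s. - exp (- (1/2) * v) * exp (- s\<^sup>2 * exp v)) has_real_derivative 2 * s * exp (1/2 * v - s\<^sup>2 * exp v)) (at s)"
        by (auto intro!: derivative_eq_intros)
    qed (use assms in auto)
    then show ?thesis by (simp add: algebra_simps)
  qed
  have outer: "(\<integral>\<^sup>+v. ennreal (2 * s * exp (1/2 * v - s\<^sup>2 * exp v)) * indicator {0..q} s \<partial>lborel) =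
      ennreal (2 * sqrt pi) * indicator {0<..q} s" for s
  proof (cases "0 < s")
    case True
    from has_bochner_integral_mult_right[OF Gamma_integral_log[of "1/2" "s\<^sup>2"], of "2 * s"] True
    have "has_bochner_integral lborel (\<lambda>v. 2 * s * exp (1/2 * v - s\<^sup>2 * exp v)) (2 * sqrt pi)"
      by (simp add: Gamma_one_half_real powr_half_sqrt)
    then have "(\<integral>\<^sup>+v. ennreal (2 * s * exp (1/2 * v - s\<^sup>2 * exp v)) \<partial>lborel) = ennreal (2 * sqrt pi)"
      using True by (subst nn_integral_eq_integral) (auto simp: has_bochner_integral_iff)
    then show ?thesis using True by (auto simp: indicator_def nn_integral_multc)
  next
    case False
    then have "2 * s * exp (1/2 * v - s\<^sup>2 * exp v) \<le> 0" for v by (simp add: mult_nonpos_nonneg)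
    then show ?thesis using False by (simp add: ennreal_neg)
  qed
  have "(\<integral>\<^sup>+v. ennreal ((1 - exp (- q\<^sup>2 * exp v)) * exp (- (1/2) * v)) \<partial>lborel) =
    (\<integral>\<^sup>+s. (\<integral>\<^sup>+v. ennreal (2 * s * exp (1/2 * v - s\<^sup>2 * exp v)) * indicator {0..q} s \<partial>lborel) \<partial>lborel)"
    unfolding inner by (rule lborel_pair.Fubini') simp
  also have "\<dots> = ennreal (2 * sqrt pi * q)"
    unfolding outer using assms by (simp add: nn_integral_cmult ennreal_mult)
  finally show "(\<integral>\<^sup>+v. ennreal ((1 - exp (- q\<^sup>2 * exp v)) * exp (- (1/2) * v)) \<partial>lborel) = ennreal (2 * sqrt pi * q)" .
  show "AE v in lborel. 0 \<le> (1 - exp (- q\<^sup>2 * exp v)) * exp (- (1/2) * v)" by simp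
qed (use assms in auto)

lemma compact_support_integrable:
  fixes \<phi> :: "'a::euclidean_space \<Rightarrow> complex"
  assumes "compact K" "continuous_on UNIV \<phi>" "\<And>x. x \<notin> K \<Longrightarrow> \<phi> x = 0"
  shows "integrable lborel \<phi>" and "\<exists>M\<ge>0. \<forall>x. norm (\<phi> x) \<le> M"
proof -
  have "bounded (\<phi> ` K)"
    using assms(1,2) by (intro compact_imp_bounded compact_continuous_image) (auto intro: continuous_on_subset)
  then obtain M where "M > 0" "\<And>x. x \<in> K \<Longrightarrow> norm (\<phi> x) \<le> M"
    unfolding bounded_pos by auto
  then have M: "M \<ge> 0" "\<And>x. norm (\<phi> x) \<le> M"
    using assms(3) by (metis less_imp_le norm_zero)+
  then show "\<exists>M\<ge>0. \<forall>x. norm (\<phi> x) \<le> M" by blast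
  show "integrable lborel \<phi>"
  proof (rule Bochner_Integration.integrable_bound)
    show "integrable lborel (\<lambda>x. M * indicator K x)"
      using assms(1) by (intro integrable_mult_right integrable_real_indicator)
        (use emeasure_bounded_finite[OF compact_imp_bounded[OF assms(1)]] assms(1) in \<open>auto simp: borel_compact\<close>)
    show "AE x in lborel. norm (\<phi> x) \<le> norm (M * indicator K x)"
      using M assms(3) by (intro AE_I2) (auto simp: indicator_def)
  qed (use borel_measurable_continuous_onI[OF assms(2)] in simp)
qed

text \<open>Translating \<open>\<phi>\<close> by \<open>t *\<^sub>R b\<close> multiplies its
  transform by \<open>fchar (t * (b \<bullet> \<xi>))\<close>. Differentiating both descriptions at
  t = 0 replaces integration by parts.\<close>

lemma fourier_deriv:
  fixes \<phi> \<phi>' :: "'a::euclidean_space \<Rightarrow> complex"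
  assumes "compact K" "continuous_on UNIV \<phi>" "\<And>x. x \<notin> K \<Longrightarrow> \<phi> x = 0"
    and "continuous_on UNIV \<phi>'" "\<And>x. x \<notin> K \<Longrightarrow> \<phi>' x = 0" "norm b \<le> 1"
    and deriv: "\<And>x. ((\<lambda>t. \<phi> (x + t *\<^sub>R b)) has_vector_derivative \<phi>' x) (at 0)"
  shows "fourier \<phi>' \<xi> = 2 * \<i> * complex_of_real (pi * (b \<bullet> \<xi>)) * fourier \<phi> \<xi>"
proof -
  let ?e = "\<lambda>x. fchar (- (x \<bullet> \<xi>))"
  have \<phi>: "integrable lborel \<phi>" by (rule compact_support_integrable[OF assms(1-3)])
  obtain M where M: "M \<ge> 0" "\<And>x. norm (\<phi>' x) \<le> M"
    using compact_support_integrable(2)[OF assms(1,4,5)] by blast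
  obtain R where R: "\<And>x. x \<in> K \<Longrightarrow> norm x \<le> R"
    using compact_imp_bounded[OF assms(1)] unfolding bounded_iff by blast
  have "((\<lambda>t. \<integral>x. \<phi> (x + t *\<^sub>R b) * ?e x \<partial>lborel) has_vector_derivative
      (\<integral>x. \<phi>' (x + 0 *\<^sub>R b) * ?e x \<partial>lborel)) (at 0)"
  proof (rule has_vector_derivative_lebesgue_integral[where r = 1 and g' = "\<lambda>t x. \<phi>' (x + t *\<^sub>R b) * ?e x"
        and h = "\<lambda>x. M * indicator (cball 0 (R + 1)) x"])
    fix t :: real assume t: "\<bar>t\<bar> < 1"
    have "integrable lborel (\<lambda>x. \<phi> (t *\<^sub>R b + 1 *\<^sub>R x))"
      using \<phi> by (intro lborel_integrable_affine) auto
    then show "integrable lborel (\<lambda>x. \<phi> (x + t *\<^sub>R b) * ?e x)"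
      by (intro integrable_fchar_mult) (simp_all add: add.commute)
    fix x
    have "((\<lambda>s. \<phi> ((x + t *\<^sub>R b) + s *\<^sub>R b)) has_vector_derivative \<phi>' (x + t *\<^sub>R b)) (at (t - t))"
      using deriv by simp
    from vector_diff_chain_at[of "\<lambda>s. s - t" 1 t, OF _ this]
    have "((\<lambda>s. \<phi> (x + s *\<^sub>R b)) has_vector_derivative \<phi>' (x + t *\<^sub>R b)) (at t)"
      using has_vector_derivative_diff[OF has_vector_derivative_id has_vector_derivative_const]
      by (simp add: o_def algebra_simps)
    then show "((\<lambda>s. \<phi> (x + s *\<^sub>R b) * ?e x) has_vector_derivative \<phi>' (x + t *\<^sub>R b) * ?e x) (at t)"
      by (rule has_vector_derivative_mult_left)
    \<comment> \<open>For \<bar>t\<bar> < 1 the support moves by at most 1, whence the radius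
      \<open>R + 1\<close>.\<close>
    show "norm (\<phi>' (x + t *\<^sub>R b) * ?e x) \<le> M * indicator (cball 0 (R + 1)) x"
    proof (cases "x + t *\<^sub>R b \<in> K")
      case True
      have "norm x \<le> norm (x + t *\<^sub>R b) + norm (t *\<^sub>R b)" by (metis add_diff_cancel norm_triangle_ineq4)
      also have "\<dots> \<le> R + 1"
        using R[OF True] t assms(6) mult_mono[of "\<bar>t\<bar>" 1 "norm b" 1] by (intro add_mono) auto
      finally show ?thesis using M(2) by (simp add: norm_mult)
    next
      case False
      then show ?thesis using M(1) by (simp add: assms(5))
    qed
  qed (auto intro!: integrable_real_indicator emeasure_bounded_finite)
  moreover have "(\<integral>x. \<phi> (x + t *\<^sub>R b) * ?e x \<partial>lborel) = fchar (t * (b \<bullet> \<xi>)) * fourier \<phi> \<xi>" for t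
  proof -
    have "fchar (t * (b \<bullet> \<xi>)) * fourier \<phi> \<xi> = (\<integral>x. fchar (t * (b \<bullet> \<xi>)) * (\<phi> x * ?e x) \<partial>lborel)"
      by (simp add: fourier_fchar)
    also have "\<dots> = (\<integral>x. fchar (t * (b \<bullet> \<xi>)) * (\<phi> (t *\<^sub>R b + x) * ?e (t *\<^sub>R b + x)) \<partial>lborel)"
      using lborel_integral_affine[of 1 "\<lambda>x. fchar (t * (b \<bullet> \<xi>)) * (\<phi> x * ?e x)" "t *\<^sub>R b"] by simp
    also have "\<dots> = (\<integral>x. \<phi> (x + t *\<^sub>R b) * ?e x \<partial>lborel)"
    proof (intro Bochner_Integration.integral_cong refl)
      fix x
      have "fchar (- (x \<bullet> \<xi>)) = fchar (t * (b \<bullet> \<xi>)) * fchar (- ((t *\<^sub>R b + x) \<bullet> \<xi>))"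
        unfolding fchar_add[symmetric] by (simp add: inner_add_left)
      then show "fchar (t * (b \<bullet> \<xi>)) * (\<phi> (t *\<^sub>R b + x) * ?e (t *\<^sub>R b + x)) = \<phi> (x + t *\<^sub>R b) * ?e x"
        by (simp add: add.commute mult_ac)
    qed
    finally show ?thesis ..
  qed
  ultimately have 1: "((\<lambda>t. fchar (t * (b \<bullet> \<xi>)) * fourier \<phi> \<xi>) has_vector_derivative fourier \<phi>' \<xi>) (at 0)"
    by (simp add: fourier_fchar)
  have "((\<lambda>z. exp (2 * \<i> * complex_of_real (pi * (b \<bullet> \<xi>)) * z)) has_field_derivative 2 * \<i> * complex_of_real (pi * (b \<bullet> \<xi>))) (at (of_real 0))"
    by (auto intro!: derivative_eq_intros)
  from has_vector_derivative_real_field[OF this]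
  have "((\<lambda>t. fchar (t * (b \<bullet> \<xi>))) has_vector_derivative 2 * \<i> * complex_of_real (pi * (b \<bullet> \<xi>))) (at 0)"
    by (simp add: fchar_def mult_ac)
  then have "((\<lambda>t. fchar (t * (b \<bullet> \<xi>)) * fourier \<phi> \<xi>) has_vector_derivative
      2 * \<i> * complex_of_real (pi * (b \<bullet> \<xi>)) * fourier \<phi> \<xi>) (at 0)"
    by (rule has_vector_derivative_mult_left)
  with 1 show ?thesis by (rule vector_derivative_unique_at)
qed

lemma fourier_norm_le:
  assumes "integrable lborel \<phi>"
  shows "norm (fourier \<phi> \<xi>) \<le> (\<integral>x. norm (\<phi> x) \<partial>lborel)"
  unfolding fourier_fchar using assms by (intro norm_integral_le) (auto simp: norm_mult)

section \<open>Polynomially weighted integrability of transforms of test functions\<close>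

context
  fixes \<psi> :: "'a::euclidean_space \<Rightarrow> complex" and K :: "'a set"
  assumes smooth: "smooth_on UNIV \<psi>" and K: "compact K" and supp: "\<And>x. x \<notin> K \<Longrightarrow> \<psi> x = 0"
begin

lemma iter_partial_compact_support:
  assumes "bs \<in> lists Basis"
  shows "continuous_on UNIV (iter_partial bs \<psi>)" "x \<notin> K \<Longrightarrow> iter_partial bs \<psi> x = 0"
    and "b \<in> Basis \<Longrightarrow> ((\<lambda>t. iter_partial bs \<psi> (x + t *\<^sub>R b)) has_vector_derivative iter_partial (b # bs) \<psi> x) (at 0)"
proof -
  show "continuous_on UNIV (iter_partial bs \<psi>)"
    using smooth assms unfolding smooth_on_def by blast
  show "x \<notin> K \<Longrightarrow> iter_partial bs \<psi> x = 0"
  proof (induction bs arbitrary: x rule: list.induct)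
    case Nil
    then show ?case using supp by (simp add: iter_partial_def)
  next
    case (Cons b bs)
    have "open (- K)" using K by (simp add: compact_imp_closed open_Compl)
    from partial_deriv_cong(2)[OF this, of x "iter_partial bs \<psi>" "\<lambda>_. 0" b 0] Cons
    show ?case by (simp add: iter_partial_def)
  qed
  show "b \<in> Basis \<Longrightarrow> ((\<lambda>t. iter_partial bs \<psi> (x + t *\<^sub>R b)) has_vector_derivative iter_partial (b # bs) \<psi> x) (at 0)"
    using smooth assms unfolding smooth_on_def
    by (simp add: iter_partial_def partial_deriv_def vector_derivative_works[symmetric])
qed

lemma test_function_regularity:
  shows test_function_continuous: "continuous_on UNIV \<psi>" and test_function_integrable: "integrable lborel \<psi>"
    and test_function_bounded: "\<exists>M\<ge>0. \<forall>x. norm (\<psi> x) \<le> M"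
proof -
  show c: "continuous_on UNIV \<psi>" using iter_partial_compact_support(1)[of "[]"] by (simp add: iter_partial_def)
  show "integrable lborel \<psi>" "\<exists>M\<ge>0. \<forall>x. norm (\<psi> x) \<le> M"
    using compact_support_integrable[OF K c supp] by auto
qed

text \<open>Repeated derivatives in a single direction control powers of one coordinate, and the
  norm is at most the dimension times the largest coordinate.\<close>

lemma fourier_decay: "\<exists>C. \<forall>\<xi>. norm \<xi> ^ N * norm (fourier \<psi> \<xi>) \<le> C"
proof -
  let ?p = "\<lambda>b n. iter_partial (replicate n b) \<psi>"
  have l: "replicate n b \<in> lists Basis" if "b \<in> Basis" for n and b :: 'a
    using that by (auto simp: in_lists_conv_set)
  have F: "fourier (?p b n) \<xi> = (2 * \<i> * complex_of_real (pi * (b \<bullet> \<xi>))) ^ n * fourier \<psi> \<xi>" if b: "b \<in> Basis" for b n \<xi>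
  proof (induction n)
    case 0
    then show ?case by (simp add: iter_partial_def)
  next
    case (Suc n)
    have l': "replicate (Suc n) b \<in> lists Basis" by (rule l[OF b])
    have "fourier (?p b (Suc n)) \<xi> = 2 * \<i> * complex_of_real (pi * (b \<bullet> \<xi>)) * fourier (?p b n) \<xi>"
      using iter_partial_compact_support[OF l[OF b, of n]] iter_partial_compact_support[OF l'] b
      by (intro fourier_deriv[OF K]) auto
    then show ?case using Suc by simp
  qed
  have i: "integrable lborel (?p b N)" if "b \<in> Basis" for b
    using compact_support_integrable(1)[OF K] iter_partial_compact_support[OF l[OF that]] by auto
  \<comment> \<open>Summing over the basis frees the constant from the direction, since the largest
    coordinate depends on \<xi>.\<close>
  define C where "C = (\<Sum>b\<in>Basis. \<integral>x. norm (?p b N x) \<partial>lborel)"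
  have C: "\<bar>b \<bullet> \<xi>\<bar> ^ N * norm (fourier \<psi> \<xi>) \<le> C" if b: "b \<in> Basis" for b \<xi>
  proof -
    have le: "\<bar>b \<bullet> \<xi>\<bar> ^ N \<le> (2 * pi * \<bar>b \<bullet> \<xi>\<bar>) ^ N"
      using pi_gt3 by (intro power_mono) (auto intro!: mult_right_mono[of 1 "2 * pi", simplified])
    have "\<bar>b \<bullet> \<xi>\<bar> ^ N * norm (fourier \<psi> \<xi>) \<le> norm (fourier (?p b N) \<xi>)"
    proof -
      have "norm ((2 * \<i> * complex_of_real (pi * (b \<bullet> \<xi>))) ^ N) = (2 * pi * \<bar>b \<bullet> \<xi>\<bar>) ^ N"
        by (simp only: norm_power norm_mult norm_of_real abs_mult norm_ii norm_numeral) (simp add: power_mult_distrib)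
      with le show ?thesis
        unfolding F[OF b] norm_mult[of "_ ^ N"] by (simp only: mult_right_mono norm_ge_zero)
    qed
    also have "\<dots> \<le> (\<integral>x. norm (?p b N x) \<partial>lborel)" by (rule fourier_norm_le[OF i[OF b]])
    also have "\<dots> \<le> C" unfolding C_def using b by (intro member_le_sum) auto
    finally show ?thesis .
  qed
  have "norm \<xi> ^ N * norm (fourier \<psi> \<xi>) \<le> real DIM('a) ^ N * C" for \<xi>
  proof -
    let ?N = "(\<lambda>a. \<bar>\<xi> \<bullet> a\<bar>) ` Basis"
    have "Max ?N \<in> ?N" by (intro Max_in) auto
    then obtain b where m: "Max ?N = \<bar>\<xi> \<bullet> b\<bar>" and b: "b \<in> Basis" by (rule imageE)
    have max: "\<bar>\<xi> \<bullet> a\<bar> \<le> \<bar>\<xi> \<bullet> b\<bar>" if "a \<in> Basis" for a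
      unfolding m[symmetric] using that by (intro Max_ge) auto
    have "norm \<xi> \<le> (\<Sum>a\<in>Basis. \<bar>\<xi> \<bullet> a\<bar>)" by (rule norm_le_l1)
    also have "\<dots> \<le> real DIM('a) * \<bar>\<xi> \<bullet> b\<bar>" using max sum_bounded_above[of Basis "\<lambda>a. \<bar>\<xi> \<bullet> a\<bar>"] by simp
    finally have "norm \<xi> ^ N \<le> (real DIM('a) * \<bar>\<xi> \<bullet> b\<bar>) ^ N" by (intro power_mono) auto
    then have "norm \<xi> ^ N * norm (fourier \<psi> \<xi>) \<le> (real DIM('a) * \<bar>\<xi> \<bullet> b\<bar>) ^ N * norm (fourier \<psi> \<xi>)"
      by (intro mult_right_mono) auto
    also have "\<dots> = real DIM('a) ^ N * (\<bar>b \<bullet> \<xi>\<bar> ^ N * norm (fourier \<psi> \<xi>))"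
      by (simp add: power_mult_distrib inner_commute)
    also have "\<dots> \<le> real DIM('a) ^ N * C" using C[OF b] by (intro mult_left_mono) auto
    finally show ?thesis .
  qed
  then show ?thesis by blast
qed

text \<open>The comparison function is the kernel of \<open>poisson_integral\<close> at height 1,
  which behaves like 1 near the origin and like \<open>norm \<xi>\<close> to the power -(d + 1) at
  infinity; \<open>C0\<close> serves the former region and \<open>C1\<close> the latter.\<close>

lemma fourier_integrable: "integrable lborel (\<lambda>\<xi>. complex_of_real (norm \<xi> ^ j) * fourier \<psi> \<xi>)"
proof -
  let ?D = "DIM('a) + 1"
  have [measurable]: "fourier \<psi> \<in> borel_measurable borel"
    by (intro fourier_measurable borel_measurable_continuous_onI test_function_continuous)
  obtain C0 where C0: "\<And>\<xi>. norm \<xi> ^ j * norm (fourier \<psi> \<xi>) \<le> C0" using fourier_decay[of j] by blast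
  obtain C1 where C1: "\<And>\<xi>. norm \<xi> ^ (?D + j) * norm (fourier \<psi> \<xi>) \<le> C1" using fourier_decay[of "?D + j"] by blast
  let ?P = "\<lambda>\<xi>::'a. 1 / norm (\<xi>, 1::real) ^ ?D"
  have P: "integrable lborel ?P"
    using poisson_integral[of 1, where 'a='a] by (simp only: has_bochner_integral_iff zero_less_one)
  show ?thesis
  proof (rule Bochner_Integration.integrable_bound)
    show "integrable lborel (\<lambda>\<xi>. 2 ^ ?D * (C0 + C1) * ?P \<xi>)"
      using P by (rule integrable_mult_right)
    show "AE \<xi> in lborel. norm (complex_of_real (norm \<xi> ^ j) * fourier \<psi> \<xi>) \<le> norm (2 ^ ?D * (C0 + C1) * ?P \<xi>)"
    proof (intro AE_I2)
      fix \<xi> :: 'a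
      let ?n = "norm (\<xi>, 1::real)" and ?A = "norm \<xi> ^ j * norm (fourier \<psi> \<xi>)"
      have A: "0 \<le> ?A" by simp
      have n: "0 < ?n" by (simp add: norm_Pair add_nonneg_pos)
      have "?n \<le> norm \<xi> + 1" using norm_Pair_le[of \<xi> "1::real"] by simp
      also have "\<dots> \<le> 2 * max (norm \<xi>) 1" by simp
      finally have "?n ^ ?D \<le> (2 * max (norm \<xi>) 1) ^ ?D" by (intro power_mono) auto
      also have "\<dots> = 2 ^ ?D * max (norm \<xi>) 1 ^ ?D" by (rule power_mult_distrib)
      also have "\<dots> \<le> 2 ^ ?D * (norm \<xi> ^ ?D + 1)"
        by (intro mult_left_mono) (auto simp: max_def)
      finally have "?n ^ ?D * ?A \<le> 2 ^ ?D * (norm \<xi> ^ ?D + 1) * ?A" using A by (rule mult_right_mono)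
      also have "\<dots> = 2 ^ ?D * (norm \<xi> ^ (?D + j) * norm (fourier \<psi> \<xi>) + ?A)" by (simp add: algebra_simps power_add)
      also have "\<dots> \<le> 2 ^ ?D * (C1 + C0)" by (intro mult_left_mono add_mono C0 C1) auto
      finally have "?A * ?n ^ ?D \<le> 2 ^ ?D * (C0 + C1)" by (simp only: add.commute[of C0] mult.commute)
      moreover have "0 < ?n ^ ?D" using n by simp
      ultimately have "?A \<le> 2 ^ ?D * (C0 + C1) / ?n ^ ?D" by (simp only: pos_le_divide_eq)
      then have "norm (complex_of_real (norm \<xi> ^ j) * fourier \<psi> \<xi>) \<le> 2 ^ ?D * (C0 + C1) * ?P \<xi>"
        by (simp add: norm_mult norm_power)
      also have "\<dots> \<le> norm (2 ^ ?D * (C0 + C1) * ?P \<xi>)"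
        unfolding real_norm_def by (rule abs_ge_self)
      finally show "norm (complex_of_real (norm \<xi> ^ j) * fourier \<psi> \<xi>) \<le> norm (2 ^ ?D * (C0 + C1) * ?P \<xi>)" .
    qed
  qed measurable
qed

end

section \<open>The half Laplacian of a test function\<close>

context
  fixes \<psi> :: "'a::euclidean_space \<Rightarrow> complex" and K :: "'a set"
  assumes smooth: "smooth_on UNIV \<psi>" and K: "compact K" and supp: "\<And>x. x \<notin> K \<Longrightarrow> \<psi> x = 0"
begin

lemma fourier_integrable_0: "integrable lborel (fourier \<psi>)"
  using fourier_integrable[OF smooth K supp, of 0] by simp

lemma fourier_integrable_1: "integrable lborel (\<lambda>\<xi>. 2 * complex_of_real (pi * norm \<xi>) * fourier \<psi> \<xi>)"
  using integrable_mult_right[OF fourier_integrable[OF smooth K supp, of 1], of "2 * complex_of_real pi"]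
  by (simp add: mult.assoc)

lemma fourier_test_function_measurable [measurable]: "fourier \<psi> \<in> borel_measurable borel"
  using fourier_integrable_0 by auto

lemma inverse_fourier_test_function: "inverse_fourier (fourier \<psi>) z = \<psi> z"
proof -
  obtain M where M: "\<And>x. norm (\<psi> x) \<le> M" using test_function_bounded[OF smooth K supp] by blast
  show ?thesis
    by (rule fourier_inversion[OF test_function_integrable[OF smooth K supp] test_function_continuous[OF smooth K supp] M fourier_integrable_0])
qed

lemma half_laplacian_eq:
  "half_laplacian \<psi> = inverse_fourier (\<lambda>\<xi>. 2 * complex_of_real (pi * norm \<xi>) * fourier \<psi> \<xi>)"
proof
  fix x
  have "half_laplacian \<psi> x = (\<integral>\<xi>. (2 * complex_of_real pi) * (complex_of_real (norm \<xi>) * fourier \<psi> \<xi> * fchar (x \<bullet> \<xi>)) \<partial>lborel)"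
    unfolding half_laplacian_def inverse_fourier_fchar by (simp only: integral_mult_right_zero)
  then show "half_laplacian \<psi> x = inverse_fourier (\<lambda>\<xi>. 2 * complex_of_real (pi * norm \<xi>) * fourier \<psi> \<xi>) x"
    unfolding inverse_fourier_fchar by (simp add: mult.assoc)
qed

lemma half_laplacian_measurable [measurable]: "half_laplacian \<psi> \<in> borel_measurable borel"
  unfolding half_laplacian_eq by (intro inverse_fourier_measurable) measurable

lemma half_laplacian_bounded: "\<exists>M\<ge>0. \<forall>x. norm (half_laplacian \<psi> x) \<le> M"
  unfolding half_laplacian_eq using inverse_fourier_bounded[OF fourier_integrable_1]
  by (meson norm_ge_zero order_trans)

text \<open>Writing \<open>2 \<pi> \<bar>\<xi>\<bar>\<close> as a superposition of \<open>1 - exp (- \<pi>\<^sup>2 \<bar>\<xi>\<bar>\<^sup>2 / \<tau>)\<close> turns \<open>half_laplacian\<close>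
  into a superposition of differences of \<open>\<psi>\<close> and its Gaussian averages; off the support only
  the averages remain.\<close>

lemma half_laplacian_decay:
  assumes \<rho>: "0 < \<rho>" and far: "\<And>y. y \<in> K \<Longrightarrow> \<rho> \<le> norm (x - y)"
  shows "norm (half_laplacian \<psi> x) \<le>
    pi powr (- ((DIM('a) + 1) / 2)) * Gamma ((DIM('a) + 1) / 2) * (\<integral>y. norm (\<psi> y) \<partial>lborel) / \<rho> ^ (DIM('a) + 1)"
proof -
  let ?A = "fourier \<psi>"
  \<comment> \<open>By \<open>absolute_value_integral\<close> with q = pi \<open>norm \<xi>\<close>
    this weight integrates to sqrt pi times the symbol of the half Laplacian; hence the factor sqrt
    pi carried along below.\<close>
  let ?w = "\<lambda>\<xi>::'a. \<lambda>v::real. (1 - exp (- pi\<^sup>2 * (norm \<xi>)\<^sup>2 * exp v)) * exp (- (1/2) * v)"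
  let ?F = "\<lambda>\<xi> v. complex_of_real (?w \<xi> v) * (?A \<xi> * fchar (x \<bullet> \<xi>))"
  let ?s = "(DIM('a) + 1) / 2"
  define L where "L = (\<integral>y. norm (\<psi> y) \<partial>lborel)"
  \<comment> \<open>If \<open>x\<close> were in \<open>K\<close>, then \<open>far\<close> at
    \<open>x\<close> itself would give \<open>\<rho> \<le> 0\<close>.\<close>
  have \<psi>x: "\<psi> x = 0" using far[of x] \<rho> supp by fastforce
  have w: "has_bochner_integral lborel (?w \<xi>) (2 * sqrt pi * (pi * norm \<xi>))" for \<xi> :: 'a
    using absolute_value_integral[of "pi * norm \<xi>"] by (simp add: power_mult_distrib)
  have w_nonneg: "0 \<le> ?w \<xi> v" for \<xi> :: 'a and v
    by (simp add: mult_nonneg_nonneg)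
  have "complex_of_real (sqrt pi) * half_laplacian \<psi> x = (\<integral>\<xi>. complex_of_real (2 * sqrt pi * (pi * norm \<xi>)) * (?A \<xi> * fchar (x \<bullet> \<xi>)) \<partial>lborel)"
    unfolding half_laplacian_eq inverse_fourier_fchar integral_mult_right_zero[symmetric]
    by (intro Bochner_Integration.integral_cong) (auto simp: mult_ac)
  also have "\<dots> = (\<integral>\<xi>. \<integral>v. ?F \<xi> v \<partial>lborel \<partial>lborel)"
  proof (intro Bochner_Integration.integral_cong refl)
    fix \<xi>
    show "complex_of_real (2 * sqrt pi * (pi * norm \<xi>)) * (?A \<xi> * fchar (x \<bullet> \<xi>)) = (\<integral>v. ?F \<xi> v \<partial>lborel)"
      unfolding integral_mult_left_zero integral_complex_of_real using w[of \<xi>] by (simp only: has_bochner_integral_iff)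
  qed
  also have "\<dots> = (\<integral>v. \<integral>\<xi>. ?F \<xi> v \<partial>lborel \<partial>lborel)"
  proof (rule lborel_Fubini)
    show "AE \<xi> in lborel. integrable lborel (?F \<xi>)"
      using w by (intro AE_I2 integrable_mult_left) (auto simp only: has_bochner_integral_iff complex_of_real_integrable_eq)
    show "AE \<xi> in lborel. (\<integral>v. norm (?F \<xi> v) \<partial>lborel) \<le> norm (2 * complex_of_real (pi * norm \<xi>) * ?A \<xi>) * sqrt pi"
    proof (intro AE_I2)
      fix \<xi>
      have "(\<integral>v. norm (?F \<xi> v) \<partial>lborel) = (\<integral>v. ?w \<xi> v * norm (?A \<xi>) \<partial>lborel)"
        using w_nonneg by (intro Bochner_Integration.integral_cong refl) (simp only: norm_mult norm_of_real norm_fchar abs_of_nonneg mult_1_right)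
      also have "\<dots> = 2 * sqrt pi * (pi * norm \<xi>) * norm (?A \<xi>)"
        unfolding integral_mult_left_zero using w[of \<xi>] by (simp only: has_bochner_integral_iff)
      also have "\<dots> = norm (2 * complex_of_real (pi * norm \<xi>) * ?A \<xi>) * sqrt pi"
        by (simp add: norm_mult mult_ac)
      finally show "(\<integral>v. norm (?F \<xi> v) \<partial>lborel) \<le> norm (2 * complex_of_real (pi * norm \<xi>) * ?A \<xi>) * sqrt pi"
        by (rule eq_refl)
    qed
    show "integrable lborel (\<lambda>\<xi>. norm (2 * complex_of_real (pi * norm \<xi>) * ?A \<xi>) * sqrt pi)"
      using fourier_integrable_1 by (intro integrable_mult_left integrable_norm)
  qed measurable
  finally have eq: "complex_of_real (sqrt pi) * half_laplacian \<psi> x = (\<integral>v. \<integral>\<xi>. ?F \<xi> v \<partial>lborel \<partial>lborel)" .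
  \<comment> \<open>After the reflection of \<open>v\<close>, the weight exp (v / 2) and the heat
    kernel normalisation (exp v / pi)^(d / 2) combine to the exponent \<open>?s\<close>; the
    distance to \<open>K\<close> contributes the decay in exp v. The resulting Gamma integral yields
    \<rho>^-(d + 1).\<close>
  let ?h = "\<lambda>v. pi powr (- (DIM('a) / 2)) * L * exp (?s * v - \<rho>\<^sup>2 * exp v)"
  have h: "has_bochner_integral lborel ?h (pi powr (- (DIM('a) / 2)) * L * (Gamma ?s / (\<rho>\<^sup>2) powr ?s))"
    by (intro has_bochner_integral_mult_right Gamma_integral_log) (use \<rho> in auto)
  have bound: "norm (\<integral>\<xi>. ?F \<xi> (- v) \<partial>lborel) \<le> ?h v" for v
  proof -
    let ?E = "\<lambda>\<xi>. ?A \<xi> * complex_of_real (exp (- pi\<^sup>2 * (norm \<xi>)\<^sup>2 / exp v)) * fchar (x \<bullet> \<xi>)"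
    have E: "integrable lborel ?E"
      by (rule Bochner_Integration.integrable_bound[OF fourier_integrable_0]) (auto simp: norm_mult mult_left_le)
    have A: "integrable lborel (\<lambda>\<xi>. ?A \<xi> * fchar (x \<bullet> \<xi>))"
      by (intro integrable_fchar_mult fourier_integrable_0) simp
    have "(\<integral>\<xi>. ?F \<xi> (- v) \<partial>lborel) = (\<integral>\<xi>. complex_of_real (exp (1/2 * v)) * (?A \<xi> * fchar (x \<bullet> \<xi>) - ?E \<xi>) \<partial>lborel)"
    proof (intro Bochner_Integration.integral_cong refl)
      fix \<xi> :: 'a
      have e: "exp (- pi\<^sup>2 * (norm \<xi>)\<^sup>2 * exp (- v)) = exp (- pi\<^sup>2 * (norm \<xi>)\<^sup>2 / exp v)" "exp (- (1/2) * - v) = exp (1/2 * v)"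
        by (simp only: exp_minus divide_inverse) simp
      show "?F \<xi> (- v) = complex_of_real (exp (1/2 * v)) * (?A \<xi> * fchar (x \<bullet> \<xi>) - ?E \<xi>)"
        unfolding e of_real_mult of_real_diff of_real_1
        by (simp only: left_diff_distrib right_diff_distrib mult_1_left mult_1_right mult_ac)
    qed
    also have "\<dots> = complex_of_real (exp (1/2 * v)) * (inverse_fourier ?A x - (\<integral>\<xi>. ?E \<xi> \<partial>lborel))"
      unfolding integral_mult_right_zero inverse_fourier_fchar using A E by simp
    also have "inverse_fourier ?A x = 0" unfolding inverse_fourier_test_function by (rule \<psi>x)
    finally have 1: "norm (\<integral>\<xi>. ?F \<xi> (- v) \<partial>lborel) = exp (1/2 * v) * norm (\<integral>\<xi>. ?E \<xi> \<partial>lborel)"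
      by (simp add: norm_mult)
    have "norm (\<integral>y. \<psi> (x + (-1) *\<^sub>R y) * complex_of_real (exp (- exp v * (norm y)\<^sup>2)) \<partial>lborel) \<le>
        (\<integral>y. norm (\<psi> (x + (-1) *\<^sub>R y)) * exp (- exp v * \<rho>\<^sup>2) \<partial>lborel)"
    proof (rule norm_integral_le)
      show "integrable lborel (\<lambda>y. norm (\<psi> (x + (-1) *\<^sub>R y)) * exp (- exp v * \<rho>\<^sup>2))"
        using test_function_integrable[OF smooth K supp] by (intro integrable_mult_left integrable_norm lborel_integrable_affine) auto
      fix y
      show "norm (\<psi> (x + (-1) *\<^sub>R y) * complex_of_real (exp (- exp v * (norm y)\<^sup>2))) \<le> norm (\<psi> (x + (-1) *\<^sub>R y)) * exp (- exp v * \<rho>\<^sup>2)"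
      proof (cases "x + (-1) *\<^sub>R y \<in> K")
        case True
        from far[OF this] have "\<rho>\<^sup>2 \<le> (norm y)\<^sup>2" using \<rho> by (intro power_mono) auto
        then show ?thesis by (simp add: norm_mult mult_left_mono)
      next
        case False
        then show ?thesis by (simp add: supp)
      qed
    qed
    also have "\<dots> = L * exp (- exp v * \<rho>\<^sup>2)"
      unfolding integral_mult_left_zero L_def
      using lborel_integral_affine[of "-1" "\<lambda>y. norm (\<psi> y)" x] by simp
    finally have "(exp v / pi) powr (DIM('a) / 2) * norm (\<integral>y. \<psi> (x + (-1) *\<^sub>R y) * complex_of_real (exp (- exp v * (norm y)\<^sup>2)) \<partial>lborel)
        \<le> (exp v / pi) powr (DIM('a) / 2) * (L * exp (- exp v * \<rho>\<^sup>2))"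
      by (rule mult_left_mono) simp
    moreover have "(\<integral>\<xi>. ?E \<xi> \<partial>lborel) = complex_of_real ((exp v / pi) powr (DIM('a) / 2)) *
        (\<integral>y. \<psi> (x + (-1) *\<^sub>R y) * complex_of_real (exp (- exp v * (norm y)\<^sup>2)) \<partial>lborel)"
      by (rule heat_fourier[OF test_function_integrable[OF smooth K supp] exp_gt_zero])
    ultimately have 2: "norm (\<integral>\<xi>. ?E \<xi> \<partial>lborel) \<le> (exp v / pi) powr (DIM('a) / 2) * (L * exp (- exp v * \<rho>\<^sup>2))"
      by (simp only: norm_mult norm_of_real abs_of_nonneg powr_ge_zero)
    have 3: "exp (1/2 * v) * ((exp v / pi) powr (DIM('a) / 2) * (L * exp (- exp v * \<rho>\<^sup>2))) = ?h v"
    proof -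
      have "(exp v / pi) powr (DIM('a) / 2) = exp (DIM('a) / 2 * v) * pi powr (- (DIM('a) / 2))"
        by (simp add: powr_divide powr_minus_divide powr_def[of "exp v"])
      moreover have "exp (1/2 * v) * exp (DIM('a) / 2 * v) * exp (- exp v * \<rho>\<^sup>2) = exp (?s * v - \<rho>\<^sup>2 * exp v)"
        by (simp add: exp_add[symmetric] algebra_simps add_divide_distrib)
      ultimately show ?thesis by (simp add: mult_ac)
    qed
    have 4: "exp (1/2 * v) * norm (\<integral>\<xi>. ?E \<xi> \<partial>lborel) \<le>
        exp (1/2 * v) * ((exp v / pi) powr (DIM('a) / 2) * (L * exp (- exp v * \<rho>\<^sup>2)))"
      using 2 by (rule mult_left_mono) simp
    show ?thesis unfolding 1 3[symmetric] by (rule 4)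
  qed
  \<comment> \<open>The weight is parametrised by exp v = 1 / \<tau>, whereas
    \<open>heat_fourier\<close> uses \<tau>.\<close>
  have reflect: "(\<integral>v. \<integral>\<xi>. ?F \<xi> v \<partial>lborel \<partial>lborel) = (\<integral>v. \<integral>\<xi>. ?F \<xi> (- v) \<partial>lborel \<partial>lborel)"
    using lborel_integral_affine[of "-1" "\<lambda>v. \<integral>\<xi>. ?F \<xi> v \<partial>lborel" "0::real"] by simp
  have "integrable lborel ?h" using h by (simp only: has_bochner_integral_iff)
  then have "norm (complex_of_real (sqrt pi) * half_laplacian \<psi> x) \<le> (\<integral>v. ?h v \<partial>lborel)"
    unfolding eq reflect using bound by (rule norm_integral_le)
  also have "\<dots> = pi powr (- (DIM('a) / 2)) * L * (Gamma ?s / \<rho> ^ (DIM('a) + 1))"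
  proof -
    have "(\<rho>\<^sup>2) powr ?s = (\<rho> powr 2) powr ?s" using \<rho> by simp
    also have "\<dots> = \<rho> powr real (DIM('a) + 1)"
    proof -
      have "2 * ?s = real (DIM('a) + 1)" 
        by (simp only: times_divide_eq_right) (rule nonzero_mult_div_cancel_left, simp)
      then show ?thesis unfolding powr_powr by (rule arg_cong)
    qed
    also have "\<dots> = \<rho> ^ (DIM('a) + 1)" by (rule powr_realpow[OF \<rho>])
    finally have e: "(\<rho>\<^sup>2) powr ?s = \<rho> ^ (DIM('a) + 1)" .
    show ?thesis using h unfolding e by (simp only: has_bochner_integral_iff)
  qed
  finally have le: "sqrt pi * norm (half_laplacian \<psi> x) \<le> pi powr (- (DIM('a) / 2)) * L * (Gamma ?s / \<rho> ^ (DIM('a) + 1))"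
    by (simp add: norm_mult)
  have "norm (half_laplacian \<psi> x) = (1 / sqrt pi) * (sqrt pi * norm (half_laplacian \<psi> x))" by simp
  also have "\<dots> \<le> (1 / sqrt pi) * (pi powr (- (DIM('a) / 2)) * L * (Gamma ?s / \<rho> ^ (DIM('a) + 1)))"
    using le by (rule mult_left_mono) simp
  also have "\<dots> = pi powr (- ?s) * Gamma ?s * L / \<rho> ^ (DIM('a) + 1)"
  proof -
    have "- ?s = - (DIM('a) / 2) + - (1 / 2)" by (simp add: field_simps)
    then have "pi powr (- ?s) = pi powr (- (DIM('a) / 2)) * (1 / sqrt pi)"
      by (simp only: powr_add powr_minus_divide[of _ "1/2"] powr_half_sqrt[OF pi_ge_zero])
    then show ?thesis by simp
  qed
  finally show ?thesis unfolding L_def .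
qed

text \<open>Bounded on a ball and decaying like the power -(d + 1) outside, it is again dominated by
  a multiple of the kernel of \<open>poisson_integral\<close> at height 1, plus an
  indicator.\<close>

lemma half_laplacian_integrable: "integrable lborel (half_laplacian \<psi>)"
proof -
  let ?D = "DIM('a) + 1"
  obtain M where M: "0 \<le> M" "\<And>x. norm (half_laplacian \<psi> x) \<le> M" using half_laplacian_bounded by blast
  obtain R where R: "0 < R" "\<And>y. y \<in> K \<Longrightarrow> norm y \<le> R"
    using compact_imp_bounded[OF K] unfolding bounded_pos by blast
  define C where "C = pi powr (- (?D / 2)) * Gamma (?D / 2) * (\<integral>y. norm (\<psi> y) \<partial>lborel)"
  have C: "0 \<le> C" unfolding C_def by (intro mult_nonneg_nonneg Gamma_real_nonneg) auto
  \<comment> \<open>Beyond \<open>R'\<close> the distance to \<open>K\<close> is at least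
    \<open>norm x / 2\<close>, and \<open>norm (x, 1)\<close> is at most \<open>2 * norm x\<close>;
    together they give the factor 4.\<close>
  define R' where "R' = max 1 (2 * R)"
  let ?P = "\<lambda>x::'a. 1 / norm (x, 1::real) ^ ?D"
  have P: "integrable lborel ?P"
    using poisson_integral[of 1, where 'a='a] by (simp only: has_bochner_integral_iff zero_less_one)
  have far: "norm (half_laplacian \<psi> x) \<le> C * 4 ^ ?D * ?P x" if "R' < norm x" for x
  proof -
    have x: "1 \<le> norm x" "2 * R \<le> norm x" using that by (auto simp: R'_def)
    have "norm (half_laplacian \<psi> x) \<le> C / (norm x / 2) ^ ?D"
      unfolding C_def
    proof (rule half_laplacian_decay)
      fix y assume "y \<in> K"
      then show "norm x / 2 \<le> norm (x - y)"
        using R(2)[of y] x(2) norm_triangle_ineq2[of x y] by linarith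
    qed (use x(1) in linarith)
    also have "\<dots> \<le> C / (norm (x, 1::real) / 4) ^ ?D"
    proof -
      have "norm (x, 1::real) \<le> norm x + 1" using norm_Pair_le[of x "1::real"] by simp
      then have "norm (x, 1::real) / 4 \<le> norm x / 2" using x(1) by simp
      moreover have "0 < norm (x, 1::real)" by (simp add: norm_Pair add_nonneg_pos)
      ultimately show ?thesis using C x(1)
        by (intro divide_left_mono power_mono mult_pos_pos zero_less_power) auto
    qed
    also have "\<dots> = C * 4 ^ ?D * ?P x" by (simp add: power_divide)
    finally show ?thesis .
  qed
  show ?thesis
  proof (rule Bochner_Integration.integrable_bound)
    show "integrable lborel (\<lambda>x. M * indicator (cball 0 R') x + C * 4 ^ ?D * ?P x)"
      by (intro Bochner_Integration.integrable_add integrable_mult_right P)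
        (auto intro!: integrable_real_indicator emeasure_bounded_finite)
    show "AE x in lborel. norm (half_laplacian \<psi> x) \<le> norm (M * indicator (cball 0 R') x + C * 4 ^ ?D * ?P x)"
    proof (intro AE_I2)
      fix x :: 'a
      have "0 \<le> C * 4 ^ ?D * ?P x" using C by simp
      then have "norm (half_laplacian \<psi> x) \<le> M * indicator (cball 0 R') x + C * 4 ^ ?D * ?P x"
        using M(2)[of x] far[of x] by (cases "norm x \<le> R'") auto
      then show "norm (half_laplacian \<psi> x) \<le> norm (M * indicator (cball 0 R') x + C * 4 ^ ?D * ?P x)"
        unfolding real_norm_def by (rule order_trans[OF _ abs_ge_self])
    qed
  qed measurable
qed

text \<open>For fixed \<open>v\<close> the kernel is a Gaussian, which
  \<open>gaussian_inverse_fourier\<close> moves to the frequency side, where the symbol contributes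
  \<open>norm \<xi>\<close>. Integrating over \<open>v\<close> there returns a multiple of 1 /
  \<open>norm \<xi>\<close>, so the symbol cancels and only the inversion formula is left. The
  exchange of integrals is made once on each side.\<close>

lemma riesz_half_laplacian:
  assumes D: "2 \<le> DIM('a)"
  shows "complex_of_real (riesz_const DIM('a)) *
    (\<integral>x. half_laplacian \<psi> x * complex_of_real (riesz (DIM('a) - 1) (x - z)) \<partial>lborel) = \<psi> z"
proof -
  let ?H = "half_laplacian \<psi>"
  define s where "s = (real DIM('a) - 1) / 2"
  have s: "0 < s" using D by (simp add: s_def)
  have G: "0 < Gamma s" using s by (rule Gamma_real_pos)
  let ?g = "\<lambda>x. \<lambda>v::real. exp (s * v - (norm (x - z))\<^sup>2 * exp v)"
  \<comment> \<open>At \<open>x = z\<close> the exponent loses its decay and the integral over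
    \<open>v\<close> diverges; the value 0 is put there, on a null set.\<close>
  let ?F = "\<lambda>x v. if x = z then 0 else complex_of_real (?g x v) * ?H x"
  have g: "has_bochner_integral lborel (?g x) (Gamma s * riesz (DIM('a) - 1) (x - z))" if "x \<noteq> z" for x
  proof -
    have n: "0 < norm (x - z)" using that by simp
    have s2: "2 * s = real (DIM('a) - 1)" using D by (simp add: s_def of_nat_diff)
    have "((norm (x - z))\<^sup>2) powr s = (norm (x - z) powr 2) powr s" using n by simp
    also have "\<dots> = norm (x - z) powr real (DIM('a) - 1)" unfolding powr_powr s2 ..
    also have "\<dots> = norm (x - z) ^ (DIM('a) - 1)" by (rule powr_realpow[OF n])
    finally show ?thesis using Gamma_integral_log[OF s, of "(norm (x - z))\<^sup>2"] n by simp
  qed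
  obtain M where M: "\<And>x. norm (?H x) \<le> M" using half_laplacian_bounded by blast
  \<comment> \<open>The norm of the half Laplacian is bounded and integrable, so it is itself an
    admissible density for \<open>potential_integrable\<close>.\<close>
  have "integrable lborel (\<lambda>x. norm (?H x) * riesz (DIM('a) - 1) ((z, 0::real) - (x, 0)))"
    by (rule potential_integrable[OF _ _ hker.base, of _ M]) (use half_laplacian_integrable M D in auto)
  then have Hint: "integrable lborel (\<lambda>x. norm (?H x) * riesz (DIM('a) - 1) (x - z))"
    by (simp add: norm_Pair1 norm_minus_commute)
  \<comment> \<open>The denominator of \<open>riesz_const\<close>; its numerator is
    \<open>Gamma s\<close>.\<close>
  define c where "c = 2 * pi powr ((DIM('a) + 1) / 2)"
  let ?k = "\<lambda>\<xi>::'a. \<lambda>v. 2 * pi * pi powr (DIM('a) / 2) * norm \<xi> * exp (- (1/2) * v - (pi * norm \<xi>)\<^sup>2 * exp (- v))"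
  let ?T = "\<lambda>\<xi> v. complex_of_real (?k \<xi> v) * (fourier \<psi> \<xi> * fchar (z \<bullet> \<xi>))"
  have T: "has_bochner_integral lborel (?k \<xi>) c" if "\<xi> \<noteq> 0" for \<xi>
  proof -
    let ?p = "2 * pi * pi powr (DIM('a) / 2) * norm \<xi>"
    \<comment> \<open>The exponent left after integrating the Gaussian over x is s - d / 2 = -1/2,
      in exp (- v); reflecting \<open>v\<close> makes it the Gamma integral at 1 / 2.\<close>
    have "has_bochner_integral lborel (\<lambda>v. exp (1/2 * v - (pi * norm \<xi>)\<^sup>2 * exp v)) (Gamma (1/2) / (pi * norm \<xi>)\<^sup>2 powr (1/2))"
      using that by (intro Gamma_integral_log) auto
    then have "has_bochner_integral lborel (\<lambda>v. exp (1/2 * (0 + -1 * v) - (pi * norm \<xi>)\<^sup>2 * exp (0 + -1 * v))) (Gamma (1/2) / (pi * norm \<xi>)\<^sup>2 powr (1/2))"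
      by (subst (asm) lborel_has_bochner_integral_real_affine_iff[of "-1" _ _ 0]) auto
    from has_bochner_integral_mult_right[OF this, of ?p]
    have "has_bochner_integral lborel (?k \<xi>) (?p * (Gamma (1/2) / (pi * norm \<xi>)\<^sup>2 powr (1/2)))" by simp
    also have "?p * (Gamma (1/2) / (pi * norm \<xi>)\<^sup>2 powr (1/2)) = c"
    proof -
      have "pi powr ((DIM('a) + 1) / 2) = pi powr (DIM('a) / 2) * sqrt pi"
        by (simp add: add_divide_distrib powr_add powr_half_sqrt)
      then show ?thesis using that by (simp add: c_def Gamma_one_half_real powr_half_sqrt)
    qed
    finally show ?thesis .
  qed
  have "complex_of_real (Gamma s) * (\<integral>x. ?H x * complex_of_real (riesz (DIM('a) - 1) (x - z)) \<partial>lborel) =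
      (\<integral>x. complex_of_real (Gamma s * riesz (DIM('a) - 1) (x - z)) * ?H x \<partial>lborel)"
    unfolding integral_mult_right_zero[symmetric] by (intro Bochner_Integration.integral_cong) (auto simp: mult_ac)
  also have "\<dots> = (\<integral>x. \<integral>v. ?F x v \<partial>lborel \<partial>lborel)"
  proof (intro integral_cong_AE)
    show "AE x in lborel. complex_of_real (Gamma s * riesz (DIM('a) - 1) (x - z)) * ?H x = (\<integral>v. ?F x v \<partial>lborel)"
    proof (rule eventually_mono[OF AE_lborel_singleton[of z]])
      fix x assume x: "x \<noteq> z"
      have "(\<integral>v. ?F x v \<partial>lborel) = (\<integral>v. complex_of_real (?g x v) * ?H x \<partial>lborel)" using x by simp
      also have "\<dots> = complex_of_real (Gamma s * riesz (DIM('a) - 1) (x - z)) * ?H x"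
        unfolding integral_mult_left_zero integral_complex_of_real using g[OF x] by (simp only: has_bochner_integral_iff)
      finally show "complex_of_real (Gamma s * riesz (DIM('a) - 1) (x - z)) * ?H x = (\<integral>v. ?F x v \<partial>lborel)" ..
    qed
  qed measurable
  also have "\<dots> = (\<integral>v. \<integral>x. ?F x v \<partial>lborel \<partial>lborel)"
  proof (rule lborel_Fubini)
    show "AE x in lborel. integrable lborel (?F x)"
    proof (rule eventually_mono[OF AE_lborel_singleton[of z]])
      fix x assume x: "x \<noteq> z"
      then have "integrable lborel (\<lambda>v. complex_of_real (?g x v) * ?H x)"
        using g[OF x] by (intro integrable_mult_left) (auto simp only: has_bochner_integral_iff complex_of_real_integrable_eq)
      with x show "integrable lborel (?F x)" by simp
    qed
    show "AE x in lborel. (\<integral>v. norm (?F x v) \<partial>lborel) \<le> Gamma s * (norm (?H x) * riesz (DIM('a) - 1) (x - z))"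
    proof (rule eventually_mono[OF AE_lborel_singleton[of z]])
      fix x assume x: "x \<noteq> z"
      have "(\<integral>v. norm (?F x v) \<partial>lborel) = (\<integral>v. ?g x v * norm (?H x) \<partial>lborel)"
        using x by (simp add: norm_mult)
      also have "\<dots> = Gamma s * riesz (DIM('a) - 1) (x - z) * norm (?H x)"
        unfolding integral_mult_left_zero using g[OF x] by (simp only: has_bochner_integral_iff)
      finally show "(\<integral>v. norm (?F x v) \<partial>lborel) \<le> Gamma s * (norm (?H x) * riesz (DIM('a) - 1) (x - z))"
        by (simp add: mult_ac)
    qed
    show "integrable lborel (\<lambda>x. Gamma s * (norm (?H x) * riesz (DIM('a) - 1) (x - z)))"
      using Hint by (rule integrable_mult_right)
  qed measurable
  also have "\<dots> = (\<integral>v. \<integral>\<xi>. complex_of_real (2 * pi * pi powr (DIM('a) / 2) * norm \<xi> * exp (- (1/2) * v - (pi * norm \<xi>)\<^sup>2 * exp (- v))) *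
      (fourier \<psi> \<xi> * fchar (z \<bullet> \<xi>)) \<partial>lborel \<partial>lborel)"
  proof (rule Bochner_Integration.integral_cong[OF refl])
    fix v :: real
    let ?B = "\<lambda>\<xi>. 2 * complex_of_real (pi * norm \<xi>) * fourier \<psi> \<xi>"
    have "(\<integral>x. ?F x v \<partial>lborel) = (\<integral>x. complex_of_real (exp (s * v)) * (complex_of_real (exp (- exp v * (norm (x - z))\<^sup>2)) * inverse_fourier ?B x) \<partial>lborel)"
      unfolding half_laplacian_eq[symmetric]
      by (intro integral_cong_AE eventually_mono[OF AE_lborel_singleton[of z]])
         (auto simp: exp_diff exp_minus divide_inverse mult_ac)
    also have "\<dots> = (\<integral>\<xi>. complex_of_real (exp (s * v)) * (complex_of_real ((pi / exp v) powr (DIM('a) / 2)) *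
        (?B \<xi> * complex_of_real (exp (- pi\<^sup>2 * (norm \<xi>)\<^sup>2 / exp v)) * fchar (z \<bullet> \<xi>))) \<partial>lborel)"
      unfolding integral_mult_right_zero gaussian_inverse_fourier[OF fourier_integrable_1 exp_gt_zero] ..
    also have "\<dots> = (\<integral>\<xi>. complex_of_real (2 * pi * pi powr (DIM('a) / 2) * norm \<xi> * exp (- (1/2) * v - (pi * norm \<xi>)\<^sup>2 * exp (- v))) *
      (fourier \<psi> \<xi> * fchar (z \<bullet> \<xi>)) \<partial>lborel)"
    proof (intro Bochner_Integration.integral_cong refl)
      fix \<xi> :: 'a
      have "(pi / exp v) powr (DIM('a) / 2) = pi powr (DIM('a) / 2) * exp (- (DIM('a) / 2) * v)"
      proof -
        have "exp v powr (DIM('a) / 2) = exp (DIM('a) / 2 * v)" by (simp add: powr_def)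
        then show ?thesis unfolding powr_divide mult_minus_left exp_minus by (simp only: divide_inverse)
      qed
      moreover have "exp (- (1/2) * v - (pi * norm \<xi>)\<^sup>2 * exp (- v)) =
          exp (s * v) * exp (- (DIM('a) / 2) * v) * exp (- pi\<^sup>2 * (norm \<xi>)\<^sup>2 / exp v)"
        unfolding exp_add[symmetric] by (simp add: s_def exp_minus power_mult_distrib field_simps)
      ultimately have real: "?k \<xi> v = exp (s * v) * ((pi / exp v) powr (DIM('a) / 2) * (2 * (pi * norm \<xi>) * exp (- pi\<^sup>2 * (norm \<xi>)\<^sup>2 / exp v)))"
        by (simp only: mult_ac)
      show "complex_of_real (exp (s * v)) * (complex_of_real ((pi / exp v) powr (DIM('a) / 2)) *
        (?B \<xi> * complex_of_real (exp (- pi\<^sup>2 * (norm \<xi>)\<^sup>2 / exp v)) * fchar (z \<bullet> \<xi>))) = ?T \<xi> v"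
        unfolding real of_real_mult of_real_numeral by (simp only: mult_ac)
    qed
    finally show "(\<integral>x. ?F x v \<partial>lborel) = (\<integral>\<xi>. complex_of_real (2 * pi * pi powr (DIM('a) / 2) * norm \<xi> * exp (- (1/2) * v - (pi * norm \<xi>)\<^sup>2 * exp (- v))) *
      (fourier \<psi> \<xi> * fchar (z \<bullet> \<xi>)) \<partial>lborel)" .
  qed
  also have "\<dots> = (\<integral>\<xi>. \<integral>v. ?T \<xi> v \<partial>lborel \<partial>lborel)"
  proof (rule lborel_Fubini[symmetric])
    show "AE \<xi> in lborel. integrable lborel (?T \<xi>)"
    proof (rule eventually_mono[OF AE_lborel_singleton[of 0]])
      fix \<xi> :: 'a assume "\<xi> \<noteq> 0"
      from T[OF this] show "integrable lborel (?T \<xi>)"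
        by (intro integrable_mult_left) (simp only: has_bochner_integral_iff complex_of_real_integrable_eq)
    qed
    show "AE \<xi> in lborel. (\<integral>v. norm (?T \<xi> v) \<partial>lborel) \<le> c * norm (fourier \<psi> \<xi>)"
    proof (rule eventually_mono[OF AE_lborel_singleton[of 0]])
      fix \<xi> :: 'a assume \<xi>: "\<xi> \<noteq> 0"
      have nn: "0 \<le> ?k \<xi> v" for v by simp
      have "(\<integral>v. norm (?T \<xi> v) \<partial>lborel) = (\<integral>v. ?k \<xi> v * norm (fourier \<psi> \<xi>) \<partial>lborel)"
        using nn by (intro Bochner_Integration.integral_cong refl) (simp only: norm_mult norm_of_real norm_fchar abs_of_nonneg mult_1_right)
      also have "\<dots> = c * norm (fourier \<psi> \<xi>)"
        unfolding integral_mult_left_zero using T[OF \<xi>] by (simp only: has_bochner_integral_iff)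
      finally show "(\<integral>v. norm (?T \<xi> v) \<partial>lborel) \<le> c * norm (fourier \<psi> \<xi>)" by simp
    qed
    show "integrable lborel (\<lambda>\<xi>. c * norm (fourier \<psi> \<xi>))"
      using fourier_integrable_0 by (intro integrable_mult_right integrable_norm)
  qed measurable
  also have "\<dots> = (\<integral>\<xi>. complex_of_real c * (fourier \<psi> \<xi> * fchar (z \<bullet> \<xi>)) \<partial>lborel)"
  proof (intro integral_cong_AE)
    show "AE \<xi> in lborel. (\<integral>v. ?T \<xi> v \<partial>lborel) = complex_of_real c * (fourier \<psi> \<xi> * fchar (z \<bullet> \<xi>))"
    proof (rule eventually_mono[OF AE_lborel_singleton[of 0]])
      fix \<xi> :: 'a assume "\<xi> \<noteq> 0"
      from T[OF this] show "(\<integral>v. ?T \<xi> v \<partial>lborel) = complex_of_real c * (fourier \<psi> \<xi> * fchar (z \<bullet> \<xi>))"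
        by (simp only: integral_mult_left_zero integral_complex_of_real has_bochner_integral_iff)
    qed
  qed measurable
  also have "\<dots> = complex_of_real c * \<psi> z"
    unfolding integral_mult_right_zero inverse_fourier_fchar[symmetric] inverse_fourier_test_function ..
  finally have main: "complex_of_real (Gamma s) * (\<integral>x. ?H x * complex_of_real (riesz (DIM('a) - 1) (x - z)) \<partial>lborel) = complex_of_real c * \<psi> z" .
  have rc: "riesz_const DIM('a) = Gamma s / c" by (simp add: riesz_const_def s_def c_def add.commute)
  have "complex_of_real (riesz_const DIM('a)) * (\<integral>x. ?H x * complex_of_real (riesz (DIM('a) - 1) (x - z)) \<partial>lborel) =
      complex_of_real (Gamma s) * (\<integral>x. ?H x * complex_of_real (riesz (DIM('a) - 1) (x - z)) \<partial>lborel) / complex_of_real c"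
    by (simp add: rc)
  also have "\<dots> = \<psi> z"
    unfolding main by (simp add: c_def)
  finally show ?thesis .
qed

end

section \<open>The main result\<close>

text \<open>The kernel is symmetric: as a function of \<open>z\<close> it builds \<open>u x\<close>,
  as a function of \<open>x\<close> it is inverted by \<open>riesz_half_laplacian\<close>. The
  exchange is absolutely convergent because the potential is bounded and the half Laplacian of
  \<open>\<psi>\<close> is integrable.\<close>

lemma half_laplacian_distr_riesz:
  fixes f :: "'a::euclidean_space \<Rightarrow> real"
  assumes f_int: "integrable lborel f" and f_le: "\<And>x. \<bar>f x\<bar> \<le> B" and f_nonneg: "\<And>x. 0 \<le> f x"
    and D: "2 \<le> DIM('a)"
    and u: "\<And>x. u x = riesz_const DIM('a) * potential f (riesz (DIM('a) - 1)) (x, 0)"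
    and \<psi>: "\<psi> \<in> test_functions \<Omega>"
  shows "half_laplacian_distr u \<psi> = (LINT x:\<Omega>|lborel. complex_of_real (f x) * \<psi> x)"
proof -
  define K where "K = closure {x. \<psi> x \<noteq> 0}"
  have smooth: "smooth_on UNIV \<psi>" and K: "compact K" and sub: "K \<subseteq> \<Omega>"
    using \<psi> by (auto simp: test_functions_def K_def)
  have supp: "\<psi> x = 0" if "x \<notin> K" for x
    using that closure_subset[of "{x. \<psi> x \<noteq> 0}"] unfolding K_def by blast
  note ctx = smooth K supp
  let ?H = "half_laplacian \<psi>" and ?m = "DIM('a) - 1"
  let ?R = "\<lambda>x z. riesz ?m (x - z)"
  have [measurable]: "f \<in> borel_measurable borel" using f_int by auto
  have [measurable]: "?H \<in> borel_measurable borel" by (rule half_laplacian_measurable[OF ctx])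
  have R: "riesz ?m ((x, 0::real) - (z, 0)) = ?R x z" for x z :: 'a
    by (simp add: norm_Pair1)
  have int: "integrable lborel (\<lambda>z. f z * ?R x z)" for x
    using potential_integrable[OF f_int f_le hker.base[of ?m], of "(x, 0)"] D unfolding R by simp
  obtain M where M: "0 \<le> M" "\<And>x. potential f (riesz ?m) (x, 0) \<le> M"
    using riesz_potential_bounded[OF f_int f_le _ D f_nonneg, of ?m] D by auto
  let ?F = "\<lambda>x z. complex_of_real (riesz_const DIM('a)) * (?H x * complex_of_real (f z * ?R x z))"
  have "half_laplacian_distr u \<psi> = (\<integral>x. \<integral>z. ?F x z \<partial>lborel \<partial>lborel)"
    unfolding half_laplacian_distr_def
  proof (intro integral_cong_AE AE_I2)
    fix x
    show "complex_of_real (u x) * ?H x = (\<integral>z. ?F x z \<partial>lborel)"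
    proof -
      have "(\<integral>z. ?F x z \<partial>lborel) = complex_of_real (riesz_const DIM('a)) * (?H x * complex_of_real (potential f (riesz ?m) (x, 0)))"
        unfolding integral_mult_right_zero integral_complex_of_real potential_def R ..
      then show ?thesis unfolding u by (simp only: of_real_mult mult_ac)
    qed
    show "(\<lambda>x. complex_of_real (u x) * ?H x) \<in> borel_measurable lborel"
      unfolding u potential_def R by measurable
  qed measurable
  also have "\<dots> = (\<integral>z. \<integral>x. ?F x z \<partial>lborel \<partial>lborel)"
  proof (rule lborel_Fubini)
    show "AE x in lborel. integrable lborel (?F x)"
      using int by (intro AE_I2 integrable_mult_right) (simp only: complex_of_real_integrable_eq)
    show "AE x in lborel. (\<integral>z. norm (?F x z) \<partial>lborel) \<le> \<bar>riesz_const DIM('a)\<bar> * M * norm (?H x)"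
    proof (intro AE_I2)
      fix x
      have nn: "\<bar>f z * ?R x z\<bar> = f z * ?R x z" for z using f_nonneg[of z] by simp
      have "(\<integral>z. norm (?F x z) \<partial>lborel) = \<bar>riesz_const DIM('a)\<bar> * (norm (?H x) * potential f (riesz ?m) (x, 0))"
        unfolding norm_mult norm_of_real nn integral_mult_right_zero potential_def R ..
      also have "\<dots> \<le> \<bar>riesz_const DIM('a)\<bar> * (norm (?H x) * M)"
        by (intro mult_left_mono M) auto
      finally show "(\<integral>z. norm (?F x z) \<partial>lborel) \<le> \<bar>riesz_const DIM('a)\<bar> * M * norm (?H x)"
        by (simp only: mult_ac)
    qed
    show "integrable lborel (\<lambda>x. \<bar>riesz_const DIM('a)\<bar> * M * norm (?H x))"
      by (intro integrable_mult_right integrable_norm half_laplacian_integrable[OF ctx])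
  qed measurable
  also have "\<dots> = (\<integral>z. complex_of_real (f z) * \<psi> z \<partial>lborel)"
  proof (rule Bochner_Integration.integral_cong[OF refl])
    fix z
    have "(\<integral>x. ?F x z \<partial>lborel) = (\<integral>x. complex_of_real (f z) * (complex_of_real (riesz_const DIM('a)) * (?H x * complex_of_real (?R x z))) \<partial>lborel)"
      by (simp only: of_real_mult mult_ac)
    also have "\<dots> = complex_of_real (f z) * (complex_of_real (riesz_const DIM('a)) * (\<integral>x. ?H x * complex_of_real (?R x z) \<partial>lborel))"
      unfolding integral_mult_right_zero ..
    also have "complex_of_real (riesz_const DIM('a)) * (\<integral>x. ?H x * complex_of_real (?R x z) \<partial>lborel) = \<psi> z"
      by (rule riesz_half_laplacian[OF ctx D])
    finally show "(\<integral>x. ?F x z \<partial>lborel) = complex_of_real (f z) * \<psi> z" .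
  qed
  \<comment> \<open>\<open>\<psi>\<close> vanishes off \<open>K\<close>, which lies in \<Omega>, so
    restricting the integral loses nothing.\<close>
  also have "\<dots> = (LINT x:\<Omega>|lborel. complex_of_real (f x) * \<psi> x)"
    unfolding set_lebesgue_integral_def using supp sub
    by (intro Bochner_Integration.integral_cong) (auto simp: indicator_def)
  finally show ?thesis .
qed

theorem proposition5p4:
  fixes d :: nat and \<Omega> :: "(real ^ 'n) set" and P :: "(real ^ 'n) measure"
    and f :: "real ^ 'n \<Rightarrow> real" and \<beta> :: real
    and Pstar :: "((real ^ 'n) \<times> real) measure"
    and u :: "real ^ 'n \<Rightarrow> real" and U :: "(real ^ 'n) \<times> real \<Rightarrow> real"
  assumes dim: "d = CARD('n)" "even d" "d \<ge> 2"
    and "open \<Omega>"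
    and P: "prob_space P"
    and f_nonneg: "\<And>x. 0 \<le> f x"
    and f_meas: "f \<in> borel_measurable borel"
    and f_bounded: "bounded (range f)"
    and P_density: "P = density lborel (\<lambda>x. ennreal (f x))"
    and \<beta>: "0 < \<beta>" "\<beta> < 1"
    and f_holder: "holder_loc \<beta> \<Omega> f"
    and Pstar: "sets Pstar = sets borel"
      "\<And>A. A \<in> sets borel \<Longrightarrow>
         emeasure Pstar A = (\<integral>\<^sup>+ x. indicator A (x, 0) * ennreal (f x) \<partial>lborel)"
    and u: "\<And>x. u x = gamma_const d *
         (neg_laplacian ^^ ((d - 2) div 2)) (divergence (geometric_cdf P)) x"
    and U: "\<And>z. z \<in> UNIV \<times> {0<..} \<Longrightarrow> U z = 2 * gamma_const (d + 1) *
         (neg_laplacian ^^ ((d - 2) div 2)) (divergence (geometric_cdf Pstar)) z"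
  shows "(smooth_on (UNIV \<times> {0<..}) U \<and> (\<forall>z \<in> UNIV \<times> {0<..}. neg_laplacian U z = 0)) \<and>
    (\<exists>V. continuous_on (\<Omega> \<times> {0..}) V \<and>
         (\<forall>z \<in> \<Omega> \<times> {0<..}. V z = U z) \<and> (\<forall>x \<in> \<Omega>. V (x, 0) = u x)) \<and>
    (\<exists>g. restricts_to_continuous (half_laplacian_distr u) \<Omega> g \<and>
         (\<forall>x \<in> \<Omega>. f x = g x \<and>
            ((\<lambda>\<epsilon>. - partial_deriv (0, 1) U (x, \<epsilon>)) \<longlongrightarrow> g x) (at_right 0)))"
proof -
  let ?D = "DIM(real ^ 'n)"
  have D: "?D = d" using dim(1) by simp
  have D2: "2 \<le> ?D" using D dim(3) by simp
  define N where "N = (d - 2) div 2"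
  \<comment> \<open>Evenness makes the halving exact, so that \<open>N\<close> Laplacians lead from
    order 1 to exactly d - 1.\<close>
  have N: "d = 2 * N + 2" using dim(2,3) by (auto simp: N_def elim!: evenE)
  have N': "2 * N + 1 = ?D - 1" "2 * N + 1 < ?D" using D N by auto
  let ?S = "UNIV \<times> {0<..} :: ((real ^ 'n) \<times> real) set"
  have S: "open ?S" "?S \<subseteq> {w. snd w \<noteq> 0}" by (auto intro: open_Times)
  obtain B where f_le: "\<And>x. \<bar>f x\<bar> \<le> B"
    using f_bounded unfolding bounded_iff by auto
  \<comment> \<open>Integrability of the density is the total mass 1 of \<open>P\<close>.\<close>
  have f_int: "integrable lborel f"
  proof (rule integrableI_bounded)
    have "emeasure P UNIV = 1" using prob_space.emeasure_space_1[OF P] by (simp add: P_density)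
    then show "(\<integral>\<^sup>+x. ennreal (norm (f x)) \<partial>lborel) < \<infinity>"
      using f_meas f_nonneg by (simp add: P_density emeasure_density)
  qed (use f_meas in simp)
  let ?W = "potential f (riesz (?D - 1))" and ?c = "riesz_const ?D"
  have u': "u x = ?c * ?W (x, 0)" for x
  proof -
    have "u x = gamma_const d * ((real d - 1) * (\<Prod>i<N. real (2 * i + 1) * (real d - 2 - real (2 * i + 1)))) * ?W (x, 0)"
      using neg_laplacian_iter_horizontal[OF f_int f_le divergence_geometric_cdf[OF f_int f_le P_density f_nonneg D2] N'(2), of x]
      unfolding u N_def[symmetric] N'(1) D by (simp only: mult.assoc)
    then show ?thesis
      unfolding gamma_const_horizontal[OF N] D .
  qed
  \<comment> \<open>\<open>Pstar\<close> is given by its values on Borel sets; as an image measure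
    it fits \<open>geometric_cdf_inner\<close>.\<close>
  have Pstar_eq: "Pstar = distr (density lborel (\<lambda>x. ennreal (f x))) borel (\<lambda>z. (z, 0))"
  proof (rule measure_eqI)
    fix A assume "A \<in> sets Pstar"
    then have A: "A \<in> sets borel" using Pstar(1) by simp
    have m: "(\<lambda>z::real ^ 'n. (z, 0::real)) \<in> borel_measurable borel"
      by (intro borel_measurable_continuous_onI continuous_intros)
    have mA: "(\<lambda>z::real ^ 'n. (z, 0::real)) -` A \<in> sets borel"
      using measurable_sets[OF m A] by simp
    show "emeasure Pstar A = emeasure (distr (density lborel (\<lambda>x. ennreal (f x))) borel (\<lambda>z. (z, 0))) A"
      using f_meas A m mA
      by (auto simp: Pstar(2) emeasure_distr emeasure_density mult.commute indicator_def intro!: nn_integral_cong)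
  qed (use Pstar(1) in simp)
  have U': "U w = ?c * ?W w" if "w \<in> ?S" for w
  proof -
    have div: "divergence (geometric_cdf Pstar) v = real ?D * potential f (riesz 1) v" if "v \<in> ?S" for v
      using S(2) that by (intro divergence_geometric_cdf_off[OF f_int f_le Pstar_eq f_nonneg]) auto
    have "U w = 2 * gamma_const (d + 1) * (real d * (\<Prod>i<N. real (2 * i + 1) * (real d - 1 - real (2 * i + 1)))) * ?W w"
      using neg_laplacian_iter_off[OF f_int f_le S div that, of N]
      unfolding U[OF that] N_def[symmetric] N'(1) D by (simp only: mult.assoc)
    then show ?thesis
      unfolding gamma_const_off[OF N] D .
  qed
  have f_cont: "isCont f x" if "x \<in> \<Omega>" for x
    by (rule isCont_holder_loc[OF f_holder \<beta>(1) \<open>open \<Omega>\<close> that])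
  have W_cont: "continuous_on UNIV ?W"
    using D2 by (intro potential_continuous[OF f_int f_le hker.base]) auto
  show ?thesis
  proof (intro conjI)
    show "smooth_on ?S U"
      by (rule smooth_on_potential[OF f_int f_le hker.base U'])
    \<comment> \<open>The factor of \<open>neg_laplacian_off\<close> at order d - 1 is zero.\<close>
    show "\<forall>z\<in>?S. neg_laplacian U z = 0"
      using neg_laplacian_off[OF f_int f_le S U'] D2 by (simp add: of_nat_diff)
    show "\<exists>V. continuous_on (\<Omega> \<times> {0..}) V \<and> (\<forall>z \<in> \<Omega> \<times> {0<..}. V z = U z) \<and> (\<forall>x \<in> \<Omega>. V (x, 0) = u x)"
    proof (intro exI conjI ballI)
      \<comment> \<open>The extension is the potential itself, continuous on the whole product
        space.\<close>
      show "continuous_on (\<Omega> \<times> {0..}) (\<lambda>w. ?c * ?W w)"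
        by (intro continuous_intros continuous_on_subset[OF W_cont]) simp
    qed (use U' u' in auto)
    \<comment> \<open>The witness is \<open>f\<close> itself, continuous on \<Omega> by the local
      Hoelder condition.\<close>
    show "\<exists>g. restricts_to_continuous (half_laplacian_distr u) \<Omega> g \<and>
         (\<forall>x \<in> \<Omega>. f x = g x \<and> ((\<lambda>\<epsilon>. - partial_deriv (0, 1) U (x, \<epsilon>)) \<longlongrightarrow> g x) (at_right 0))"
    proof (intro exI[of _ f] conjI ballI refl)
      have "continuous_on \<Omega> f" using f_cont by (intro continuous_at_imp_continuous_on) blast
      then show "restricts_to_continuous (half_laplacian_distr u) \<Omega> f"
        unfolding restricts_to_continuous_def
        using half_laplacian_distr_riesz[OF f_int f_le f_nonneg D2 u'] by blast
      show "((\<lambda>\<epsilon>. - partial_deriv (0, 1) U (x, \<epsilon>)) \<longlongrightarrow> f x) (at_right 0)" if "x \<in> \<Omega>" for x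
        by (rule normal_derivative_limit[OF f_int f_le U' D2 f_cont[OF that]])
    qed
  qed
qed

end
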